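(* Assume that $\phi$ is Anosov on fibers and topological mixing on fibers. Then for any $\epsilon>0$ there exists $N\in\mathbb N$ such that for any $g\in L^\infty(\Omega,M)$ and any $n\ge N$ there exists a random periodic point $\tilde g\in L^\infty(\Omega,M)$ of $\phi$ with period $n$ such that $d_{L^\infty(\Omega,M)}(g,\tilde g)\le \epsilon$.
   Context: Setting: $M$ is a connected compact smooth Riemannian manifold without boundary, with induced distance $d_M$; $(\Omega,d_\Omega)$ is a compact metric space; $\theta:\Omega\to\Omega$ is a homeomorphism; $\mathrm{Diff}^2(M)$ is the space of $C^2$ diffeomorphisms of $M$ with the $C^2$ topology; $f:\Omega\to \mathrm{Diff}^2(M)$, $\omega\mapsto f_\omega$, is continuous; $\phi:M\times\Omega\to M\times\Omega$ is the skew product $\phi(x,\omega)=(f_\omega x,\theta\omega)$. Write $M_\omega=M\times\{\omega\}$. Anosov on fibers: for every $(x,\omega)$ there is a splitting $T_xM_\omega=E^u_{(x,\omega)}\oplus E^s_{(x,\omega)}$ depending continuously on $(x,\omega)\in M\times\Omega$, with $\dim E^u_{(x,\omega)},\dim E^s_{(x,\omega)}>0$, $Df_\omega(x)E^\tau_{(x,\omega)}=E^\tau_{\phi(x,\omega)}$ for $\tau=u,s$, and a constant $\lambda_0>0$ such that for all $(x,\omega)$: $|Df_\omega(x)\xi|\ge e^{\lambda_0}|\xi|$ for $\xi\in E^u_{(x,\omega)}$ and $|Df_\omega(x)\eta|\le e^{-\lambda_0}|\eta|$ for $\eta\in E^s_{(x,\omega)}$. Topological mixing on fibers: for any nonempty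 open sets $U,V\subset M$ there exists $N>0$ such that for all $n\ge N$ and all $\omega\in\Omega$, $\phi^n(U\times\{\omega\})\cap (V\times\{\theta^n\omega\})\ne\emptyset$. $L^\infty(\Omega,M)$ is the space of Borel measurable maps $\Omega\to M$ with metric $d_{L^\infty(\Omega,M)}(g_1,g_2)=\sup_{\omega\in\Omega}d_M(g_1(\omega),g_2(\omega))$. The map $\tilde\phi$ on $L^\infty(\Omega,M)$ is $\tilde\phi(g)(\omega)=f_{\theta^{-1}\omega}\,g(\theta^{-1}\omega)$. A random periodic orbit of period $n$ is a family $g_1,\dots,g_n\in L^\infty(\Omega,M)$ with $\tilde\phi(g_i)=g_{i+1 \bmod n}$ for $1\le i\le n$ (equivalently $\phi(\mathrm{graph}(g_i))=\mathrm{graph}(g_{i+1\bmod n})$); each $g_i$ is called a random periodic point with period $n$. *)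

theory Defs
  imports "HOL-Analysis.Analysis"
begin

section \<open>Differentiability of class \<open>C\<^sup>k\<close> in Euclidean space\<close>

text \<open>Only used on open sets \<open>S\<close>. Requiring all directional derivatives of a differentiable map to be
  of class \<open>C\<^sup>k\<close> amounts to requiring this of its total derivative, by finite dimension.\<close>

primrec Ck_on :: "nat \<Rightarrow> 'a::euclidean_space set \<Rightarrow> ('a \<Rightarrow> 'b::euclidean_space) \<Rightarrow> bool" where
  "Ck_on 0 S F \<longleftrightarrow> continuous_on S F"
| "Ck_on (Suc k) S F \<longleftrightarrow>
     (\<forall>y\<in>S. F differentiable (at y)) \<and> (\<forall>v. Ck_on k S (\<lambda>y. frechet_derivative F (at y) v))"

definition smooth_on :: "'a::euclidean_space set \<Rightarrow> ('a \<Rightarrow> 'b::euclidean_space) \<Rightarrow> bool" where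
  "smooth_on S F \<longleftrightarrow> (\<forall>k. Ck_on k S F)"

text \<open>The derivatives of \<open>F\<close> and \<open>H\<close> of all orders up to \<open>k\<close>, as multilinear maps, differ by less
  than \<open>e\<close> at every point of \<open>K\<close>: the unit vectors \<open>v\<close> of the recursion are the arguments of these
  multilinear maps.\<close>

primrec Ck_close ::
    "nat \<Rightarrow> 'a::euclidean_space set \<Rightarrow> real \<Rightarrow> ('a \<Rightarrow> 'b::euclidean_space) \<Rightarrow> ('a \<Rightarrow> 'b) \<Rightarrow> bool" where
  "Ck_close 0 K e F H \<longleftrightarrow> (\<forall>y\<in>K. norm (F y - H y) < e)"
| "Ck_close (Suc k) K e F H \<longleftrightarrow>
     (\<forall>y\<in>K. norm (F y - H y) < e) \<and>
     (\<forall>v. norm v = 1 \<longrightarrow>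
        Ck_close k K e (\<lambda>y. frechet_derivative F (at y) v) (\<lambda>y. frechet_derivative H (at y) v))"


section \<open>Smooth manifolds without boundary\<close>

text \<open>The underlying set of a manifold is the whole type \<open>'m\<close>; it is modelled on \<open>'e\<close>. A chart is a
  pair of its domain and its coordinate map (whose values off the domain are irrelevant).\<close>

type_synonym ('m, 'e) chart = "'m set \<times> ('m \<Rightarrow> 'e)"

definition chart_inv :: "('m, 'e) chart \<Rightarrow> 'e \<Rightarrow> 'm" where
  "chart_inv c = inv_into (fst c) (snd c)"

definition is_chart :: "('m::topological_space, 'e::euclidean_space) chart \<Rightarrow> bool" where
  "is_chart c \<longleftrightarrow> open (fst c) \<and> open (snd c ` fst c) \<and>
     homeomorphism (fst c) (snd c ` fst c) (snd c) (chart_inv c)"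

definition smooth_atlas :: "('m::topological_space, 'e::euclidean_space) chart set \<Rightarrow> bool" where
  "smooth_atlas A \<longleftrightarrow>
     (\<forall>c\<in>A. is_chart c) \<and> (\<Union>c\<in>A. fst c) = UNIV \<and>
     (\<forall>c\<in>A. \<forall>d\<in>A. smooth_on (snd c ` (fst c \<inter> fst d)) (snd d \<circ> chart_inv c))"

text \<open>The tangent space at \<open>x\<close> is the model space \<open>'e\<close>, a vector being represented by its coordinates
  in one fixed chart of the atlas around \<open>x\<close>. This choice is not continuous in \<open>x\<close>, so continuity and
  smoothness of tangent objects are always expressed in a chart \<open>c\<close>, through the mutually inverse
  changes of coordinates \<open>tangent_to_chart A c x\<close> and \<open>tangent_from_chart A c x\<close> for \<open>x \<in> fst c\<close>.\<close>

definition chart_at :: "('m, 'e) chart set \<Rightarrow> 'm \<Rightarrow> ('m, 'e) chart" where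
  "chart_at A x = (SOME c. c \<in> A \<and> x \<in> fst c)"

definition tangent_to_chart ::
    "('m, 'e::euclidean_space) chart set \<Rightarrow> ('m, 'e) chart \<Rightarrow> 'm \<Rightarrow> 'e \<Rightarrow> 'e" where
  "tangent_to_chart A c x =
     frechet_derivative (snd c \<circ> chart_inv (chart_at A x)) (at (snd (chart_at A x) x))"

definition tangent_from_chart ::
    "('m, 'e::euclidean_space) chart set \<Rightarrow> ('m, 'e) chart \<Rightarrow> 'm \<Rightarrow> 'e \<Rightarrow> 'e" where
  "tangent_from_chart A c x = frechet_derivative (snd (chart_at A x) \<circ> chart_inv c) (at (snd c x))"

definition tangent_map ::
    "('m, 'e::euclidean_space) chart set \<Rightarrow> ('m \<Rightarrow> 'm) \<Rightarrow> 'm \<Rightarrow> 'e \<Rightarrow> 'e" where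
  "tangent_map A F x =
     frechet_derivative (snd (chart_at A (F x)) \<circ> F \<circ> chart_inv (chart_at A x))
       (at (snd (chart_at A x) x))"

definition Ck_map ::
    "nat \<Rightarrow> ('m::topological_space, 'e::euclidean_space) chart set \<Rightarrow> ('m \<Rightarrow> 'm) \<Rightarrow> bool" where
  "Ck_map k A F \<longleftrightarrow> continuous_on UNIV F \<and>
     (\<forall>c\<in>A. \<forall>d\<in>A. Ck_on k (snd c ` (fst c \<inter> F -` fst d)) (snd d \<circ> F \<circ> chart_inv c))"

definition Diff ::
    "nat \<Rightarrow> ('m::topological_space, 'e::euclidean_space) chart set \<Rightarrow> ('m \<Rightarrow> 'm) set" where
  "Diff k A = {F. bij F \<and> Ck_map k A F \<and> Ck_map k A (inv F)}"

text \<open>The \<open>C\<^sup>k\<close> topology, given by Hirsch's subbasis of compact-open \<open>C\<^sup>k\<close> neighbourhoods.\<close>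

definition Diff_nbhd ::
    "nat \<Rightarrow> ('m::topological_space, 'e::euclidean_space) chart set \<Rightarrow> ('m \<Rightarrow> 'm) \<Rightarrow>
       ('m, 'e) chart \<Rightarrow> ('m, 'e) chart \<Rightarrow> 'm set \<Rightarrow> real \<Rightarrow> ('m \<Rightarrow> 'm) set" where
  "Diff_nbhd k A F c d K e =
     {H \<in> Diff k A. H ` K \<subseteq> fst d \<and>
        Ck_close k (snd c ` K) e (snd d \<circ> F \<circ> chart_inv c) (snd d \<circ> H \<circ> chart_inv c)}"

definition Diff_topology ::
    "nat \<Rightarrow> ('m::topological_space, 'e::euclidean_space) chart set \<Rightarrow> ('m \<Rightarrow> 'm) topology" where
  "Diff_topology k A = topology_generated_by
     {Diff_nbhd k A F c d K e | F c d K e.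
        F \<in> Diff k A \<and> c \<in> A \<and> d \<in> A \<and> compact K \<and> K \<subseteq> fst c \<and> F ` K \<subseteq> fst d \<and> 0 < e}"


section \<open>Riemannian metrics\<close>

definition riemannian_metric ::
    "('m, 'e::euclidean_space) chart set \<Rightarrow> ('m \<Rightarrow> 'e \<Rightarrow> 'e \<Rightarrow> real) \<Rightarrow> bool" where
  "riemannian_metric A G \<longleftrightarrow>
     (\<forall>x. bilinear (G x) \<and> (\<forall>u v. G x u v = G x v u) \<and> (\<forall>v. v \<noteq> 0 \<longrightarrow> 0 < G x v v)) \<and>
     (\<forall>c\<in>A. \<forall>u v. smooth_on (snd c ` fst c)
        (\<lambda>y. let x = chart_inv c y
              in G x (tangent_from_chart A c x u) (tangent_from_chart A c x v)))"

definition tangent_norm :: "('m \<Rightarrow> 'e \<Rightarrow> 'e \<Rightarrow> real) \<Rightarrow> 'm \<Rightarrow> 'e \<Rightarrow> real" where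
  "tangent_norm G x v = sqrt (G x v v)"

definition C1_curve_on ::
    "('m::topological_space, 'e::euclidean_space) chart set \<Rightarrow> real \<Rightarrow> real \<Rightarrow> (real \<Rightarrow> 'm) \<Rightarrow> bool" where
  "C1_curve_on A a b \<gamma> \<longleftrightarrow> continuous_on {a..b} \<gamma> \<and>
     (\<forall>c\<in>A. (\<forall>t\<in>{a..b} \<inter> \<gamma> -` fst c. (snd c \<circ> \<gamma>) differentiable (at t within {a..b})) \<and>
       continuous_on ({a..b} \<inter> \<gamma> -` fst c) (\<lambda>t. vector_derivative (snd c \<circ> \<gamma>) (at t within {a..b})))"

text \<open>The curve is \<open>C\<^sup>1\<close> up to the endpoints on each closed interval between consecutive break points.
  (The library's \<open>piecewise_C1_differentiable_on\<close> would allow unbounded velocities near them.)\<close>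

definition piecewise_C1_curve ::
    "('m::topological_space, 'e::euclidean_space) chart set \<Rightarrow> (real \<Rightarrow> 'm) \<Rightarrow> bool" where
  "piecewise_C1_curve A \<gamma> \<longleftrightarrow> (\<exists>P. finite P \<and>
     (\<forall>a b. 0 \<le> a \<and> a < b \<and> b \<le> 1 \<and> {a<..<b} \<inter> P = {} \<longrightarrow> C1_curve_on A a b \<gamma>))"

definition curve_length ::
    "('m, 'e::euclidean_space) chart set \<Rightarrow> ('m \<Rightarrow> 'e \<Rightarrow> 'e \<Rightarrow> real) \<Rightarrow> (real \<Rightarrow> 'm) \<Rightarrow> real" where
  "curve_length A G \<gamma> = integral {0..1}
     (\<lambda>t. tangent_norm G (\<gamma> t) (vector_derivative (snd (chart_at A (\<gamma> t)) \<circ> \<gamma>) (at t)))"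

definition riemannian_distance ::
    "('m::topological_space, 'e::euclidean_space) chart set \<Rightarrow> ('m \<Rightarrow> 'e \<Rightarrow> 'e \<Rightarrow> real) \<Rightarrow>
       'm \<Rightarrow> 'm \<Rightarrow> real" where
  "riemannian_distance A G x y =
     Inf {curve_length A G \<gamma> | \<gamma>. piecewise_C1_curve A \<gamma> \<and> \<gamma> 0 = x \<and> \<gamma> 1 = y}"


section \<open>Random dynamics\<close>

definition skew_product :: "('w \<Rightarrow> 'm \<Rightarrow> 'm) \<Rightarrow> ('w \<Rightarrow> 'w) \<Rightarrow> 'm \<times> 'w \<Rightarrow> 'm \<times> 'w" where
  "skew_product f \<theta> = (\<lambda>(x, \<omega>). (f \<omega> x, \<theta> \<omega>))"

text \<open>Near every point, and in every chart there, the subspaces \<open>E (x, \<omega>)\<close> of the tangent spaces at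
  \<open>x\<close> have a continuous frame.\<close>

definition continuous_subbundle ::
    "('m::topological_space, 'e::euclidean_space) chart set \<Rightarrow>
       ('m \<times> 'w::topological_space \<Rightarrow> 'e set) \<Rightarrow> bool" where
  "continuous_subbundle A E \<longleftrightarrow>
     (\<forall>c\<in>A. \<forall>p\<in>fst c \<times> UNIV. \<exists>W (k::nat) b.
        open W \<and> p \<in> W \<and> W \<subseteq> fst c \<times> UNIV \<and>
        (\<forall>i<k. continuous_on W (b i)) \<and>
        (\<forall>q\<in>W. inj_on (\<lambda>i. b i q) {..<k} \<and> independent ((\<lambda>i. b i q) ` {..<k}) \<and>
           span ((\<lambda>i. b i q) ` {..<k}) = tangent_to_chart A c (fst q) ` E q))"

definition anosov_on_fibers ::
    "('m::topological_space, 'e::euclidean_space) chart set \<Rightarrow> ('m \<Rightarrow> 'e \<Rightarrow> 'e \<Rightarrow> real) \<Rightarrow>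
       ('w::topological_space \<Rightarrow> 'm \<Rightarrow> 'm) \<Rightarrow> ('w \<Rightarrow> 'w) \<Rightarrow> bool" where
  "anosov_on_fibers A G f \<theta> \<longleftrightarrow>
     (\<exists>(Eu :: 'm \<times> 'w \<Rightarrow> 'e set) (Es :: 'm \<times> 'w \<Rightarrow> 'e set).
        (\<forall>p. subspace (Eu p) \<and> subspace (Es p) \<and>
           Eu p \<inter> Es p = {0} \<and> {u + s | u s. u \<in> Eu p \<and> s \<in> Es p} = UNIV \<and>
           0 < dim (Eu p) \<and> 0 < dim (Es p)) \<and>
        continuous_subbundle A Eu \<and> continuous_subbundle A Es \<and>
        (\<forall>x \<omega>. tangent_map A (f \<omega>) x ` Eu (x, \<omega>) = Eu (skew_product f \<theta> (x, \<omega>)) \<and>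
               tangent_map A (f \<omega>) x ` Es (x, \<omega>) = Es (skew_product f \<theta> (x, \<omega>))) \<and>
        (\<exists>\<kappa>>0. \<forall>x \<omega>.
           (\<forall>\<xi>\<in>Eu (x, \<omega>). tangent_norm G (f \<omega> x) (tangent_map A (f \<omega>) x \<xi>)
                              \<ge> exp \<kappa> * tangent_norm G x \<xi>) \<and>
           (\<forall>\<eta>\<in>Es (x, \<omega>). tangent_norm G (f \<omega> x) (tangent_map A (f \<omega>) x \<eta>)
                              \<le> exp (- \<kappa>) * tangent_norm G x \<eta>)))"

definition mixing_on_fibers ::
    "('w \<Rightarrow> 'm::topological_space \<Rightarrow> 'm) \<Rightarrow> ('w \<Rightarrow> 'w) \<Rightarrow> bool" where
  "mixing_on_fibers f \<theta> \<longleftrightarrow>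
     (\<forall>U V. open U \<and> U \<noteq> {} \<and> open V \<and> V \<noteq> {} \<longrightarrow>
        (\<exists>N>0. \<forall>n\<ge>N. \<forall>\<omega>.
           (skew_product f \<theta> ^^ n) ` (U \<times> {\<omega>}) \<inter> V \<times> {(\<theta> ^^ n) \<omega>} \<noteq> {}))"

definition Linfty :: "('w::topological_space \<Rightarrow> 'm::topological_space) set" where
  "Linfty = borel_measurable borel"

definition Linfty_dist :: "('w \<Rightarrow> 'm::metric_space) \<Rightarrow> ('w \<Rightarrow> 'm) \<Rightarrow> real" where
  "Linfty_dist g h = (SUP \<omega>. dist (g \<omega>) (h \<omega>))"

definition graph_transform ::
    "('w \<Rightarrow> 'm \<Rightarrow> 'm) \<Rightarrow> ('w \<Rightarrow> 'w) \<Rightarrow> ('w \<Rightarrow> 'm) \<Rightarrow> 'w \<Rightarrow> 'm" where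
  "graph_transform f \<theta> g = (\<lambda>\<omega>. f (inv \<theta> \<omega>) (g (inv \<theta> \<omega>)))"

text \<open>The indices run over \<open>1, \<dots>, n\<close>, so the cyclic successor of \<open>i\<close> is \<open>i mod n + 1\<close>.\<close>

definition random_periodic_orbit ::
    "('w::topological_space \<Rightarrow> 'm::topological_space \<Rightarrow> 'm) \<Rightarrow> ('w \<Rightarrow> 'w) \<Rightarrow> nat \<Rightarrow>
       (nat \<Rightarrow> 'w \<Rightarrow> 'm) \<Rightarrow> bool" where
  "random_periodic_orbit f \<theta> n g \<longleftrightarrow>
     (\<forall>i\<in>{1..n}. g i \<in> Linfty \<and> graph_transform f \<theta> (g i) = g (i mod n + 1))"

definition random_periodic_point ::
    "('w::topological_space \<Rightarrow> 'm::topological_space \<Rightarrow> 'm) \<Rightarrow> ('w \<Rightarrow> 'w) \<Rightarrow> nat \<Rightarrow>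
       ('w \<Rightarrow> 'm) \<Rightarrow> bool" where
  "random_periodic_point f \<theta> n h \<longleftrightarrow>
     (\<exists>g. random_periodic_orbit f \<theta> n g \<and> (\<exists>i\<in>{1..n}. h = g i))"

end

theory Submission
  imports Defs
begin

text \<open>
Given a measurable \<open>g\<close> and a large \<open>n\<close>, mixing provides near each \<open>g \<omega>\<close> a point whose \<open>n\<close>-th iterate is
near \<open>g (\<theta>\<^sup>n \<omega>)\<close> (\<open>uniform_mixing\<close>). The bound on \<open>n\<close> is uniform in \<open>\<omega>\<close> by assumption and in the points
by compactness, and the point can be chosen measurably (\<open>measurable_connection\<close>). Following its orbit for
\<open>n\<close> steps, jumping to the point chosen over \<open>\<theta>\<^sup>n \<omega>\<close>, and so on in both directions of time, defines a
two-sided pseudo-orbit over the \<open>\<theta>\<close>-orbit of \<open>\<omega>\<close>. Since the system is hyperbolic on fibres, exactly one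
true orbit stays close to it (\<open>shadowing\<close>); let \<open>h \<omega>\<close> be its point at time \<open>0\<close>.

The uniqueness of the shadowing orbit does the rest. The pseudo-orbit over \<open>\<theta>\<^sup>n \<omega>\<close> is the one over \<open>\<omega>\<close>
shifted by \<open>n\<close>, so the \<open>n\<close>-th iterate of \<open>h \<omega>\<close> is \<open>h (\<theta>\<^sup>n \<omega>)\<close>, which means that \<open>h\<close> is periodic. And \<open>h \<omega>\<close>
is the only solution of countably many closed conditions on a point of a compact space which depend
measurably on \<open>\<omega>\<close>, so \<open>h\<close> is measurable (\<open>measurable_unique_solution\<close>).

For the shadowing lemma, the points near the pseudo-orbit are written in charts centred at its points.
An orbit is then a bounded sequence with \<open>v (j + 1) = F j (v j)\<close>, where \<open>F j\<close> differs by a map of small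
Lipschitz constant from a linear map that preserves the splitting, expands its unstable part and
contracts its stable part. Solving the unstable components backwards and the stable components forwards
is a contraction of the space of bounded sequences (\<open>hyperbolic_sequence\<close>). The constants involved are
uniform because \<open>M\<close> and \<open>\<Omega>\<close> are compact and everything depends continuously on the point and the
parameter: the maps \<open>f \<omega>\<close> and their derivatives in charts (\<open>isCont_f\<close>, \<open>continuous_on_Df\<close>), the norm
(\<open>continuous_on_chart_norm\<close>) and the projections along the splitting (\<open>isCont_projection_along\<close>).
\<close>

section \<open>Bounded orbits of hyperbolic sequences of maps\<close>

text \<open>The contraction principle for sequences measured by a norm that varies with the index. The norms
\<open>N i\<close> are uniformly equivalent to the given one, so the iterates of \<open>\<Gamma>\<close> converge at each index and the
error bounds, which are uniform in the index, survive in the limit.\<close>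

lemma weighted_contraction_fixed_point:
  fixes N :: "'i \<Rightarrow> 'a::banach \<Rightarrow> real" and \<Gamma> :: "('i \<Rightarrow> 'a) \<Rightarrow> 'i \<Rightarrow> 'a"
  assumes tri: "\<And>i u v. N i (u + v) \<le> N i u + N i v"
    and C: "0 < C"
    and upper: "\<And>i v. N i v \<le> C * norm v"
    and lower: "\<And>i v. norm v \<le> C * N i v"
    and \<rho>: "0 \<le> \<rho>" "\<rho> < 1"
    and start: "\<And>i. N i (\<Gamma> (\<lambda>_. 0) i) \<le> (1 - \<rho>) * s"
    and contr: "\<And>v w D i. \<lbrakk>\<And>i. N i (v i) \<le> s; \<And>i. N i (w i) \<le> s; \<And>i. N i (v i - w i) \<le> D\<rbrakk>
                  \<Longrightarrow> N i (\<Gamma> v i - \<Gamma> w i) \<le> \<rho> * D"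
  obtains v where "\<And>i. N i (v i) \<le> s" and "\<Gamma> v = v"
proof -
  define V where "V k = (\<Gamma> ^^ k) (\<lambda>_. 0)" for k
  have V0: "V 0 = (\<lambda>_. 0)" and VS: "V (Suc k) = \<Gamma> (V k)" for k
    by (auto simp: V_def)
  have pos: "0 \<le> N i v" for i v
    using lower[of v i] C norm_ge_zero[of v] by (meson order_trans zero_le_mult_iff not_le)
  have N0: "N i 0 = 0" for i
    using upper[of i 0] pos[of i 0] by simp
  have s0: "0 \<le> s"
    using start[of undefined] pos[of undefined "\<Gamma> (\<lambda>_. 0) undefined"] \<rho>
    by (metis diff_gt_0_iff_gt dual_order.trans zero_le_mult_iff not_le)
  have ball: "N i (V k i) \<le> s" for i k
  proof (induction k arbitrary: i)
    case 0
    then show ?case by (simp add: V0 N0 s0)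
  next
    case (Suc k)
    have "N i (\<Gamma> (V k) i - \<Gamma> (\<lambda>_. 0) i) \<le> \<rho> * s"
      by (rule contr) (use Suc s0 in \<open>auto simp: N0\<close>)
    then have "N i (\<Gamma> (V k) i) \<le> \<rho> * s + (1 - \<rho>) * s"
      using tri[of i "\<Gamma> (V k) i - \<Gamma> (\<lambda>_. 0) i" "\<Gamma> (\<lambda>_. 0) i"] start[of i] by simp
    then show ?case by (simp add: VS algebra_simps)
  qed
  have step: "N i (V (Suc k) i - V k i) \<le> \<rho> ^ k * ((1 - \<rho>) * s)" for i k
  proof (induction k arbitrary: i)
    case 0
    then show ?case using start[of i] by (simp add: V0 VS)
  next
    case (Suc k)
    have "N i (\<Gamma> (V (Suc k)) i - \<Gamma> (V k) i) \<le> \<rho> * (\<rho> ^ k * ((1 - \<rho>) * s))"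
      by (rule contr) (use Suc ball in auto)
    then show ?case by (simp add: VS mult.assoc)
  qed
  have tail: "N i (V (k + m) i - V k i) \<le> \<rho> ^ k * s * (1 - \<rho> ^ m)" for i k m
  proof (induction m)
    case 0
    then show ?case by (simp add: N0)
  next
    case (Suc m)
    have "N i (V (k + Suc m) i - V k i)
        \<le> N i (V (Suc (k + m)) i - V (k + m) i) + N i (V (k + m) i - V k i)"
      using tri[of i "V (Suc (k + m)) i - V (k + m) i" "V (k + m) i - V k i"] by simp
    also have "\<dots> \<le> \<rho> ^ (k + m) * ((1 - \<rho>) * s) + \<rho> ^ k * s * (1 - \<rho> ^ m)"
      using step[of i "k + m"] Suc by simp
    finally show ?case by (simp add: power_add algebra_simps)
  qed
  have tail': "N i (V (k + m) i - V k i) \<le> \<rho> ^ k * s" for i k m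
    by (rule order_trans[OF tail]) (use \<rho> s0 in \<open>auto intro!: mult_left_le\<close>)
  have zero: "(\<lambda>k. a * \<rho> ^ k) \<longlonglongrightarrow> 0" for a
    using \<rho> by (auto intro!: tendsto_mult_right_zero LIMSEQ_realpow_zero)
  have "Cauchy (\<lambda>k. V k i)" for i
  proof (rule CauchyI)
    fix e :: real assume e: "0 < e"
    from zero[of "2 * C * s"] e obtain k where k: "2 * C * s * \<rho> ^ k < e"
      by (metis (lifting) LIMSEQ_D diff_zero le_refl abs_less_iff real_norm_def)
    have *: "norm (V m i - V k i) \<le> C * (\<rho> ^ k * s)" if "k \<le> m" for m
      using lower[of "V m i - V k i" i] tail'[of i k "m - k"] that C
      by (smt (verit) add_diff_inverse_nat mult_left_mono not_le)
    show "\<exists>M. \<forall>m\<ge>M. \<forall>n\<ge>M. norm (V m i - V n i) < e"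
    proof (intro exI[of _ k] allI impI)
      fix m n assume mn: "k \<le> m" "k \<le> n"
      have "norm (V m i - V n i) \<le> norm (V m i - V k i) + norm (V n i - V k i)"
        by (metis norm_triangle_ineq4 diff_diff_eq2 diff_add_cancel)
      also have "\<dots> \<le> 2 * C * s * \<rho> ^ k" using *[OF mn(1)] *[OF mn(2)] by (simp add: algebra_simps)
      also have "\<dots> < e" by fact
      finally show "norm (V m i - V n i) < e" .
    qed
  qed
  then have "\<exists>l. (\<lambda>k. V k i) \<longlonglongrightarrow> l" for i
    by (simp add: Cauchy_convergent_iff convergent_def)
  then obtain v where v: "(\<lambda>k. V k i) \<longlonglongrightarrow> v i" for i by metis
  have Nlim: "(\<lambda>m. C * norm (v i - V (k + m) i)) \<longlonglongrightarrow> 0" for i k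
    using tendsto_diff[OF tendsto_const[of "v i"] LIMSEQ_ignore_initial_segment[OF v[of i], of k]]
    by (intro tendsto_mult_right_zero tendsto_norm_zero) (simp add: add.commute)
  have near: "N i (v i - V k i) \<le> s * \<rho> ^ k" for i k
  proof (rule LIMSEQ_le_const)
    show "(\<lambda>m. C * norm (v i - V (k + m) i) + s * \<rho> ^ k) \<longlonglongrightarrow> s * \<rho> ^ k"
      using tendsto_add[OF Nlim tendsto_const] by simp
    have "N i (v i - V k i) \<le> C * norm (v i - V (k + m) i) + s * \<rho> ^ k" for m
      using tri[of i "v i - V (k + m) i" "V (k + m) i - V k i"] upper[of i "v i - V (k + m) i"]
        tail'[of i k m] by (simp add: mult.commute)
    then show "\<exists>N'. \<forall>m\<ge>N'. N i (v i - V k i) \<le> C * norm (v i - V (k + m) i) + s * \<rho> ^ k" by blast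
  qed
  have vs: "N i (v i) \<le> s" for i using near[of i 0] by (simp add: V0)
  have "\<Gamma> v i = v i" for i
  proof -
    have "N i (\<Gamma> v i - v i) \<le> s * \<rho> * \<rho> ^ k + C * norm (V (Suc k) i - v i)" for k
    proof -
      have "N i (\<Gamma> v i - \<Gamma> (V k) i) \<le> \<rho> * (s * \<rho> ^ k)"
        by (rule contr) (use vs ball near in auto)
      then show ?thesis
        using tri[of i "\<Gamma> v i - \<Gamma> (V k) i" "V (Suc k) i - v i"] upper[of i "V (Suc k) i - v i"]
        by (simp add: VS mult_ac)
    qed
    moreover have "(\<lambda>k. s * \<rho> * \<rho> ^ k + C * norm (V (Suc k) i - v i)) \<longlonglongrightarrow> 0"
      using tendsto_diff[OF LIMSEQ_Suc[OF v[of i]] tendsto_const[of "v i"]]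
      by (intro tendsto_add_zero zero tendsto_mult_right_zero tendsto_norm_zero) simp
    ultimately have "N i (\<Gamma> v i - v i) \<le> 0"
      by (intro LIMSEQ_le_const) auto
    then have "norm (\<Gamma> v i - v i) \<le> 0"
      using lower[of "\<Gamma> v i - v i" i] C by (smt (verit) mult_nonneg_nonpos)
    then show ?thesis by simp
  qed
  then show ?thesis using that vs by blast
qed

text \<open>Invertible linear maps \<open>A j\<close> that intertwine projections \<open>P j\<close>, expand the range of \<open>P j\<close> and contract
its kernel, with respect to norms \<open>nrm j\<close> for which all constants are uniform in \<open>j\<close>. The aim is to
find the bounded orbits \<open>v (j + 1) = F j (v j)\<close> of small perturbations \<open>F\<close> of \<open>A\<close>.\<close>

locale hyperbolic_sequence =
  fixes P A A' :: "int \<Rightarrow> 'e::euclidean_space \<Rightarrow> 'e"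
    and nrm :: "int \<Rightarrow> 'e \<Rightarrow> real" and \<kappa> B :: real
  assumes P_linear: "linear (P j)" and P_idem: "P j (P j v) = P j v"
    and A_linear: "linear (A j)" and A'_linear: "linear (A' j)"
    and A'_A: "A' j (A j v) = v" and A_A': "A j (A' j v) = v"
    and A_P: "A j (P j v) = P (j + 1) (A j v)"
    and nrm_triangle: "nrm j (u + v) \<le> nrm j u + nrm j v"
    and nrm_upper: "nrm j v \<le> B * norm v" and nrm_lower: "norm v \<le> B * nrm j v"
    and P_bound: "norm (P j v) \<le> B * norm v"
    and B: "1 \<le> B" and \<kappa>: "0 \<le> \<kappa>" "\<kappa> < 1"
    and unstable: "nrm j (P j v) \<le> \<kappa> * nrm (j + 1) (A j (P j v))"
    and stable: "nrm (j + 1) (A j (v - P j v)) \<le> \<kappa> * nrm j (v - P j v)"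
begin

text \<open>The maximum of the two components, rather than \<open>nrm j\<close> itself: for it a contraction rate in each of
the two components separately is a contraction rate.\<close>

definition box_norm :: "int \<Rightarrow> 'e \<Rightarrow> real" where
  "box_norm j v = max (nrm j (P j v)) (nrm j (v - P j v))"

lemma box_norm_triangle: "box_norm j (u + v) \<le> box_norm j u + box_norm j v"
proof -
  have "nrm j (P j (u + v)) \<le> nrm j (P j u) + nrm j (P j v)"
    using nrm_triangle by (simp add: linear_add[OF P_linear])
  moreover have "nrm j (u + v - P j (u + v)) \<le> nrm j (u - P j u) + nrm j (v - P j v)"
    using nrm_triangle[of j "u - P j u" "v - P j v"]
    by (simp add: linear_add[OF P_linear] algebra_simps)
  ultimately show ?thesis unfolding box_norm_def by linarith
qed

lemma P_part_bound: "nrm j (P j v) \<le> 2 * B\<^sup>2 * norm v"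
proof -
  have "nrm j (P j v) \<le> B * (B * norm v)"
    using nrm_upper[of j "P j v"] P_bound[of j v] B by (meson mult_left_mono order_trans zero_le_one)
  also have "\<dots> \<le> 2 * B\<^sup>2 * norm v" using B by (simp add: power2_eq_square)
  finally show ?thesis .
qed

lemma Q_part_bound: "nrm j (v - P j v) \<le> 2 * B\<^sup>2 * norm v"
proof -
  have "norm (v - P j v) \<le> norm v + B * norm v"
    using norm_triangle_ineq4[of v "P j v"] P_bound[of j v] by linarith
  also have "\<dots> \<le> 2 * B * norm v" using mult_right_mono[OF B norm_ge_zero[of v]] by simp
  finally have "B * norm (v - P j v) \<le> B * (2 * B * norm v)" using B by simp
  then show ?thesis using nrm_upper[of j "v - P j v"] by (simp add: power2_eq_square mult_ac)
qed

lemma box_norm_upper: "box_norm j v \<le> 2 * B\<^sup>2 * norm v"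
  unfolding box_norm_def using P_part_bound Q_part_bound by simp

lemma box_norm_lower: "norm v \<le> 2 * B * box_norm j v"
proof -
  have "norm v \<le> norm (P j v) + norm (v - P j v)"
    using norm_triangle_ineq[of "P j v" "v - P j v"] by simp
  also have "\<dots> \<le> B * box_norm j v + B * box_norm j v"
    using B unfolding box_norm_def
    by (intro add_mono order_trans[OF nrm_lower[of _ j]] mult_left_mono) auto
  finally show ?thesis by simp
qed

lemma P_A': "P j (A' j v) = A' j (P (j + 1) v)"
  by (metis A_P A'_A A_A')

text \<open>Expansion in forward time, read backwards.\<close>

lemma A'_contracts: "nrm j (A' j (P (j + 1) v)) \<le> \<kappa> * nrm (j + 1) (P (j + 1) v)"
  using unstable[of j "A' j v"] by (metis P_A' A_P A_A')

text \<open>Solving the unstable part of \<open>v (j + 1) = F j (v j)\<close> for the earlier term, by \<open>A'\<close>, and leaving the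
stable part as it is turns the equation into a fixed point problem in which both parts contract.\<close>

definition transform :: "(int \<Rightarrow> 'e \<Rightarrow> 'e) \<Rightarrow> (int \<Rightarrow> 'e) \<Rightarrow> int \<Rightarrow> 'e" where
  "transform F v j = A' j (P (j + 1) (v (j + 1) - (F j (v j) - A j (v j)))) +
     (F (j - 1) (v (j - 1)) - P j (F (j - 1) (v (j - 1))))"

lemma P_Q: "P j (v - P j v) = 0"
  by (simp add: linear_diff[OF P_linear] P_idem)

lemma P_transform:
  "P j (transform F v j) = A' j (P (j + 1) (v (j + 1) - (F j (v j) - A j (v j))))"
  unfolding transform_def by (simp add: linear_add[OF P_linear] P_Q P_A' P_idem)

lemma Q_transform:
  "transform F v j - P j (transform F v j) = F (j - 1) (v (j - 1)) - P j (F (j - 1) (v (j - 1)))"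
  unfolding P_transform by (simp add: transform_def)

lemma transform_fixed_iff: "transform F v = v \<longleftrightarrow> (\<forall>j. v (j + 1) = F j (v j))"
proof
  assume fixed: "transform F v = v"
  show "\<forall>j. v (j + 1) = F j (v j)"
  proof
    fix j
    have "P j (v j) = A' j (P (j + 1) (v (j + 1) - F j (v j)) + P (j + 1) (A j (v j)))"
      using P_transform[of j F v] by (simp add: fixed linear_add[OF P_linear, symmetric] algebra_simps)
    also have "\<dots> = A' j (P (j + 1) (v (j + 1) - F j (v j))) + P j (v j)"
      by (simp add: linear_add[OF A'_linear] A_P[symmetric] A'_A)
    finally have "A' j (P (j + 1) (v (j + 1) - F j (v j))) = 0" by simp
    then have "P (j + 1) (v (j + 1) - F j (v j)) = 0"
      by (metis A_A' A_linear linear_0)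
    moreover have "v (j + 1) - P (j + 1) (v (j + 1)) = F j (v j) - P (j + 1) (F j (v j))"
      using Q_transform[of F v "j + 1"] by (simp add: fixed)
    ultimately show "v (j + 1) = F j (v j)" by (simp add: linear_diff[OF P_linear])
  qed
next
  assume orbit: "\<forall>j. v (j + 1) = F j (v j)"
  have "transform F v j = v j" for j
  proof -
    have "F (j - 1) (v (j - 1)) = v j" using orbit[rule_format, of "j - 1"] by simp
    then show ?thesis using orbit by (simp add: transform_def A_P[symmetric] A'_A)
  qed
  then show "transform F v = v" by blast
qed

text \<open>The linear parts contract at the rate \<open>\<kappa>\<close>. The nonlinear remainder \<open>F j - A j\<close> contributes \<open>\<eta>\<close> times
the constants that compare \<open>box_norm\<close> with the norm: \<open>2 * B\<^sup>2\<close> one way and \<open>2 * B\<close> the other.\<close>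

lemma transform_contracts:
  assumes \<eta>: "\<And>j v w. \<lbrakk>norm v \<le> r; norm w \<le> r\<rbrakk>
                \<Longrightarrow> norm ((F j v - A j v) - (F j w - A j w)) \<le> \<eta> * norm (v - w)"
    and "0 \<le> \<eta>"
    and small: "\<And>j. norm (v j) \<le> r" "\<And>j. norm (w j) \<le> r"
    and D: "\<And>j. box_norm j (v j - w j) \<le> D"
  shows "box_norm j (transform F v j - transform F w j) \<le> (\<kappa> + 4 * B ^ 3 * \<eta>) * D"
proof -
  define R where "R j = (F j (v j) - A j (v j)) - (F j (w j) - A j (w j))" for j
  have "norm (v j - w j) \<le> 2 * B * D" for j
    using box_norm_lower[of "v j - w j" j] D[of j] B
    by (smt (verit) mult_left_mono)
  then have R: "norm (R j) \<le> \<eta> * (2 * B * D)" for j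
    unfolding R_def using \<eta>[OF small, of j j j] \<open>0 \<le> \<eta>\<close> by (meson mult_left_mono order_trans)
  have R': "2 * B\<^sup>2 * norm (R j) \<le> 4 * B ^ 3 * \<eta> * D" for j
    using mult_left_mono[OF R[of j], of "2 * B\<^sup>2"] by (simp add: power2_eq_square power3_eq_cube mult_ac)
  have PR: "nrm i (P i (R j)) \<le> 4 * B ^ 3 * \<eta> * D" and QR: "nrm i (R j - P i (R j)) \<le> 4 * B ^ 3 * \<eta> * D"
    for i j
    using P_part_bound[of i "R j"] Q_part_bound[of i "R j"] R'[of j] by linarith+
  have minus: "nrm i (- P i u) \<le> 2 * B\<^sup>2 * norm u" for i u
    using P_part_bound[of i "- u"] by (simp add: linear_neg[OF P_linear])
  have D0: "0 \<le> 4 * B ^ 3 * \<eta> * D"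
    using R'[of 0] by (meson mult_nonneg_nonneg norm_ge_zero order_trans zero_le_numeral zero_le_power2)
  have "nrm j (P j (transform F v j - transform F w j)) \<le> (\<kappa> + 4 * B ^ 3 * \<eta>) * D"
  proof -
    have "P j (transform F v j - transform F w j)
        = A' j (P (j + 1) ((v (j + 1) - w (j + 1)) - R j))"
      by (simp add: linear_diff[OF P_linear] P_transform R_def linear_diff[OF A'_linear, symmetric])
         (simp add: linear_diff[OF P_linear, symmetric] algebra_simps)
    also have "nrm j \<dots> \<le> \<kappa> * nrm (j + 1) (P (j + 1) ((v (j + 1) - w (j + 1)) - R j))"
      by (rule A'_contracts)
    also have "\<dots> \<le> \<kappa> * (nrm (j + 1) (P (j + 1) (v (j + 1) - w (j + 1))) + nrm (j + 1) (- P (j + 1) (R j)))"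
      using nrm_triangle[of "j + 1" "P (j + 1) (v (j + 1) - w (j + 1))" "- P (j + 1) (R j)"] \<kappa>
      by (intro mult_left_mono) (simp_all add: linear_diff[OF P_linear])
    also have "\<dots> \<le> \<kappa> * (D + 4 * B ^ 3 * \<eta> * D)"
      using D[of "j + 1"] order_trans[OF minus[of "j + 1" "R j"] R'[of j]] \<kappa>
      by (intro mult_left_mono add_mono) (auto simp: box_norm_def)
    also have "\<dots> \<le> \<kappa> * D + 4 * B ^ 3 * \<eta> * D"
      using mult_right_mono[of \<kappa> 1, OF _ D0] \<kappa> by (simp add: algebra_simps)
    finally show ?thesis by (simp add: algebra_simps)
  qed
  moreover have "nrm j (transform F v j - transform F w j - P j (transform F v j - transform F w j))
      \<le> (\<kappa> + 4 * B ^ 3 * \<eta>) * D"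
  proof -
    define i where "i = j - 1"
    have j: "j = i + 1" by (simp add: i_def)
    define u where "u = v i - w i"
    have "transform F v j - transform F w j - P j (transform F v j - transform F w j)
        = (transform F v j - P j (transform F v j)) - (transform F w j - P j (transform F w j))"
      by (simp add: linear_diff[OF P_linear])
    also have "\<dots> = A i (u - P i u) + (R i - P j (R i))"
      unfolding Q_transform
      by (simp add: R_def u_def j linear_diff[OF A_linear] A_P linear_diff[OF P_linear])
    also have "nrm j \<dots> \<le> nrm j (A i (u - P i u)) + nrm j (R i - P j (R i))"
      by (rule nrm_triangle)
    also have "\<dots> \<le> \<kappa> * D + 4 * B ^ 3 * \<eta> * D"
      using stable[of i u] D[of i] \<kappa>(1) QR[of j i]
      by (smt (verit, ccfv_threshold) box_norm_def j mult_left_mono u_def)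
    finally show ?thesis by (simp add: algebra_simps)
  qed
  ultimately show ?thesis by (simp add: box_norm_def)
qed

lemma ex_orbit:
  assumes \<eta>: "\<And>j v w. \<lbrakk>norm v \<le> r; norm w \<le> r\<rbrakk>
                \<Longrightarrow> norm ((F j v - A j v) - (F j w - A j w)) \<le> \<eta> * norm (v - w)"
    and \<eta>0: "0 \<le> \<eta>" and \<eta>1: "4 * B ^ 3 * \<eta> \<le> (1 - \<kappa>) / 2"
    and s: "0 \<le> s" "s \<le> r" and F0: "\<And>j. norm (F j 0) \<le> (1 - \<kappa>) / (8 * B ^ 3) * s"
  obtains v where "\<And>j. norm (v j) \<le> s" and "\<And>j. v (j + 1) = F j (v j)"
proof -
  \<comment> \<open>The ball of radius \<open>t\<close> for \<open>box_norm\<close> lies in that of radius \<open>s\<close> for the norm.\<close>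
  define t where "t = s / (2 * B)"
  define \<rho> where "\<rho> = (1 + \<kappa>) / 2"
  have t: "norm u \<le> s" if "box_norm j u \<le> t" for u j
    using box_norm_lower[of u j] that B by (simp add: t_def field_simps)
  obtain v where v: "\<And>j. box_norm j (v j) \<le> t" "transform F v = v"
  proof (rule weighted_contraction_fixed_point[of box_norm "2 * B\<^sup>2" \<rho> "transform F" t])
    show "norm v \<le> 2 * B\<^sup>2 * box_norm i v" for i v
    proof -
      have "0 \<le> box_norm i v" using box_norm_lower[of v i] B norm_ge_zero[of v]
        by (smt (verit) mult_nonneg_nonpos zero_less_mult_iff mult_pos_neg)
      then have "2 * B * box_norm i v \<le> 2 * B\<^sup>2 * box_norm i v"
        using B by (intro mult_right_mono) (auto simp: power2_eq_square)
      then show ?thesis using box_norm_lower[of v i] by linarith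
    qed
    have "box_norm i (transform F (\<lambda>_. 0) i) \<le> 2 * B\<^sup>2 * ((1 - \<kappa>) / (8 * B ^ 3) * s)" for i
    proof -
      have *: "2 * B\<^sup>2 * norm (F j 0) \<le> 2 * B\<^sup>2 * ((1 - \<kappa>) / (8 * B ^ 3) * s)" for j
        using F0 by (intro mult_left_mono) auto
      have "nrm i (P i (transform F (\<lambda>_. 0) i)) \<le> \<kappa> * nrm (i + 1) (P (i + 1) (- F i 0))"
        using A'_contracts[of i "- F i 0"] unfolding P_transform by (simp add: linear_0[OF A_linear])
      also have "\<dots> \<le> \<kappa> * (2 * B\<^sup>2 * norm (F i 0))"
        using P_part_bound[of "i + 1" "- F i 0"] \<kappa> by (intro mult_left_mono) auto
      also have "\<dots> \<le> 1 * (2 * B\<^sup>2 * norm (F i 0))"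
        using \<kappa> by (intro mult_right_mono) auto
      finally show ?thesis
        using Q_part_bound[of i "F (i - 1) 0"] *[of i] *[of "i - 1"]
        unfolding box_norm_def Q_transform by linarith
    qed
    also have "2 * B\<^sup>2 * ((1 - \<kappa>) / (8 * B ^ 3) * s) = (1 - \<rho>) * t"
      using B by (simp add: \<rho>_def t_def field_simps power2_eq_square power3_eq_cube)
    finally show "box_norm i (transform F (\<lambda>_. 0) i) \<le> (1 - \<rho>) * t" for i .
    show "box_norm i (transform F v i - transform F w i) \<le> \<rho> * D"
      if vw: "\<And>j. box_norm j (v j) \<le> t" "\<And>j. box_norm j (w j) \<le> t"
        and D: "\<And>j. box_norm j (v j - w j) \<le> D" for v w D i
    proof -
      have "box_norm i (transform F v i - transform F w i) \<le> (\<kappa> + 4 * B ^ 3 * \<eta>) * D"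
      proof (rule transform_contracts[OF \<eta> \<eta>0])
        show "norm (v j) \<le> r" "norm (w j) \<le> r" for j
          using t[OF vw(1)] t[OF vw(2)] s(2) order_trans by blast+
      qed (use D in auto)
      also have "\<dots> \<le> \<rho> * D"
      proof (rule mult_right_mono)
        have "0 \<le> 2 * B * D"
          using box_norm_lower[of "v 0 - w 0" 0] D[of 0] B norm_ge_zero[of "v 0 - w 0"]
          by (smt (verit) mult_left_mono)
        then show "0 \<le> D" using B by (simp add: zero_le_mult_iff)
        show "\<kappa> + 4 * B ^ 3 * \<eta> \<le> \<rho>" using \<eta>1 by (simp add: \<rho>_def field_simps)
      qed
      finally show ?thesis .
    qed
  qed (use B \<kappa> box_norm_triangle box_norm_upper in \<open>auto simp: \<rho>_def\<close>)
  show ?thesis using that v t transform_fixed_iff by blast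
qed

text \<open>Two orbits are fixed points of the same contraction, so their distance is at most \<open>\<rho> ^ k\<close> times a
bound, for every \<open>k\<close>.\<close>

lemma orbit_unique:
  assumes \<eta>: "\<And>j v w. \<lbrakk>norm v \<le> r; norm w \<le> r\<rbrakk>
                \<Longrightarrow> norm ((F j v - A j v) - (F j w - A j w)) \<le> \<eta> * norm (v - w)"
    and \<eta>0: "0 \<le> \<eta>" and \<eta>1: "4 * B ^ 3 * \<eta> \<le> (1 - \<kappa>) / 2"
    and v: "\<And>j. norm (v j) \<le> r" "\<And>j. v (j + 1) = F j (v j)"
    and w: "\<And>j. norm (w j) \<le> r" "\<And>j. w (j + 1) = F j (w j)"
  shows "v = w"
proof
  fix j
  define \<rho> where "\<rho> = (1 + \<kappa>) / 2"
  define D where "D = 2 * B\<^sup>2 * (r + r)"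
  have fixed: "transform F v = v" "transform F w = w"
    using v(2) w(2) by (simp_all add: transform_fixed_iff)
  have r: "0 \<le> r" using v(1)[of 0] norm_ge_zero order_trans by blast
  have "box_norm i (v i - w i) \<le> \<rho> ^ k * D" for i k
  proof (induction k arbitrary: i)
    case 0
    have "norm (v i - w i) \<le> r + r"
      using norm_triangle_ineq4[of "v i" "w i"] v(1)[of i] w(1)[of i] by linarith
    then have "2 * B\<^sup>2 * norm (v i - w i) \<le> D" unfolding D_def by (intro mult_left_mono) auto
    then show ?case using box_norm_upper[of i "v i - w i"] by simp
  next
    case (Suc k)
    have "box_norm i (v i - w i) \<le> (\<kappa> + 4 * B ^ 3 * \<eta>) * (\<rho> ^ k * D)"
      using transform_contracts[of r F \<eta> v w "\<rho> ^ k * D" i] \<eta> \<eta>0 v w Suc by (simp add: fixed)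
    also have "\<dots> \<le> \<rho> * (\<rho> ^ k * D)"
      using \<eta>1 r \<kappa> by (intro mult_right_mono) (auto simp: \<rho>_def D_def field_simps)
    finally show ?case by simp
  qed
  moreover have "(\<lambda>k. \<rho> ^ k * D) \<longlonglongrightarrow> 0"
    using \<kappa> by (intro tendsto_mult_left_zero LIMSEQ_realpow_zero) (auto simp: \<rho>_def)
  ultimately have "box_norm j (v j - w j) \<le> 0" by (intro LIMSEQ_le_const) auto
  then have "norm (v j - w j) \<le> 0"
    using box_norm_lower[of "v j - w j" j] B by (smt (verit) mult_nonneg_nonpos)
  then show "v j = w j" by simp
qed

end

section \<open>Projections along a continuous splitting\<close>

definition complementary :: "'e::euclidean_space set \<Rightarrow> 'e set \<Rightarrow> bool" where
  "complementary U V \<longleftrightarrow> subspace U \<and> subspace V \<and> U \<inter> V = {0} \<and> {u + v | u v. u \<in> U \<and> v \<in> V} = UNIV"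

definition projection_along :: "'e::euclidean_space set \<Rightarrow> 'e set \<Rightarrow> 'e \<Rightarrow>\<^sub>L 'e" where
  "projection_along U V = Blinfun (\<lambda>v. THE u. u \<in> U \<and> v - u \<in> V)"

lemma projection_along_eqI:
  fixes U V :: "'e::euclidean_space set"
  assumes c: "complementary U V" and u: "u \<in> U" "v - u \<in> V"
  shows "projection_along U V v = u"
proof -
  define p where "p v = (THE u. u \<in> U \<and> v - u \<in> V)" for v
  have sub: "subspace U" "subspace V" and int: "U \<inter> V = {0}"
    using c by (auto simp: complementary_def)
  have uniq: "p v = u" if "u \<in> U" "v - u \<in> V" for u v
    unfolding p_def
  proof (rule the_equality)
    show "u' = u" if u': "u' \<in> U \<and> v - u' \<in> V" for u'
    proof -
      have "u' - u \<in> U" using subspace_diff[OF sub(1)] u' \<open>u \<in> U\<close> by blast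
      moreover have "(v - u) - (v - u') \<in> V" using subspace_diff[OF sub(2)] u' \<open>v - u \<in> V\<close> by blast
      then have "u' - u \<in> V" by (simp add: algebra_simps)
      ultimately have "u' - u \<in> U \<inter> V" by blast
      then show ?thesis unfolding int by simp
    qed
  qed (use that in blast)
  have ex: "\<exists>u. u \<in> U \<and> v - u \<in> V" for v
  proof -
    have "v \<in> {u + s | u s. u \<in> U \<and> s \<in> V}" using c by (simp add: complementary_def)
    then obtain u s where "v = u + s" "u \<in> U" "s \<in> V" by blast
    then show ?thesis by (intro exI[of _ u]) simp
  qed
  have p: "p v \<in> U" "v - p v \<in> V" for v using ex[of v] uniq by blast+
  have "linear p"
  proof (rule linearI)
    fix v w :: 'e and a :: real
    show "p (v + w) = p v + p w"
    proof (rule uniq)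
      show "p v + p w \<in> U" using p sub subspace_add by blast
      have "(v - p v) + (w - p w) \<in> V" using p sub subspace_add by blast
      then show "v + w - (p v + p w) \<in> V" by (simp add: algebra_simps)
    qed
    show "p (a *\<^sub>R v) = a *\<^sub>R p v"
    proof (rule uniq)
      show "a *\<^sub>R p v \<in> U" using p sub subspace_scale by blast
      have "a *\<^sub>R (v - p v) \<in> V" using p sub subspace_scale by blast
      then show "a *\<^sub>R v - a *\<^sub>R p v \<in> V" by (simp add: algebra_simps)
    qed
  qed
  then have "bounded_linear p" by (simp add: linear_conv_bounded_linear)
  then have "projection_along U V v = p v"
    by (simp add: projection_along_def p_def[abs_def] bounded_linear_Blinfun_apply)
  then show ?thesis using uniq u by simp
qed

lemma projection_along_mem:
  assumes c: "complementary U V"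
  shows "projection_along U V v \<in> U" and "v - projection_along U V v \<in> V"
proof -
  have "v \<in> {u + s | u s. u \<in> U \<and> s \<in> V}" using c by (simp add: complementary_def)
  then obtain u s where "v = u + s" "u \<in> U" "s \<in> V" by blast
  then have "u \<in> U" "v - u \<in> V" by simp_all
  then show "projection_along U V v \<in> U" "v - projection_along U V v \<in> V"
    using projection_along_eqI[OF c] by auto
qed

lemma projection_along_left: "complementary U V \<Longrightarrow> u \<in> U \<Longrightarrow> projection_along U V u = u"
  by (rule projection_along_eqI) (auto simp: complementary_def subspace_0)

lemma projection_along_right: "complementary U V \<Longrightarrow> v \<in> V \<Longrightarrow> projection_along U V v = 0"
  by (rule projection_along_eqI) (auto simp: complementary_def subspace_0)

lemma frame_coordinates:
  fixes b :: "nat \<Rightarrow> 'e::euclidean_space"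
  assumes inj: "inj_on b {..<k}" and ind: "independent (b ` {..<k})"
  obtains \<phi> where "\<And>i. linear (\<phi> i)" and "\<And>u. u \<in> span (b ` {..<k}) \<Longrightarrow> u = (\<Sum>i<k. \<phi> i u *\<^sub>R b i)"
proof -
  have "\<exists>\<phi>. linear \<phi> \<and> (\<forall>x\<in>b ` {..<k}. \<phi> x = (if x = b i then 1 else 0::real))" for i
    by (rule linear_independent_extend[OF ind])
  then obtain \<phi> where \<phi>: "\<And>i. linear (\<phi> i)"
    "\<And>i x. x \<in> b ` {..<k} \<Longrightarrow> \<phi> i x = (if x = b i then 1 else 0::real)"
    by metis
  have lin: "linear (\<lambda>u. \<Sum>i<k. \<phi> i u *\<^sub>R b i)"
    by (intro linear_compose_sum ballI linearI)
       (simp_all add: linear_add[OF \<phi>(1)] linear_cmul[OF \<phi>(1)] scaleR_add_left)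
  have "u = (\<Sum>i<k. \<phi> i u *\<^sub>R b i)" if "u \<in> span (b ` {..<k})" for u
  proof (rule linear_eq_on[OF linear_id[unfolded id_def] lin that])
    fix x assume "x \<in> b ` {..<k}"
    then obtain j where j: "j < k" "x = b j" by auto
    have "(\<Sum>i<k. \<phi> i x *\<^sub>R b i) = (\<Sum>i<k. if i = j then b j else 0)"
      using j inj by (intro sum.cong) (auto simp: \<phi>(2) inj_on_def)
    then show "x = (\<Sum>i<k. \<phi> i x *\<^sub>R b i)" using j by simp
  qed
  then show ?thesis using that \<phi>(1) by blast
qed

text \<open>Near a base point \<open>p\<close>, the linear map \<open>T q\<close> that carries the two frames at \<open>p\<close> to those at \<open>q\<close> is
close to the identity, hence onto, and it carries one splitting to the other. So
\<open>pr q \<circ> T q = T q \<circ> pr p\<close> for the projections \<open>pr\<close>, and \<open>pr q\<close> is close to \<open>pr p\<close>.\<close>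

lemma isCont_projection_along:
  fixes U V :: "'a::t2_space \<Rightarrow> 'e::euclidean_space set"
    and b b' :: "nat \<Rightarrow> 'a \<Rightarrow> 'e" and k l :: nat
  assumes W: "open W" "p \<in> W" and comp: "\<And>q. q \<in> W \<Longrightarrow> complementary (U q) (V q)"
    and b: "\<And>i. i < k \<Longrightarrow> continuous_on W (b i)"
    and bU: "\<And>q. q \<in> W \<Longrightarrow> inj_on (\<lambda>i. b i q) {..<k} \<and> independent ((\<lambda>i. b i q) ` {..<k}) \<and>
           span ((\<lambda>i. b i q) ` {..<k}) = U q"
    and b': "\<And>i. i < l \<Longrightarrow> continuous_on W (b' i)"
    and bV: "\<And>q. q \<in> W \<Longrightarrow> inj_on (\<lambda>i. b' i q) {..<l} \<and> independent ((\<lambda>i. b' i q) ` {..<l}) \<and>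
           span ((\<lambda>i. b' i q) ` {..<l}) = V q"
  shows "isCont (\<lambda>q. projection_along (U q) (V q)) p"
proof -
  define pr where "pr q = projection_along (U q) (V q)" for q
  obtain \<phi> where \<phi>: "\<And>i. linear (\<phi> i)" "\<And>u. u \<in> U p \<Longrightarrow> u = (\<Sum>i<k. \<phi> i u *\<^sub>R b i p)"
    using frame_coordinates[of "\<lambda>i. b i p" k] bU[OF W(2)] by metis
  obtain \<psi> where \<psi>: "\<And>i. linear (\<psi> i)" "\<And>u. u \<in> V p \<Longrightarrow> u = (\<Sum>i<l. \<psi> i u *\<^sub>R b' i p)"
    using frame_coordinates[of "\<lambda>i. b' i p" l] bV[OF W(2)] by metis
  have prp: "pr q v \<in> U q" "v - pr q v \<in> V q" if "q \<in> W" for q v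
    unfolding pr_def using projection_along_mem[OF comp[OF that]] by auto
  have linL: "linear (\<lambda>v. \<phi> i (pr p v))" and linR: "linear (\<lambda>v. \<psi> i (v - pr p v))" for i
    using linear_compose[OF blinfun.bounded_linear_right[THEN bounded_linear.linear, of "pr p"] \<phi>(1)[of i]]
      linear_compose[OF blinfun.bounded_linear_right[THEN bounded_linear.linear, of "id_blinfun - pr p"] \<psi>(1)[of i]]
    by (auto simp: o_def blinfun.diff_left)
  have "\<exists>C. \<forall>v. \<bar>\<phi> i (pr p v)\<bar> \<le> C * norm v" for i
    using linear_bounded[OF linL[of i]] by auto
  then obtain C where C: "\<And>i v. \<bar>\<phi> i (pr p v)\<bar> \<le> C i * norm v" by metis
  have "\<exists>C. \<forall>v. \<bar>\<psi> i (v - pr p v)\<bar> \<le> C * norm v" for i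
    using linear_bounded[OF linR[of i]] by auto
  then obtain C' where C': "\<And>i v. \<bar>\<psi> i (v - pr p v)\<bar> \<le> C' i * norm v" by metis
  define T where "T q v = (\<Sum>i<k. \<phi> i (pr p v) *\<^sub>R b i q) + (\<Sum>i<l. \<psi> i (v - pr p v) *\<^sub>R b' i q)" for q v
  \<comment> \<open>A bound for the distance of \<open>T q\<close> from the identity.\<close>
  define \<omega> where "\<omega> q = (\<Sum>i<k. C i * norm (b i q - b i p)) + (\<Sum>i<l. C' i * norm (b' i q - b' i p))" for q
  have T_lin: "linear (T q)" for q
    unfolding T_def
    by (intro linear_compose_add linear_compose_sum ballI linearI)
       (simp_all add: linear_add[OF linL] linear_add[OF linR] linear_cmul[OF linL] linear_cmul[OF linR] scaleR_add_left)
  have Tp: "v = T p v" for v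
    using \<phi>(2)[OF prp(1)[OF W(2), of v]] \<psi>(2)[OF prp(2)[OF W(2), of v]] unfolding T_def
    by (metis add_diff_cancel_left' add_diff_eq)
  have T_near: "norm (T q v - v) \<le> \<omega> q * norm v" for q v
  proof -
    have "T q v - v = T q v - T p v" using Tp by simp
    also have "\<dots> = (\<Sum>i<k. \<phi> i (pr p v) *\<^sub>R (b i q - b i p)) + (\<Sum>i<l. \<psi> i (v - pr p v) *\<^sub>R (b' i q - b' i p))"
      unfolding T_def by (simp add: scaleR_diff_right sum_subtractf)
    also have "norm \<dots> \<le> (\<Sum>i<k. \<bar>\<phi> i (pr p v)\<bar> * norm (b i q - b i p)) + (\<Sum>i<l. \<bar>\<psi> i (v - pr p v)\<bar> * norm (b' i q - b' i p))"
      by (rule norm_triangle_le, rule add_mono; rule sum_norm_le) simp_all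
    also have "\<dots> \<le> (\<Sum>i<k. (C i * norm v) * norm (b i q - b i p)) + (\<Sum>i<l. (C' i * norm v) * norm (b' i q - b' i p))"
      by (intro add_mono sum_mono mult_right_mono C C') auto
    also have "\<dots> = \<omega> q * norm v"
      by (simp add: \<omega>_def sum_distrib_left algebra_simps)
    finally show ?thesis .
  qed
  have \<omega>0: "(\<omega> \<longlongrightarrow> 0) (at p)"
  proof -
    have "isCont (b i) p" if "i < k" for i using b[OF that] W continuous_on_eq_continuous_at by blast
    moreover have "isCont (b' i) p" if "i < l" for i using b'[OF that] W continuous_on_eq_continuous_at by blast
    ultimately have "isCont \<omega> p" unfolding \<omega>_def by (intro continuous_intros) auto
    then show ?thesis by (simp add: isCont_def \<omega>_def)
  qed
  have est: "norm (pr q - pr p) \<le> 4 * norm (pr p) * \<omega> q" if q: "q \<in> W" and small: "\<omega> q < 1/2" for q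
  proof -
    have T_half: "norm w \<le> 2 * norm (T q w)" for w
    proof -
      have "\<omega> q * norm w \<le> 1/2 * norm w" using small by (intro mult_right_mono) auto
      then show ?thesis using T_near[of q w] norm_triangle_ineq2[of w "T q w"] by (simp add: norm_minus_commute)
    qed
    then have "inj (T q)"
      unfolding linear_injective_0[OF T_lin] by (metis norm_le_zero_iff mult_zero_right norm_zero)
    then have surj: "surj (T q)" using linear_injective_imp_surjective T_lin by blast
    have \<omega>q: "0 \<le> \<omega> q"
    proof -
      obtain e :: 'e where "norm e = 1" using nonempty_Basis norm_Basis by blast
      then have "norm (T q e - e) \<le> \<omega> q" using T_near[of q e] by simp
      then show ?thesis using norm_ge_zero order_trans by blast
    qed
    show ?thesis
    proof (rule norm_blinfun_bound)
      show "0 \<le> 4 * norm (pr p) * \<omega> q" using \<omega>q by simp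
      fix v
      obtain w where w: "v = T q w" using surj by (metis surjD)
      have memU: "(\<Sum>i<k. a i *\<^sub>R b i q) \<in> U q" for a
      proof -
        have "(\<Sum>i<k. a i *\<^sub>R b i q) \<in> span ((\<lambda>i. b i q) ` {..<k})"
          by (intro span_sum span_scale span_base) auto
        then show ?thesis using bU[OF q] by simp
      qed
      have memV: "(\<Sum>i<l. a i *\<^sub>R b' i q) \<in> V q" for a
      proof -
        have "(\<Sum>i<l. a i *\<^sub>R b' i q) \<in> span ((\<lambda>i. b' i q) ` {..<l})"
          by (intro span_sum span_scale span_base) auto
        then show ?thesis using bV[OF q] by simp
      qed
      have PP: "pr p (pr p w) = pr p w"
        using projection_along_left[OF comp[OF W(2)]] prp(1)[OF W(2)] by (simp add: pr_def)
      \<comment> \<open>The two sums in \<open>T q w\<close> are its components in \<open>U q\<close> and \<open>V q\<close>.\<close>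
      have "pr q v = (\<Sum>i<k. \<phi> i (pr p w) *\<^sub>R b i q)"
        unfolding pr_def[of q] w
        by (rule projection_along_eqI[OF comp[OF q]]) (use memU memV in \<open>auto simp: T_def\<close>)
      also have "\<dots> = T q (pr p w)" by (simp add: T_def PP linear_0[OF \<psi>(1)])
      finally have "(pr q - pr p) v = (T q (pr p w) - pr p w) - pr p (T q w - w)"
        by (simp add: blinfun.diff_left blinfun.diff_right w)
      also have "norm \<dots> \<le> norm (T q (pr p w) - pr p w) + norm (pr p (T q w - w))"
        by (rule norm_triangle_ineq4)
      also have "\<dots> \<le> \<omega> q * (norm (pr p) * norm w) + norm (pr p) * (\<omega> q * norm w)"
        using \<omega>q by (intro add_mono order_trans[OF T_near] order_trans[OF norm_blinfun] mult_left_mono T_near) auto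
      also have "\<dots> = 2 * norm (pr p) * \<omega> q * norm w" by (simp add: algebra_simps)
      also have "\<dots> \<le> 2 * norm (pr p) * \<omega> q * (2 * norm v)"
        using T_half[of w] \<omega>q w by (intro mult_left_mono) auto
      finally show "norm ((pr q - pr p) v) \<le> 4 * norm (pr p) * \<omega> q * norm v" by simp
    qed
  qed
  have "((\<lambda>q. pr q - pr p) \<longlongrightarrow> 0) (at p)"
  proof (rule Lim_null_comparison)
    show "((\<lambda>q. 4 * norm (pr p) * \<omega> q) \<longlongrightarrow> 0) (at p)" by (intro tendsto_mult_right_zero \<omega>0)
    have "\<forall>\<^sub>F q in at p. q \<in> W" using W by (simp add: eventually_at_topological) blast
    moreover have "\<forall>\<^sub>F q in at p. \<omega> q < 1/2" using order_tendstoD(2)[OF \<omega>0, of "1/2"] by simp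
    ultimately show "\<forall>\<^sub>F q in at p. norm (pr q - pr p) \<le> 4 * norm (pr p) * \<omega> q"
      by eventually_elim (use est in auto)
  qed
  then have "(pr \<longlongrightarrow> pr p) (at p)" by (simp add: Lim_null[symmetric])
  then show ?thesis unfolding isCont_def pr_def[abs_def] .
qed

section \<open>Tangent maps in charts\<close>

abbreviation local_rep :: "('m, 'e) chart \<Rightarrow> ('m, 'e) chart \<Rightarrow> ('m \<Rightarrow> 'm) \<Rightarrow> 'e \<Rightarrow> 'e" where
  "local_rep c d F \<equiv> snd d \<circ> F \<circ> chart_inv c"

abbreviation local_deriv ::
    "('m, 'e::euclidean_space) chart \<Rightarrow> ('m, 'e) chart \<Rightarrow> ('m \<Rightarrow> 'm) \<Rightarrow> 'm \<Rightarrow> 'e \<Rightarrow> 'e" where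
  "local_deriv c d F x \<equiv> frechet_derivative (local_rep c d F) (at (snd c x))"

locale manifold =
  fixes A :: "('m::metric_space, 'e::euclidean_space) chart set"
  assumes atlas: "smooth_atlas A"
begin

lemma chart: "c \<in> A \<Longrightarrow> is_chart c"
  using atlas by (auto simp: smooth_atlas_def)

lemma open_chart: "c \<in> A \<Longrightarrow> open (fst c)"
  using chart by (auto simp: is_chart_def)

lemma open_chart_image: "c \<in> A \<Longrightarrow> open (snd c ` fst c)"
  using chart by (auto simp: is_chart_def)

lemma chart_inv_chart [simp]: "c \<in> A \<Longrightarrow> x \<in> fst c \<Longrightarrow> chart_inv c (snd c x) = x"
  using chart by (auto simp: is_chart_def homeomorphism_def)

lemma chart_chart_inv [simp]: "c \<in> A \<Longrightarrow> y \<in> snd c ` fst c \<Longrightarrow> snd c (chart_inv c y) = y"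
  using chart by (auto simp: is_chart_def homeomorphism_def)

lemma continuous_on_chart: "c \<in> A \<Longrightarrow> continuous_on (fst c) (snd c)"
  using chart by (auto simp: is_chart_def homeomorphism_def)

lemma continuous_on_chart_inv: "c \<in> A \<Longrightarrow> continuous_on (snd c ` fst c) (chart_inv c)"
  using chart by (auto simp: is_chart_def homeomorphism_def)

lemma chart_at: "chart_at A x \<in> A" "x \<in> fst (chart_at A x)"
proof -
  have "x \<in> (\<Union>c\<in>A. fst c)" using atlas by (simp add: smooth_atlas_def)
  then have "\<exists>c. c \<in> A \<and> x \<in> fst c" by blast
  from someI_ex[OF this] show "chart_at A x \<in> A" "x \<in> fst (chart_at A x)"
    by (auto simp: chart_at_def)
qed

lemma open_chart_preimage:
  assumes "c \<in> A" "open S"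
  shows "open (snd c ` fst c \<inter> chart_inv c -` S)"
  using continuous_open_preimage[OF continuous_on_chart_inv open_chart_image] assms by blast

lemma transition_differentiable:
  assumes "c \<in> A" "d \<in> A" "x \<in> fst c" "x \<in> fst d"
  shows "snd d \<circ> chart_inv c differentiable at (snd c x)"
proof -
  have "smooth_on (snd c ` (fst c \<inter> fst d)) (snd d \<circ> chart_inv c)"
    using atlas assms by (auto simp: smooth_atlas_def)
  then have "Ck_on (Suc 0) (snd c ` (fst c \<inter> fst d)) (snd d \<circ> chart_inv c)"
    unfolding smooth_on_def by blast
  then show ?thesis using assms by (auto simp: o_def)
qed

text \<open>With one or both maps the identity, the chain rule in this form also governs changes of coordinates.\<close>

lemma local_deriv_comp:
  assumes c: "c \<in> A" "x \<in> fst c" and d: "d \<in> A" "F x \<in> fst d"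
    and contF: "continuous_on UNIV F"
    and F: "local_rep c d F differentiable at (snd c x)"
    and H: "local_rep d e H differentiable at (snd d (F x))"
  shows "local_deriv c e (H \<circ> F) x v = local_deriv d e H (F x) (local_deriv c d F x v)"
proof -
  have x: "local_rep c d F (snd c x) = snd d (F x)" using c by simp
  have "(local_rep d e H \<circ> local_rep c d F has_derivative
      (local_deriv d e H (F x) \<circ> local_deriv c d F x)) (at (snd c x))"
  proof (rule diff_chain_at)
    show "(local_rep c d F has_derivative local_deriv c d F x) (at (snd c x))"
      by (rule frechet_derivative_works[THEN iffD1, OF F])
    show "(local_rep d e H has_derivative local_deriv d e H (F x)) (at (local_rep c d F (snd c x)))"
      unfolding x by (rule frechet_derivative_works[THEN iffD1, OF H])
  qed
  then have "(local_rep c e (H \<circ> F) has_derivative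
      (local_deriv d e H (F x) \<circ> local_deriv c d F x)) (at (snd c x))"
  proof (rule has_derivative_transform_within_open)
    show "open (snd c ` fst c \<inter> chart_inv c -` (F -` fst d))"
      by (intro open_chart_preimage c open_vimage contF open_chart d)
    show "snd c x \<in> snd c ` fst c \<inter> chart_inv c -` (F -` fst d)" using c d by simp
    show "(local_rep d e H \<circ> local_rep c d F) y = local_rep c e (H \<circ> F) y"
      if "y \<in> snd c ` fst c \<inter> chart_inv c -` (F -` fst d)" for y
      using that d by simp
  qed
  from frechet_derivative_at[OF this, symmetric] show ?thesis by simp
qed

lemma local_deriv_id:
  assumes "c \<in> A" "x \<in> fst c"
  shows "local_deriv c c id x v = v"
proof -
  have "(local_rep c c id has_derivative (\<lambda>v. v)) (at (snd c x))"
  proof (rule has_derivative_transform_within_open[OF has_derivative_ident open_chart_image[OF assms(1)]])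
    show "y = local_rep c c id y" if "y \<in> snd c ` fst c" for y
      using chart_chart_inv[OF assms(1) that] by simp
  qed (use assms(2) in simp)
  then show ?thesis by (metis frechet_derivative_at)
qed

lemma transition_inverse:
  assumes c: "c \<in> A" "x \<in> fst c" and d: "d \<in> A" "x \<in> fst d"
  shows "frechet_derivative (snd c \<circ> chart_inv d) (at (snd d x))
           (frechet_derivative (snd d \<circ> chart_inv c) (at (snd c x)) v) = v"
proof -
  have "local_deriv c c (id \<circ> id) x v = local_deriv d c id (id x) (local_deriv c d id x v)"
    by (rule local_deriv_comp) (use assms in \<open>simp_all add: transition_differentiable\<close>)
  then show ?thesis using local_deriv_id[OF c, of v] by simp
qed

lemma tangent_to_from_chart:
  assumes "c \<in> A" "x \<in> fst c"
  shows "tangent_to_chart A c x (tangent_from_chart A c x v) = v"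
  unfolding tangent_to_chart_def tangent_from_chart_def by (rule transition_inverse[OF assms chart_at])

lemma tangent_from_to_chart:
  assumes "c \<in> A" "x \<in> fst c"
  shows "tangent_from_chart A c x (tangent_to_chart A c x v) = v"
  unfolding tangent_to_chart_def tangent_from_chart_def by (rule transition_inverse[OF chart_at assms])

lemma linear_tangent_to_chart:
  assumes "c \<in> A" "x \<in> fst c"
  shows "linear (tangent_to_chart A c x)"
  unfolding tangent_to_chart_def
  by (intro linear_frechet_derivative transition_differentiable chart_at assms)

lemma linear_tangent_from_chart:
  assumes "c \<in> A" "x \<in> fst c"
  shows "linear (tangent_from_chart A c x)"
  unfolding tangent_from_chart_def
  by (intro linear_frechet_derivative transition_differentiable chart_at assms)

lemma Ck_map_local:
  assumes F: "Ck_map k A F" and c: "c \<in> A" and d: "d \<in> A"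
  shows "Ck_on k (snd c ` (fst c \<inter> F -` fst d)) (local_rep c d F)"
  by (rule bspec[OF bspec[OF conjunct2[OF F[unfolded Ck_map_def]] c] d])

lemma Ck_map_differentiable:
  assumes F: "Ck_map 2 A F" and "c \<in> A" "d \<in> A" "x \<in> fst c" "F x \<in> fst d"
  shows "local_rep c d F differentiable at (snd c x)"
proof -
  have "Ck_on 2 (snd c ` (fst c \<inter> F -` fst d)) (local_rep c d F)"
    by (rule Ck_map_local[OF assms(1-3)])
  then have "\<forall>x\<in>fst c \<inter> F -` fst d. local_rep c d F differentiable at (snd c x)"
    by (simp add: numeral_2_eq_2)
  then show ?thesis using assms(4,5) by simp
qed

text \<open>The tangent spaces are trivialised by an arbitrary choice of chart at each point. This choice cancels
when both sides are read in given charts, where the tangent map becomes the ordinary derivative.\<close>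

lemma tangent_map_in_charts:
  assumes F: "Ck_map 2 A F" and c: "c \<in> A" "x \<in> fst c" and d: "d \<in> A" "F x \<in> fst d"
  shows "tangent_to_chart A d (F x) (tangent_map A F x (tangent_from_chart A c x v)) = local_deriv c d F x v"
proof -
  let ?c = "chart_at A x" and ?d = "chart_at A (F x)"
  have contF: "continuous_on UNIV F" using F by (simp add: Ck_map_def)
  have "local_deriv c ?d F x v = local_deriv ?c ?d F x (local_deriv c ?c id x v)"
    using local_deriv_comp[of c x ?c id ?d F v] c
    by (simp add: chart_at transition_differentiable Ck_map_differentiable[OF F])
  moreover have "local_deriv c d F x v = local_deriv ?d d id (F x) (local_deriv c ?d F x v)"
    using local_deriv_comp[of c x ?d F d id v] c d contF
    by (simp add: chart_at transition_differentiable Ck_map_differentiable[OF F])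
  ultimately show ?thesis
    by (simp add: tangent_map_def tangent_to_chart_def tangent_from_chart_def)
qed

lemma continuous_on_local_deriv:
  assumes F: "Ck_map 2 A F" and "c \<in> A" "d \<in> A"
  shows "continuous_on (fst c \<inter> F -` fst d) (\<lambda>x. local_deriv c d F x v)"
proof -
  have "Ck_on 2 (snd c ` (fst c \<inter> F -` fst d)) (local_rep c d F)"
    by (rule Ck_map_local[OF assms(1-3)])
  then have "\<forall>y\<in>snd c ` (fst c \<inter> F -` fst d). (\<lambda>y. frechet_derivative (local_rep c d F) (at y) v) differentiable at y"
    by (auto simp: numeral_2_eq_2)
  then have "continuous_on (snd c ` (fst c \<inter> F -` fst d)) (\<lambda>y. frechet_derivative (local_rep c d F) (at y) v)"
    by (auto intro!: continuous_at_imp_continuous_on differentiable_imp_continuous_within)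
  then show ?thesis
    by (rule continuous_on_compose2) (use continuous_on_chart[OF assms(2)] in \<open>auto intro: continuous_on_subset\<close>)
qed

end

section \<open>Random diffeomorphisms in charts\<close>

lemma Ck_close_refl: "0 < e \<Longrightarrow> Ck_close k K e F F"
  by (induction k arbitrary: F) simp_all

lemma Ck_close_2D:
  assumes "Ck_close 2 K e F H" "y \<in> K"
  shows "norm (F y - H y) < e"
    and "norm v = 1 \<Longrightarrow> norm (frechet_derivative F (at y) v - frechet_derivative H (at y) v) < e"
  using assms by (simp_all add: numeral_2_eq_2)

lemma bilinear_Cauchy_Schwarz_triangle:
  fixes g :: "'e::real_vector \<Rightarrow> 'e \<Rightarrow> real"
  assumes bil: "bilinear g" and sym: "\<And>u v. g u v = g v u" and pos: "\<And>v. 0 \<le> g v v"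
  shows "sqrt (g (u + v) (u + v)) \<le> sqrt (g u u) + sqrt (g v v)"
proof -
  have cs: "(g u v)\<^sup>2 \<le> g u u * g v v"
  proof -
    have q: "0 \<le> g u u + 2 * t * g u v + t\<^sup>2 * g v v" for t
    proof -
      have "g (u + t *\<^sub>R v) (u + t *\<^sub>R v) = g u u + 2 * t * g u v + t\<^sup>2 * g v v"
        by (simp add: bilinear_ladd[OF bil] bilinear_radd[OF bil] bilinear_lmul[OF bil] bilinear_rmul[OF bil]
            sym[of v u] power2_eq_square algebra_simps)
      then show ?thesis using pos[of "u + t *\<^sub>R v"] by simp
    qed
    show ?thesis
    proof (cases "g v v = 0")
      case True
      have "g u v = 0"
      proof (rule ccontr)
        assume ne: "g u v \<noteq> 0"
        have "0 \<le> g u u + 2 * (- (g u u + 1) / (2 * g u v)) * g u v"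
          using q[of "- (g u u + 1) / (2 * g u v)"] True by simp
        then show False using ne by (simp add: field_simps)
      qed
      then show ?thesis using pos by simp
    next
      case False
      then have v: "0 < g v v" using pos[of v] by simp
      have "0 \<le> g v v * (g u u + 2 * (- g u v / g v v) * g u v + (- g u v / g v v)\<^sup>2 * g v v)"
        using q[of "- g u v / g v v"] v by (intro mult_nonneg_nonneg) auto
      also have "\<dots> = g u u * g v v - (g u v)\<^sup>2"
        using v by (simp add: field_simps power2_eq_square)
      finally show ?thesis by simp
    qed
  qed
  have "g (u + v) (u + v) = g u u + 2 * g u v + g v v"
    by (simp add: bilinear_ladd[OF bil] bilinear_radd[OF bil] sym[of v u])
  also have "g u v \<le> sqrt (g u u) * sqrt (g v v)"
    using real_le_rsqrt[OF cs] by (simp add: real_sqrt_mult)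
  then have "g u u + 2 * g u v + g v v \<le> (sqrt (g u u) + sqrt (g v v))\<^sup>2"
    using pos[of u] pos[of v] by (simp add: power2_sum)
  finally show ?thesis using pos by (intro real_le_lsqrt) auto
qed

locale random_diffeo = manifold A
  for A :: "('m::metric_space, 'e::euclidean_space) chart set" +
  fixes G :: "'m \<Rightarrow> 'e \<Rightarrow> 'e \<Rightarrow> real"
    and \<theta> :: "'w::metric_space \<Rightarrow> 'w"
    and f :: "'w \<Rightarrow> 'm \<Rightarrow> 'm"
  assumes compact_M: "compact (UNIV :: 'm set)"
    and metric: "riemannian_metric A G"
    and compact_base: "compact (UNIV :: 'w set)"
    and \<theta>_homeo: "homeomorphism UNIV UNIV \<theta> (inv \<theta>)"
    and f_cont: "continuous_map euclidean (Diff_topology 2 A) f"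
begin

lemma f_Diff: "f \<omega> \<in> Diff 2 A"
proof -
  have "f \<omega> \<in> topspace (Diff_topology 2 A)"
    using continuous_map_image_subset_topspace[OF f_cont] by auto
  then show ?thesis unfolding Diff_topology_def topology_generated_by_topspace
    by (auto simp: Diff_nbhd_def)
qed

lemma f_Ck: "Ck_map 2 A (f \<omega>)" using f_Diff by (simp add: Diff_def)

lemma continuous_on_f: "continuous_on UNIV (f \<omega>)"
  using f_Ck by (simp add: Ck_map_def)

text \<open>What continuity of \<open>f\<close> for the \<open>C\<^sup>2\<close> topology means in charts: a basic neighbourhood of \<open>f \<omega>\<close> taken
for a small ball as compact set. It controls values and first derivatives uniformly on the ball.\<close>

lemma local_closeness:
  assumes c: "c \<in> A" "x \<in> fst c" and d: "d \<in> A" "f \<omega> x \<in> fst d" and "0 < e"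
  obtains s W where "0 < s" "ball x s \<subseteq> fst c" "open W" "\<omega> \<in> W"
    "\<And>y \<omega>'. \<lbrakk>y \<in> ball x s; \<omega>' \<in> W\<rbrakk> \<Longrightarrow> f \<omega>' y \<in> fst d"
    "\<And>y \<omega>'. \<lbrakk>y \<in> ball x s; \<omega>' \<in> W\<rbrakk> \<Longrightarrow> norm (snd d (f \<omega> y) - snd d (f \<omega>' y)) < e"
    "\<And>y \<omega>' v. \<lbrakk>y \<in> ball x s; \<omega>' \<in> W; norm v = 1\<rbrakk> \<Longrightarrow>
        norm (local_deriv c d (f \<omega>) y v - local_deriv c d (f \<omega>') y v) < e"
proof -
  have "open (fst c \<inter> f \<omega> -` fst d)"
    using open_chart c d by (intro open_Int open_vimage continuous_on_f) auto
  then obtain s where s: "0 < s" "cball x s \<subseteq> fst c \<inter> f \<omega> -` fst d"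
    using c d open_contains_cball by (metis IntI vimageI)
  have K: "compact (cball x s)"
    using compact_Int_closed[OF compact_M closed_cball[of x s]] by simp
  define N where "N = Diff_nbhd 2 A (f \<omega>) c d (cball x s) e"
  have "openin (Diff_topology 2 A) N"
    unfolding Diff_topology_def N_def
    using c d K s f_Diff \<open>0 < e\<close> by (intro topology_generated_by_Basis) blast
  then have "open {\<omega>'. f \<omega>' \<in> N}"
    using openin_continuous_map_preimage[OF f_cont] by simp
  moreover have "f \<omega> \<in> N"
    using s f_Diff \<open>0 < e\<close> by (auto simp: N_def Diff_nbhd_def Ck_close_refl)
  moreover have "f \<omega>' y \<in> fst d" "norm (snd d (f \<omega> y) - snd d (f \<omega>' y)) < e"
      "norm v = 1 \<Longrightarrow> norm (local_deriv c d (f \<omega>) y v - local_deriv c d (f \<omega>') y v) < e"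
    if y: "y \<in> ball x s" and \<omega>': "\<omega>' \<in> {\<omega>'. f \<omega>' \<in> N}" for y \<omega>' v
  proof -
    have yK: "y \<in> cball x s" using y by auto
    have yc: "y \<in> fst c" using yK s by auto
    have sub: "f \<omega>' ` cball x s \<subseteq> fst d"
      and close: "Ck_close 2 (snd c ` cball x s) e (local_rep c d (f \<omega>)) (local_rep c d (f \<omega>'))"
      using \<omega>' by (auto simp: N_def Diff_nbhd_def)
    show "f \<omega>' y \<in> fst d" using sub yK by blast
    show "norm (snd d (f \<omega> y) - snd d (f \<omega>' y)) < e"
      using Ck_close_2D(1)[OF close imageI[OF yK]] yc c by simp
    show "norm (local_deriv c d (f \<omega>) y v - local_deriv c d (f \<omega>') y v) < e" if "norm v = 1"
      by (rule Ck_close_2D(2)[OF close imageI[OF yK] that])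
  qed
  moreover have "ball x s \<subseteq> fst c" using s by auto
  ultimately show ?thesis using that[of s "{\<omega>'. f \<omega>' \<in> N}"] s(1) by simp
qed

text \<open>Joint continuity: values at nearby parameters are uniformly close near \<open>x\<close>, and \<open>f \<omega>\<close> itself is
continuous at \<open>x\<close>.\<close>

lemma isCont_f: "isCont (\<lambda>q. f (snd q) (fst q)) (x, \<omega>)"
proof -
  define c where "c = chart_at A x"
  define d where "d = chart_at A (f \<omega> x)"
  have c: "c \<in> A" "x \<in> fst c" and d: "d \<in> A" "f \<omega> x \<in> fst d"
    using chart_at by (auto simp: c_def d_def)
  have fx: "isCont (\<lambda>y. snd d (f \<omega> y)) x"
  proof (rule isCont_o2[where f = "f \<omega>" and g = "snd d"])
    show "isCont (f \<omega>) x" using continuous_on_f by (simp add: continuous_on_eq_continuous_at)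
    show "isCont (snd d) (f \<omega> x)"
      using continuous_on_chart[OF d(1)] open_chart[OF d(1)] d(2) by (simp add: continuous_on_eq_continuous_at)
  qed
  have in_d: "\<forall>\<^sub>F q in nhds (x, \<omega>). f (snd q) (fst q) \<in> fst d"
  proof -
    obtain s W where sW: "0 < s" "ball x s \<subseteq> fst c" "open W" "\<omega> \<in> W"
      "\<And>y \<omega>'. \<lbrakk>y \<in> ball x s; \<omega>' \<in> W\<rbrakk> \<Longrightarrow> f \<omega>' y \<in> fst d"
      using local_closeness[OF c d, of 1] by (metis zero_less_one)
    have "\<forall>\<^sub>F q in nhds (x, \<omega>). q \<in> ball x s \<times> W"
      using sW by (intro eventually_nhds_in_open open_Times) auto
    then show ?thesis by eventually_elim (use sW in auto)
  qed
  have lim: "isCont (\<lambda>q. snd d (f (snd q) (fst q))) (x, \<omega>)"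
    unfolding isCont_def
  proof (rule tendstoI)
    fix e :: real assume "0 < e"
    obtain s W where sW: "0 < s" "ball x s \<subseteq> fst c" "open W" "\<omega> \<in> W"
      "\<And>y \<omega>'. \<lbrakk>y \<in> ball x s; \<omega>' \<in> W\<rbrakk> \<Longrightarrow> norm (snd d (f \<omega> y) - snd d (f \<omega>' y)) < e/2"
      using local_closeness[OF c d, of "e/2"] \<open>0 < e\<close> by (metis half_gt_zero)
    obtain t where "0 < t" "\<And>y. dist y x < t \<Longrightarrow> dist (snd d (f \<omega> y)) (snd d (f \<omega> x)) < e/2"
      using fx[unfolded continuous_at_eps_delta] \<open>0 < e\<close> by (meson half_gt_zero)
    then obtain T where T: "open T" "x \<in> T" "\<And>y. y \<in> T \<Longrightarrow> dist (snd d (f \<omega> y)) (snd d (f \<omega> x)) < e/2"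
      using open_ball centre_in_ball by (metis mem_ball dist_commute)
    have "\<forall>\<^sub>F q in at (x, \<omega>). q \<in> (ball x s \<inter> T) \<times> W"
      using sW T by (intro eventually_at_in_open' open_Times open_Int) auto
    then show "\<forall>\<^sub>F q in at (x, \<omega>). dist (snd d (f (snd q) (fst q))) (snd d (f (snd (x, \<omega>)) (fst (x, \<omega>)))) < e"
    proof eventually_elim
      case (elim q)
      then have "dist (snd d (f (snd q) (fst q))) (snd d (f \<omega> (fst q))) < e/2"
        "dist (snd d (f \<omega> (fst q))) (snd d (f \<omega> x)) < e/2"
        using sW(5)[of "fst q" "snd q"] T(3)[of "fst q"] by (auto simp: dist_norm norm_minus_commute)
      then show ?case using dist_triangle_half_r[of "snd d (f \<omega> (fst q))"] by (metis dist_commute fst_conv snd_conv)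
    qed
  qed
  have "isCont (chart_inv d) (snd d (f \<omega> x))"
    using continuous_on_chart_inv[OF d(1)] open_chart_image[OF d(1)] d(2)
    by (simp add: continuous_on_eq_continuous_at)
  from isCont_o2[OF lim] this
  have "isCont (\<lambda>q. chart_inv d (snd d (f (snd q) (fst q)))) (x, \<omega>)" by simp
  moreover have "\<forall>\<^sub>F q in nhds (x, \<omega>). chart_inv d (snd d (f (snd q) (fst q))) = f (snd q) (fst q)"
    using in_d by eventually_elim (use d in simp)
  ultimately show ?thesis by (simp add: isCont_cong)
qed

lemma continuous_on_f_joint: "continuous_on UNIV (\<lambda>q. f (snd q) (fst q))"
  by (intro continuous_at_imp_continuous_on ballI) (metis isCont_f prod.collapse)

definition chart_dom :: "('m, 'e) chart \<Rightarrow> ('m, 'e) chart \<Rightarrow> ('m \<times> 'w) set" where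
  "chart_dom c d = {q. fst q \<in> fst c \<and> f (snd q) (fst q) \<in> fst d}"

definition Df :: "('m, 'e) chart \<Rightarrow> ('m, 'e) chart \<Rightarrow> 'm \<times> 'w \<Rightarrow> 'e \<Rightarrow>\<^sub>L 'e" where
  "Df c d q = Blinfun (local_deriv c d (f (snd q)) (fst q))"

lemma open_chart_dom: "c \<in> A \<Longrightarrow> d \<in> A \<Longrightarrow> open (chart_dom c d)"
proof -
  assume "c \<in> A" "d \<in> A"
  then have "open (fst -` fst c \<inter> (\<lambda>q. f (snd q) (fst q)) -` fst d)"
    by (intro open_Int open_vimage open_chart continuous_on_f_joint continuous_on_fst continuous_on_id)
  moreover have "chart_dom c d = fst -` fst c \<inter> (\<lambda>q. f (snd q) (fst q)) -` fst d" by (auto simp: chart_dom_def)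
  ultimately show ?thesis by simp
qed

lemma local_rep_has_derivative:
  assumes "c \<in> A" "d \<in> A" "(x, \<omega>) \<in> chart_dom c d"
  shows "(local_rep c d (f \<omega>) has_derivative Df c d (x, \<omega>)) (at (snd c x))"
proof -
  have "local_rep c d (f \<omega>) differentiable at (snd c x)"
    by (rule Ck_map_differentiable[OF f_Ck]) (use assms in \<open>simp_all add: chart_dom_def\<close>)
  then have "(local_rep c d (f \<omega>) has_derivative local_deriv c d (f \<omega>) x) (at (snd c x))"
    by (simp add: frechet_derivative_works)
  moreover from has_derivative_bounded_linear[OF this]
  have "blinfun_apply (Df c d (x, \<omega>)) = local_deriv c d (f \<omega>) x"
    by (simp add: Df_def bounded_linear_Blinfun_apply)
  ultimately show ?thesis by simp
qed

lemma Df_apply: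
  assumes "c \<in> A" "d \<in> A" "(x, \<omega>) \<in> chart_dom c d"
  shows "blinfun_apply (Df c d (x, \<omega>)) = local_deriv c d (f \<omega>) x"
  using frechet_derivative_at[OF local_rep_has_derivative[OF assms]] .

lemma continuous_on_Df:
  assumes c: "c \<in> A" and d: "d \<in> A"
  shows "continuous_on (chart_dom c d) (Df c d)"
proof (rule continuous_on_blinfun_componentwise)
  fix v :: 'e assume "v \<in> Basis"
  then have v: "norm v = 1" by simp
  have "isCont (\<lambda>q. Df c d q v) (x, \<omega>)" if q: "(x, \<omega>) \<in> chart_dom c d" for x \<omega>
    unfolding isCont_def
  proof (rule tendstoI)
    fix e :: real assume "0 < e"
    have x: "x \<in> fst c" "f \<omega> x \<in> fst d" using q by (auto simp: chart_dom_def)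
    obtain s W where sW: "0 < s" "ball x s \<subseteq> fst c" "open W" "\<omega> \<in> W"
      "\<And>y \<omega>' v. \<lbrakk>y \<in> ball x s; \<omega>' \<in> W; norm v = 1\<rbrakk> \<Longrightarrow>
        norm (local_deriv c d (f \<omega>) y v - local_deriv c d (f \<omega>') y v) < e/2"
      using local_closeness[OF c x(1) d x(2), of "e/2"] \<open>0 < e\<close> by (metis half_gt_zero)
    define O' where "O' = fst c \<inter> f \<omega> -` fst d"
    have O': "open O'" "x \<in> O'"
      using x unfolding O'_def
      by (intro open_Int open_vimage open_chart c d continuous_on_f, simp)
    have lim: "isCont (\<lambda>y. local_deriv c d (f \<omega>) y v) x"
      using continuous_on_local_deriv[OF f_Ck c d, of \<omega> v] O' unfolding O'_def
      by (simp add: continuous_on_eq_continuous_at)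
    obtain t where "0 < t"
      "\<And>y. dist y x < t \<Longrightarrow> dist (local_deriv c d (f \<omega>) y v) (local_deriv c d (f \<omega>) x v) < e/2"
      using lim[unfolded continuous_at_eps_delta] \<open>0 < e\<close> by (meson half_gt_zero)
    then obtain T where T: "open T" "x \<in> T"
      "\<And>y. y \<in> T \<Longrightarrow> dist (local_deriv c d (f \<omega>) y v) (local_deriv c d (f \<omega>) x v) < e/2"
      using open_ball centre_in_ball by (metis mem_ball dist_commute)
    have "\<forall>\<^sub>F q in at (x, \<omega>). q \<in> chart_dom c d \<inter> ((ball x s \<inter> T) \<times> W)"
      using sW T q by (intro eventually_at_in_open' open_Times open_Int open_chart_dom c d) auto
    then show "\<forall>\<^sub>F q in at (x, \<omega>). dist (Df c d q v) (Df c d (x, \<omega>) v) < e"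
    proof eventually_elim
      case (elim q)
      obtain y \<omega>' where yw: "q = (y, \<omega>')" by force
      have "dist (local_deriv c d (f \<omega>') y v) (local_deriv c d (f \<omega>) y v) < e/2"
        "dist (local_deriv c d (f \<omega>) y v) (local_deriv c d (f \<omega>) x v) < e/2"
        using sW(5)[of y \<omega>' v] T(3)[of y] elim v yw by (auto simp: dist_norm norm_minus_commute)
      then have "dist (local_deriv c d (f \<omega>') y v) (local_deriv c d (f \<omega>) x v) < e"
        using dist_triangle_half_r by (metis dist_commute)
      then show ?case using Df_apply[OF c d] q elim yw by simp
    qed
  qed
  then show "continuous_on (chart_dom c d) (\<lambda>q. Df c d q v)"
    by (intro continuous_at_imp_continuous_on) auto
qed

definition chart_norm :: "('m, 'e) chart \<Rightarrow> 'm \<Rightarrow> 'e \<Rightarrow> real" where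
  "chart_norm c x v = tangent_norm G x (tangent_from_chart A c x v)"

lemma G_properties: "bilinear (G x)" "G x u v = G x v u" "v \<noteq> 0 \<Longrightarrow> 0 < G x v v" "0 \<le> G x v v"
proof -
  show "bilinear (G x)" "G x u v = G x v u" and pos: "v \<noteq> 0 \<Longrightarrow> 0 < G x v v"
    using metric by (auto simp: riemannian_metric_def)
  then show "0 \<le> G x v v" using bilinear_lzero[of "G x" v] by (cases "v = 0") force+
qed

context
  fixes c x assumes c: "c \<in> A" and x: "x \<in> fst c"
begin

lemma chart_norm_triangle: "chart_norm c x (u + v) \<le> chart_norm c x u + chart_norm c x v"
  unfolding chart_norm_def tangent_norm_def linear_add[OF linear_tangent_from_chart[OF c x]]
  by (rule bilinear_Cauchy_Schwarz_triangle) (use G_properties in auto)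

lemma chart_norm_nonneg: "0 \<le> chart_norm c x v"
  unfolding chart_norm_def tangent_norm_def using G_properties by simp

lemma chart_norm_scale: "chart_norm c x (a *\<^sub>R v) = \<bar>a\<bar> * chart_norm c x v"
  unfolding chart_norm_def tangent_norm_def linear_cmul[OF linear_tangent_from_chart[OF c x]]
  by (simp add: bilinear_lmul[OF G_properties(1)] bilinear_rmul[OF G_properties(1)] real_sqrt_mult
      flip: mult.assoc)

lemma chart_norm_pos: "v \<noteq> 0 \<Longrightarrow> 0 < chart_norm c x v"
proof -
  assume "v \<noteq> 0"
  then have "tangent_from_chart A c x v \<noteq> 0"
    using tangent_to_from_chart[OF c x, of v] linear_0[OF linear_tangent_to_chart[OF c x]] by auto
  then show ?thesis unfolding chart_norm_def tangent_norm_def using G_properties(3) by simp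
qed

end

text \<open>Smoothness of the metric is given for fixed pairs of vectors. Expanding in a basis makes the norm
continuous in point and vector jointly.\<close>

lemma continuous_on_chart_norm:
  assumes c: "c \<in> A"
  shows "continuous_on (fst c \<times> UNIV) (\<lambda>q. chart_norm c (fst q) (snd q))"
proof -
  define g where "g u v x = G x (tangent_from_chart A c x u) (tangent_from_chart A c x v)" for u v x
  have cont: "continuous_on (fst c) (g u v)" for u v
  proof -
    have "smooth_on (snd c ` fst c) (\<lambda>y. let x = chart_inv c y
              in G x (tangent_from_chart A c x u) (tangent_from_chart A c x v))"
      using metric c unfolding riemannian_metric_def by blast
    then have "Ck_on 0 (snd c ` fst c) (\<lambda>y. let x = chart_inv c y
              in G x (tangent_from_chart A c x u) (tangent_from_chart A c x v))"
      unfolding smooth_on_def by blast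
    then have "continuous_on (snd c ` fst c) (\<lambda>y. g u v (chart_inv c y))"
      by (simp add: g_def Let_def)
    then have "continuous_on (fst c) (\<lambda>x. g u v (chart_inv c (snd c x)))"
      by (rule continuous_on_compose2) (use continuous_on_chart[OF c] in auto)
    then show ?thesis by (rule continuous_on_eq) (use c in auto)
  qed
  have expand: "chart_norm c x v = sqrt (\<Sum>i\<in>Basis. \<Sum>j\<in>Basis. (v \<bullet> i) * ((v \<bullet> j) * g i j x))"
    if x: "x \<in> fst c" for x v
  proof -
    have "g v v x = g (\<Sum>i\<in>Basis. (v \<bullet> i) *\<^sub>R i) (\<Sum>j\<in>Basis. (v \<bullet> j) *\<^sub>R j) x"
      by (simp add: euclidean_representation)
    also have "\<dots> = (\<Sum>i\<in>Basis. \<Sum>j\<in>Basis. (v \<bullet> i) * ((v \<bullet> j) * g i j x))"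
      unfolding g_def linear_sum[OF linear_tangent_from_chart[OF c x]]
        linear_cmul[OF linear_tangent_from_chart[OF c x]] bilinear_sum[OF G_properties(1)]
      by (simp add: bilinear_lmul[OF G_properties(1)] bilinear_rmul[OF G_properties(1)] sum.cartesian_product mult_ac)
    finally show ?thesis by (simp add: chart_norm_def tangent_norm_def g_def)
  qed
  have "continuous_on (fst c \<times> UNIV)
      (\<lambda>q. sqrt (\<Sum>i\<in>Basis. \<Sum>j\<in>Basis. (snd q \<bullet> i) * ((snd q \<bullet> j) * g i j (fst q))))"
    by (intro continuous_intros continuous_on_compose2[OF cont]) auto
  then show ?thesis by (rule continuous_on_eq) (auto simp: expand)
qed

end

section \<open>Neighbourhoods of compact sets\<close>

lemma compact_open_margin:
  fixes K S :: "'a::metric_space set"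
  assumes "compact K" "open S" "K \<subseteq> S"
  obtains \<delta> where "0 < \<delta>" "\<And>x y. \<lbrakk>x \<in> K; dist x y < \<delta>\<rbrakk> \<Longrightarrow> y \<in> S"
proof -
  obtain \<delta> where "0 < \<delta>" "(\<Union>x\<in>K. ball x \<delta>) \<subseteq> S"
    using compact_subset_open_imp_ball_epsilon_subset[OF assms] .
  then show ?thesis using that[of \<delta>] by (meson UN_I mem_ball subsetD)
qed

lemma open_Collect_on:
  fixes g h :: "'a::topological_space \<Rightarrow> real"
  assumes "open S" "continuous_on S g" "continuous_on S h"
  shows "open {x \<in> S. g x < h x}"
proof -
  have "continuous_on S (\<lambda>x. h x - g x)" by (intro continuous_intros assms)
  from continuous_open_preimage[OF this assms(1), of "{0<..}"]
  show ?thesis by (simp add: Int_def vimage_def)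
qed

text \<open>Unlike uniform continuity on the compact set, this compares a point of \<open>K\<close> with arbitrary nearby
points, which is what perturbing an orbit requires.\<close>

lemma uniformly_continuous_near_compact:
  fixes g :: "'a::metric_space \<Rightarrow> 'b::metric_space"
  assumes K: "compact K" "K \<subseteq> S" and S: "open S" and g: "continuous_on S g" and "0 < e"
  obtains \<delta> where "0 < \<delta>" "\<And>x y. \<lbrakk>x \<in> K; dist x y < \<delta>\<rbrakk> \<Longrightarrow> y \<in> S \<and> dist (g x) (g y) < e"
proof -
  have "continuous_on (S \<times> S) (\<lambda>p. dist (g (fst p)) (g (snd p)))"
    by (intro continuous_intros continuous_on_compose2[OF g]) auto
  then have "open {p \<in> S \<times> S. dist (g (fst p)) (g (snd p)) < e}"
    using S by (intro open_Collect_on open_Times continuous_on_const)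
  moreover have "compact ((\<lambda>x. (x, x)) ` K)"
    by (intro compact_continuous_image K continuous_intros)
  ultimately obtain \<delta> where \<delta>: "0 < \<delta>"
    "\<And>x y. \<lbrakk>x \<in> (\<lambda>x. (x, x)) ` K; dist x y < \<delta>\<rbrakk> \<Longrightarrow> y \<in> {p \<in> S \<times> S. dist (g (fst p)) (g (snd p)) < e}"
    using compact_open_margin[of "(\<lambda>x. (x, x)) ` K"] K \<open>0 < e\<close> by (smt (verit) image_subset_iff mem_Collect_eq SigmaI dist_self fst_conv snd_conv subsetD)
  show ?thesis
  proof (rule that[OF \<delta>(1)])
    fix x y assume "x \<in> K" "dist x y < \<delta>"
    then show "y \<in> S \<and> dist (g x) (g y) < e"
      using \<delta>(2)[of "(x, x)" "(x, y)"] by (auto simp: dist_Pair_Pair)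
  qed
qed

lemma compact_pos_bounds:
  fixes g :: "'a::topological_space \<Rightarrow> real"
  assumes K: "compact K" and g: "continuous_on K g" and pos: "\<And>x. x \<in> K \<Longrightarrow> 0 < g x"
  obtains B where "1 \<le> B" "\<And>x. x \<in> K \<Longrightarrow> g x \<le> B" "\<And>x. x \<in> K \<Longrightarrow> 1 \<le> B * g x"
proof (cases "K = {}")
  case True
  then show ?thesis using that[of 1] by simp
next
  case False
  obtain a where a: "a \<in> K" "\<And>x. x \<in> K \<Longrightarrow> g x \<le> g a"
    using continuous_attains_sup[OF K False g] by blast
  obtain b where b: "b \<in> K" "\<And>x. x \<in> K \<Longrightarrow> g b \<le> g x"
    using continuous_attains_inf[OF K False g] by blast
  define B where "B = Max {1, g a, 1 / g b}"
  have B: "1 \<le> B" "g a \<le> B" "1 / g b \<le> B" by (simp_all add: B_def)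
  show ?thesis
  proof (rule that[OF B(1)])
    fix x assume x: "x \<in> K"
    show "g x \<le> B" using a(2)[OF x] B by linarith
    have "1 \<le> B * g b" using B(3) pos[OF b(1)] by (simp add: field_simps)
    also have "\<dots> \<le> B * g x" using b(2)[OF x] B by (intro mult_left_mono) auto
    finally show "1 \<le> B * g x" .
  qed
qed

section \<open>The hyperbolic splitting in charts\<close>

locale anosov_splitting = random_diffeo A G \<theta> f
  for A :: "('m::metric_space, 'e::euclidean_space) chart set"
    and G :: "'m \<Rightarrow> 'e \<Rightarrow> 'e \<Rightarrow> real"
    and \<theta> :: "'w::metric_space \<Rightarrow> 'w"
    and f :: "'w \<Rightarrow> 'm \<Rightarrow> 'm" +
  fixes Eu Es :: "'m \<times> 'w \<Rightarrow> 'e set" and \<kappa> :: real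
  assumes splitting: "complementary (Eu p) (Es p)"
    and Eu_continuous: "continuous_subbundle A Eu" and Es_continuous: "continuous_subbundle A Es"
    and Eu_invariant: "tangent_map A (f \<omega>) x ` Eu (x, \<omega>) = Eu (f \<omega> x, \<theta> \<omega>)"
    and Es_invariant: "tangent_map A (f \<omega>) x ` Es (x, \<omega>) = Es (f \<omega> x, \<theta> \<omega>)"
    and \<kappa>_pos: "0 < \<kappa>"
    and expanding: "\<xi> \<in> Eu (x, \<omega>) \<Longrightarrow>
      exp \<kappa> * tangent_norm G x \<xi> \<le> tangent_norm G (f \<omega> x) (tangent_map A (f \<omega>) x \<xi>)"
    and contracting: "\<eta> \<in> Es (x, \<omega>) \<Longrightarrow>
      tangent_norm G (f \<omega> x) (tangent_map A (f \<omega>) x \<eta>) \<le> exp (- \<kappa>) * tangent_norm G x \<eta>"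
begin

definition chart_Eu :: "('m, 'e) chart \<Rightarrow> 'm \<times> 'w \<Rightarrow> 'e set" where
  "chart_Eu c q = tangent_to_chart A c (fst q) ` Eu q"

definition chart_Es :: "('m, 'e) chart \<Rightarrow> 'm \<times> 'w \<Rightarrow> 'e set" where
  "chart_Es c q = tangent_to_chart A c (fst q) ` Es q"

definition proj_u :: "('m, 'e) chart \<Rightarrow> 'm \<times> 'w \<Rightarrow> 'e \<Rightarrow>\<^sub>L 'e" where
  "proj_u c q = projection_along (chart_Eu c q) (chart_Es c q)"

lemma chart_splitting:
  assumes c: "c \<in> A" and q: "fst q \<in> fst c"
  shows "complementary (chart_Eu c q) (chart_Es c q)"
proof -
  let ?T = "tangent_to_chart A c (fst q)" and ?T' = "tangent_from_chart A c (fst q)"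
  have lin: "linear ?T" by (rule linear_tangent_to_chart[OF c q])
  have sub: "subspace (Eu q)" "subspace (Es q)" and int: "Eu q \<inter> Es q = {0}"
    and sum: "{u + s | u s. u \<in> Eu q \<and> s \<in> Es q} = UNIV"
    using splitting[of q] by (auto simp: complementary_def)
  have "inj ?T" by (rule inj_on_inverseI[of _ ?T']) (rule tangent_from_to_chart[OF c q])
  then have "chart_Eu c q \<inter> chart_Es c q = ?T ` {0}"
    unfolding chart_Eu_def chart_Es_def int[symmetric] by (simp add: image_Int)
  moreover have "v \<in> {u + s | u s. u \<in> chart_Eu c q \<and> s \<in> chart_Es c q}" for v
  proof -
    have "?T' v \<in> {u + s | u s. u \<in> Eu q \<and> s \<in> Es q}" by (simp add: sum)
    then obtain u s where us: "?T' v = u + s" "u \<in> Eu q" "s \<in> Es q" by blast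
    have "v = ?T (u + s)" using tangent_to_from_chart[OF c q, of v] us(1) by simp
    then have "v = ?T u + ?T s" by (simp add: linear_add[OF lin])
    then show ?thesis using us(2,3) unfolding chart_Eu_def chart_Es_def by blast
  qed
  ultimately show ?thesis
    unfolding complementary_def
    using linear_subspace_image[OF lin sub(1)] linear_subspace_image[OF lin sub(2)] linear_0[OF lin]
    by (simp add: chart_Eu_def[symmetric] chart_Es_def[symmetric])
qed

lemma proj_u_mem:
  assumes "c \<in> A" "fst q \<in> fst c"
  shows "proj_u c q v \<in> chart_Eu c q" "v - proj_u c q v \<in> chart_Es c q"
  unfolding proj_u_def by (rule projection_along_mem[OF chart_splitting[OF assms]])+

lemma proj_u_Eu: "c \<in> A \<Longrightarrow> fst q \<in> fst c \<Longrightarrow> u \<in> chart_Eu c q \<Longrightarrow> proj_u c q u = u"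
  unfolding proj_u_def by (rule projection_along_left[OF chart_splitting])

lemma proj_u_Es: "c \<in> A \<Longrightarrow> fst q \<in> fst c \<Longrightarrow> s \<in> chart_Es c q \<Longrightarrow> proj_u c q s = 0"
  unfolding proj_u_def by (rule projection_along_right[OF chart_splitting])

lemma proj_u_idem: "c \<in> A \<Longrightarrow> fst q \<in> fst c \<Longrightarrow> proj_u c q (proj_u c q v) = proj_u c q v"
  using proj_u_Eu proj_u_mem by blast

lemma proj_u_kernel: "c \<in> A \<Longrightarrow> fst q \<in> fst c \<Longrightarrow> proj_u c q (v - proj_u c q v) = 0"
  by (simp add: blinfun.diff_right proj_u_idem)

lemma continuous_on_proj_u:
  assumes c: "c \<in> A"
  shows "continuous_on (fst c \<times> UNIV) (proj_u c)"
proof (intro continuous_at_imp_continuous_on ballI)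
  fix p :: "'m \<times> 'w" assume p: "p \<in> fst c \<times> UNIV"
  obtain W1 and k :: nat and b where "open W1 \<and> p \<in> W1 \<and> W1 \<subseteq> fst c \<times> UNIV \<and> (\<forall>i<k. continuous_on W1 (b i)) \<and>
    (\<forall>q\<in>W1. inj_on (\<lambda>i. b i q) {..<k} \<and> independent ((\<lambda>i. b i q) ` {..<k}) \<and>
           span ((\<lambda>i. b i q) ` {..<k}) = tangent_to_chart A c (fst q) ` Eu q)"
    using bspec[OF bspec[OF Eu_continuous[unfolded continuous_subbundle_def] c] p]
    by - (erule exE, erule exE, erule exE, erule that)
  then have 1: "open W1" "p \<in> W1" "W1 \<subseteq> fst c \<times> UNIV" "\<And>i. i < k \<Longrightarrow> continuous_on W1 (b i)"
    "\<And>q. q \<in> W1 \<Longrightarrow> inj_on (\<lambda>i. b i q) {..<k} \<and> independent ((\<lambda>i. b i q) ` {..<k}) \<and>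
           span ((\<lambda>i. b i q) ` {..<k}) = chart_Eu c q"
    by (simp_all add: chart_Eu_def)
  obtain W2 and l :: nat and b' where "open W2 \<and> p \<in> W2 \<and> W2 \<subseteq> fst c \<times> UNIV \<and> (\<forall>i<l. continuous_on W2 (b' i)) \<and>
    (\<forall>q\<in>W2. inj_on (\<lambda>i. b' i q) {..<l} \<and> independent ((\<lambda>i. b' i q) ` {..<l}) \<and>
           span ((\<lambda>i. b' i q) ` {..<l}) = tangent_to_chart A c (fst q) ` Es q)"
    using bspec[OF bspec[OF Es_continuous[unfolded continuous_subbundle_def] c] p]
    by - (erule exE, erule exE, erule exE, erule that)
  then have 2: "open W2" "p \<in> W2" "W2 \<subseteq> fst c \<times> UNIV" "\<And>i. i < l \<Longrightarrow> continuous_on W2 (b' i)"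
    "\<And>q. q \<in> W2 \<Longrightarrow> inj_on (\<lambda>i. b' i q) {..<l} \<and> independent ((\<lambda>i. b' i q) ` {..<l}) \<and>
           span ((\<lambda>i. b' i q) ` {..<l}) = chart_Es c q"
    by (simp_all add: chart_Es_def)
  show "isCont (proj_u c) p"
    unfolding proj_u_def[abs_def]
  proof (rule isCont_projection_along[of "W1 \<inter> W2" p _ _ k b l b'])
    show "open (W1 \<inter> W2)" "p \<in> W1 \<inter> W2" using 1 2 by auto
    show "complementary (chart_Eu c q) (chart_Es c q)" if "q \<in> W1 \<inter> W2" for q
      using that 1(3) by (intro chart_splitting c) auto
    show "continuous_on (W1 \<inter> W2) (b i)" if "i < k" for i
      by (rule continuous_on_subset[OF 1(4)[OF that]]) simp
    show "continuous_on (W1 \<inter> W2) (b' i)" if "i < l" for i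
      by (rule continuous_on_subset[OF 2(4)[OF that]]) simp
  qed (use 1(5) 2(5) in simp_all)
qed

context
  fixes c d x \<omega>
  assumes c: "c \<in> A" and d: "d \<in> A" and xw: "(x, \<omega>) \<in> chart_dom c d"
begin

lemma in_charts: "x \<in> fst c" "f \<omega> x \<in> fst d"
  using xw by (auto simp: chart_dom_def)

lemma Df_tangent: "Df c d (x, \<omega>) v =
    tangent_to_chart A d (f \<omega> x) (tangent_map A (f \<omega>) x (tangent_from_chart A c x v))"
  unfolding Df_apply[OF c d xw]
  by (rule tangent_map_in_charts[OF f_Ck c in_charts(1) d in_charts(2), symmetric])

lemma Df_Eu:
  assumes "u \<in> chart_Eu c (x, \<omega>)"
  shows "Df c d (x, \<omega>) u \<in> chart_Eu d (f \<omega> x, \<theta> \<omega>)"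
    and "exp \<kappa> * chart_norm c x u \<le> chart_norm d (f \<omega> x) (Df c d (x, \<omega>) u)"
proof -
  obtain \<xi> where \<xi>: "\<xi> \<in> Eu (x, \<omega>)" "u = tangent_to_chart A c x \<xi>"
    using assms by (auto simp: chart_Eu_def)
  have chart_vec: "tangent_from_chart A c x u = \<xi>" using \<xi>(2) tangent_from_to_chart[OF c in_charts(1)] by simp
  then have Df: "Df c d (x, \<omega>) u = tangent_to_chart A d (f \<omega> x) (tangent_map A (f \<omega>) x \<xi>)"
    by (simp add: Df_tangent)
  have "tangent_map A (f \<omega>) x \<xi> \<in> Eu (f \<omega> x, \<theta> \<omega>)" using Eu_invariant \<xi>(1) by blast
  then show "Df c d (x, \<omega>) u \<in> chart_Eu d (f \<omega> x, \<theta> \<omega>)" unfolding Df by (simp add: chart_Eu_def)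
  show "exp \<kappa> * chart_norm c x u \<le> chart_norm d (f \<omega> x) (Df c d (x, \<omega>) u)"
    unfolding Df chart_norm_def chart_vec tangent_from_to_chart[OF d in_charts(2)] by (rule expanding[OF \<xi>(1)])
qed

lemma Df_Es:
  assumes "s \<in> chart_Es c (x, \<omega>)"
  shows "Df c d (x, \<omega>) s \<in> chart_Es d (f \<omega> x, \<theta> \<omega>)"
    and "chart_norm d (f \<omega> x) (Df c d (x, \<omega>) s) \<le> exp (- \<kappa>) * chart_norm c x s"
proof -
  obtain \<xi> where \<xi>: "\<xi> \<in> Es (x, \<omega>)" "s = tangent_to_chart A c x \<xi>"
    using assms by (auto simp: chart_Es_def)
  have chart_vec: "tangent_from_chart A c x s = \<xi>" using \<xi>(2) tangent_from_to_chart[OF c in_charts(1)] by simp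
  then have Df: "Df c d (x, \<omega>) s = tangent_to_chart A d (f \<omega> x) (tangent_map A (f \<omega>) x \<xi>)"
    by (simp add: Df_tangent)
  have "tangent_map A (f \<omega>) x \<xi> \<in> Es (f \<omega> x, \<theta> \<omega>)" using Es_invariant \<xi>(1) by blast
  then show "Df c d (x, \<omega>) s \<in> chart_Es d (f \<omega> x, \<theta> \<omega>)" unfolding Df by (simp add: chart_Es_def)
  show "chart_norm d (f \<omega> x) (Df c d (x, \<omega>) s) \<le> exp (- \<kappa>) * chart_norm c x s"
    unfolding Df chart_norm_def chart_vec tangent_from_to_chart[OF d in_charts(2)] by (rule contracting[OF \<xi>(1)])
qed

text \<open>The derivative maps the stable and the unstable space onto their successors, so it is onto, and
hence injective for reasons of dimension.\<close>

lemma inj_Df: "inj (Df c d (x, \<omega>))"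
proof -
  have lin: "linear (Df c d (x, \<omega>))" by (simp add: blinfun.bounded_linear_right bounded_linear.linear)
  have onto_tm: "\<exists>w. tangent_map A (f \<omega>) x w = v \<and> w \<in> Eu (x, \<omega>)" if "v \<in> Eu (f \<omega> x, \<theta> \<omega>)" for v
    using that Eu_invariant[of \<omega> x] by (metis imageE)
  have onto_tm': "\<exists>w. tangent_map A (f \<omega>) x w = v \<and> w \<in> Es (x, \<omega>)" if "v \<in> Es (f \<omega> x, \<theta> \<omega>)" for v
    using that Es_invariant[of \<omega> x] by (metis imageE)
  have range: "tangent_to_chart A d (f \<omega> x) (tangent_map A (f \<omega>) x w) \<in> range (Df c d (x, \<omega>))" for w
    using Df_tangent[of "tangent_to_chart A c x w"] tangent_from_to_chart[OF c in_charts(1), of w]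
    by (metis rangeI)
  have "v \<in> range (Df c d (x, \<omega>))" for v
  proof -
    let ?w = "tangent_from_chart A d (f \<omega> x) v"
    have "?w \<in> {u + s | u s. u \<in> Eu (f \<omega> x, \<theta> \<omega>) \<and> s \<in> Es (f \<omega> x, \<theta> \<omega>)}"
      using splitting by (simp add: complementary_def)
    then obtain u s where us: "?w = u + s" "u \<in> Eu (f \<omega> x, \<theta> \<omega>)" "s \<in> Es (f \<omega> x, \<theta> \<omega>)" by blast
    have "v = tangent_to_chart A d (f \<omega> x) u + tangent_to_chart A d (f \<omega> x) s"
      using tangent_to_from_chart[OF d in_charts(2), of v] us(1)
      by (simp add: linear_add[OF linear_tangent_to_chart[OF d in_charts(2)]])
    moreover have "tangent_to_chart A d (f \<omega> x) u \<in> range (Df c d (x, \<omega>))"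
      using range onto_tm[OF us(2)] by metis
    moreover have "tangent_to_chart A d (f \<omega> x) s \<in> range (Df c d (x, \<omega>))"
      using range onto_tm'[OF us(3)] by metis
    ultimately show ?thesis using subspace_add[OF linear_subspace_image[OF lin subspace_UNIV]] by metis
  qed
  then have "surj (Df c d (x, \<omega>))" by (simp add: set_eq_iff)
  then show ?thesis by (rule linear_surjective_imp_injective[OF lin]) (rule refl)
qed

end

end

section \<open>Uniform estimates along pseudo-orbits\<close>

lemma eventually_at_right_0I:
  fixes \<delta> :: real
  assumes "0 < \<delta>" "\<And>\<delta>'. \<lbrakk>0 < \<delta>'; \<delta>' \<le> \<delta>\<rbrakk> \<Longrightarrow> P \<delta>'"
  shows "eventually P (at_right 0)"
  using assms by (auto simp: eventually_at_right_field intro!: exI[of _ \<delta>])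

context anosov_splitting
begin

text \<open>The points at distance at least \<open>\<rho>\<close> from the complement of the chart domain; it is stated without
\<open>infdist\<close>, which vanishes on the empty set, so that a chart with domain \<open>UNIV\<close> causes no exception.\<close>

definition inner_chart :: "('m, 'e) chart \<Rightarrow> real \<Rightarrow> 'm set" where
  "inner_chart c \<rho> = {x. \<forall>y. y \<notin> fst c \<longrightarrow> \<rho> \<le> dist x y}"

lemma inner_chart_subset: "0 < \<rho> \<Longrightarrow> inner_chart c \<rho> \<subseteq> fst c"
  by (force simp: inner_chart_def)

lemma compact_inner_chart: "compact (inner_chart c \<rho>)"
proof -
  have "closed {x. \<rho> \<le> dist x y}" for y :: 'm
    by (intro closed_Collect_le continuous_intros)
  then have "closed (\<Inter>y\<in>- fst c. {x. \<rho> \<le> dist x y})" by blast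
  moreover have "inner_chart c \<rho> = (\<Inter>y\<in>- fst c. {x. \<rho> \<le> dist x y})" by (auto simp: inner_chart_def)
  ultimately show ?thesis using compact_Int_closed[OF compact_M] by simp
qed

lemma inner_chart_near:
  assumes "x \<in> inner_chart c (\<rho> + \<sigma>)" "dist x z \<le> \<sigma>"
  shows "z \<in> inner_chart c \<rho>"
  unfolding inner_chart_def
proof safe
  fix y assume "y \<notin> fst c"
  then have "\<rho> + \<sigma> \<le> dist x y" using assms(1) by (simp add: inner_chart_def)
  then show "\<rho> \<le> dist z y" using dist_triangle[of x y z] assms(2) by linarith
qed

text \<open>A step of a pseudo-orbit is recorded as \<open>((x, \<omega>), x')\<close>, where \<open>x'\<close> is meant to be near \<open>f \<omega> x\<close>. The
exact steps between two inner charts form a compact set. Hence every open condition that holds on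
exact steps holds on all steps with a sufficiently small jump.\<close>

definition step_graph :: "('m, 'e) chart \<Rightarrow> ('m, 'e) chart \<Rightarrow> real \<Rightarrow> (('m \<times> 'w) \<times> 'm) set" where
  "step_graph c d \<rho> = {t. fst (fst t) \<in> inner_chart c \<rho> \<and> snd t \<in> inner_chart d \<rho> \<and>
     snd t = f (snd (fst t)) (fst (fst t))}"

lemma step_graph_iff [simp]:
  "((x, \<omega>), f \<omega> x) \<in> step_graph c d \<rho> \<longleftrightarrow> x \<in> inner_chart c \<rho> \<and> f \<omega> x \<in> inner_chart d \<rho>"
  by (simp add: step_graph_def)

lemma compact_step_graph: "compact (step_graph c d \<rho>)"
proof -
  have "closed (((\<lambda>t. fst (fst t)) -` inner_chart c \<rho>) \<inter> (snd -` inner_chart d \<rho>) \<inter>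
      {t :: ('m \<times> 'w) \<times> 'm. snd t = f (snd (fst t)) (fst (fst t))})"
    by (intro closed_Int closed_vimage closed_Collect_eq compact_imp_closed compact_inner_chart
        continuous_intros continuous_on_compose2[OF continuous_on_f_joint, of _ fst]) auto
  moreover have "compact (UNIV :: (('m \<times> 'w) \<times> 'm) set)"
    using compact_Times[OF compact_Times[OF compact_M compact_base] compact_M] by simp
  moreover have "step_graph c d \<rho> = ((\<lambda>t. fst (fst t)) -` inner_chart c \<rho>) \<inter> (snd -` inner_chart d \<rho>) \<inter>
      {t. snd t = f (snd (fst t)) (fst (fst t))}"
    by (auto simp: step_graph_def)
  ultimately show ?thesis using compact_Int_closed by (metis Int_UNIV_left)
qed

text \<open>The vector \<open>v\<close> allows for conditions on unit vectors, which form a compact set as well.\<close>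

lemma near_step_graph:
  fixes S W :: "((('m \<times> 'w) \<times> 'm) \<times> 'v::metric_space) set"
  assumes "compact S" "open W" "S \<subseteq> W"
  shows "\<forall>\<^sub>F \<delta> in at_right 0. \<forall>x \<omega> x' v.
           (((x, \<omega>), f \<omega> x), v) \<in> S \<longrightarrow> dist (f \<omega> x) x' < \<delta> \<longrightarrow> (((x, \<omega>), x'), v) \<in> W"
proof -
  obtain \<delta> where \<delta>: "0 < \<delta>" "\<And>a b. \<lbrakk>a \<in> S; dist a b < \<delta>\<rbrakk> \<Longrightarrow> b \<in> W"
    using compact_open_margin[OF assms] by blast
  show ?thesis
  proof (rule eventually_at_right_0I[OF \<delta>(1)], intro allI impI)
    fix \<delta>' x \<omega> x' v
    assume "\<delta>' \<le> \<delta>" "(((x, \<omega>), f \<omega> x), v) \<in> S" "dist (f \<omega> x) x' < \<delta>'"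
    then show "(((x, \<omega>), x'), v) \<in> W" by (intro \<delta>(2)) (auto simp: dist_Pair_Pair)
  qed
qed

text \<open>At a step with a jump the derivative maps the splitting at \<open>(x, \<omega>)\<close> to the one at \<open>f \<omega> x\<close> and not to
the one at \<open>x'\<close>. Dropping the off-diagonal blocks of the derivative gives a nearby linear map that
respects the splittings at \<open>(x, \<omega>)\<close> and \<open>x'\<close> exactly; at exact steps nothing changes.\<close>

definition adapted :: "('m, 'e) chart \<Rightarrow> ('m, 'e) chart \<Rightarrow> ('m \<times> 'w) \<times> 'm \<Rightarrow> 'e \<Rightarrow>\<^sub>L 'e" where
  "adapted c d t = (let P = proj_u c (fst t); P' = proj_u d (snd t, \<theta> (snd (fst t))); L = Df c d (fst t)
     in (P' o\<^sub>L L o\<^sub>L P) + ((id_blinfun - P') o\<^sub>L L o\<^sub>L (id_blinfun - P)))"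

definition step_dom :: "('m, 'e) chart \<Rightarrow> ('m, 'e) chart \<Rightarrow> (('m \<times> 'w) \<times> 'm) set" where
  "step_dom c d = chart_dom c d \<times> fst d"

lemma continuous_on_\<theta>: "continuous_on UNIV \<theta>"
  using \<theta>_homeo by (simp add: homeomorphism_def)

lemma open_step_dom: "c \<in> A \<Longrightarrow> d \<in> A \<Longrightarrow> open (step_dom c d)"
  unfolding step_dom_def by (intro open_Times open_chart_dom open_chart)

lemma step_graph_subset_dom:
  assumes "0 < \<rho>"
  shows "step_graph c d \<rho> \<subseteq> step_dom c d"
proof
  fix t assume "t \<in> step_graph c d \<rho>"
  then show "t \<in> step_dom c d"
    using subsetD[OF inner_chart_subset[OF assms, of c]] subsetD[OF inner_chart_subset[OF assms, of d]]
    by (cases t) (simp add: step_graph_def step_dom_def chart_dom_def)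
qed

lemma continuous_on_adapted:
  assumes c: "c \<in> A" and d: "d \<in> A"
  shows "continuous_on (step_dom c d) (adapted c d)"
proof -
  have 1: "continuous_on (step_dom c d) (\<lambda>t. Df c d (fst t))"
    by (rule continuous_on_compose2[OF continuous_on_Df[OF c d]])
       (auto intro!: continuous_intros simp: step_dom_def)
  have 2: "continuous_on (step_dom c d) (\<lambda>t. proj_u c (fst t))"
    by (rule continuous_on_compose2[OF continuous_on_proj_u[OF c]])
       (auto intro!: continuous_intros simp: step_dom_def chart_dom_def)
  have 3: "continuous_on (step_dom c d) (\<lambda>t. proj_u d (snd t, \<theta> (snd (fst t))))"
    by (rule continuous_on_compose2[OF continuous_on_proj_u[OF d]])
       (auto intro!: continuous_intros continuous_on_compose2[OF continuous_on_\<theta>] simp: step_dom_def chart_dom_def)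
  show ?thesis unfolding adapted_def Let_def
    by (intro continuous_on_add bounded_bilinear.continuous_on[OF bounded_bilinear_blinfun_compose]
        continuous_on_diff continuous_on_const 1 2 3)
qed

lemma adapted_apply:
  "adapted c d ((x, \<omega>), x') v =
     proj_u d (x', \<theta> \<omega>) (Df c d (x, \<omega>) (proj_u c (x, \<omega>) v)) +
     (Df c d (x, \<omega>) (v - proj_u c (x, \<omega>) v) - proj_u d (x', \<theta> \<omega>) (Df c d (x, \<omega>) (v - proj_u c (x, \<omega>) v)))"
  by (simp add: adapted_def Let_def blinfun.add_left blinfun.diff_left)

lemma adapted_proj_u:
  assumes "c \<in> A" "d \<in> A" "x \<in> fst c" "x' \<in> fst d"
  shows "adapted c d ((x, \<omega>), x') (proj_u c (x, \<omega>) v) = proj_u d (x', \<theta> \<omega>) (adapted c d ((x, \<omega>), x') v)"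
  using assms by (simp add: adapted_apply proj_u_idem proj_u_kernel blinfun.add_right)

lemma adapted_graph:
  assumes c: "c \<in> A" and d: "d \<in> A" and q: "(x, \<omega>) \<in> chart_dom c d"
  shows "adapted c d ((x, \<omega>), f \<omega> x) = Df c d (x, \<omega>)"
proof (rule blinfun_eqI)
  fix v
  have x: "x \<in> fst c" and fx: "f \<omega> x \<in> fst d" using q by (auto simp: chart_dom_def)
  let ?P = "proj_u c (x, \<omega>)"
  have "proj_u d (f \<omega> x, \<theta> \<omega>) (Df c d (x, \<omega>) (?P v)) = Df c d (x, \<omega>) (?P v)"
    by (intro proj_u_Eu d Df_Eu c q proj_u_mem) (use x fx in auto)
  moreover have "proj_u d (f \<omega> x, \<theta> \<omega>) (Df c d (x, \<omega>) (v - ?P v)) = 0"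
    by (intro proj_u_Es d Df_Es c q proj_u_mem) (use x fx in auto)
  ultimately show "adapted c d ((x, \<omega>), f \<omega> x) v = Df c d (x, \<omega>) v"
    by (simp add: adapted_apply) (simp flip: blinfun.add_right)
qed

lemma adapted_near_Df:
  assumes c: "c \<in> A" and d: "d \<in> A" and \<rho>: "0 < \<rho>" and \<eta>: "0 < \<eta>"
  shows "\<forall>\<^sub>F \<delta> in at_right 0. \<forall>x \<omega> x'. x \<in> inner_chart c \<rho> \<longrightarrow> f \<omega> x \<in> inner_chart d \<rho> \<longrightarrow>
           dist (f \<omega> x) x' < \<delta> \<longrightarrow> norm (adapted c d ((x, \<omega>), x') - Df c d (x, \<omega>)) < \<eta>"
proof -
  define W where "W = {t \<in> step_dom c d. norm (adapted c d t - Df c d (fst t)) < \<eta>}"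
  have "continuous_on (step_dom c d) (\<lambda>t. Df c d (fst t))"
    by (rule continuous_on_compose2[OF continuous_on_Df[OF c d]])
       (auto intro!: continuous_intros simp: step_dom_def)
  then have "open W" unfolding W_def
    by (intro open_Collect_on open_step_dom c d continuous_intros continuous_on_adapted)
  then have "open (W \<times> (UNIV :: real set))" by (simp add: open_Times)
  moreover have "compact (step_graph c d \<rho> \<times> {0::real})"
    by (intro compact_Times compact_step_graph) auto
  moreover have "step_graph c d \<rho> \<times> {0::real} \<subseteq> W \<times> UNIV"
  proof -
    have "t \<in> W" if t: "t \<in> step_graph c d \<rho>" for t
    proof -
      obtain x \<omega> x' where t_eq: "t = ((x, \<omega>), x')" by (metis prod.exhaust)
      then have "x' = f \<omega> x" using t by (simp add: step_graph_def)
      moreover have "t \<in> step_dom c d" using step_graph_subset_dom[OF \<rho>] t by blast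
      ultimately show ?thesis
        using adapted_graph[OF c d, of x \<omega>] \<eta> by (simp add: W_def t_eq step_dom_def)
    qed
    then show ?thesis by auto
  qed
  ultimately have "\<forall>\<^sub>F \<delta> in at_right 0. \<forall>x \<omega> x' v.
           (((x, \<omega>), f \<omega> x), v) \<in> step_graph c d \<rho> \<times> {0::real} \<longrightarrow> dist (f \<omega> x) x' < \<delta> \<longrightarrow>
           (((x, \<omega>), x'), v) \<in> W \<times> UNIV"
    by (intro near_step_graph)
  then show ?thesis by eventually_elim (simp add: W_def)
qed

lemma inj_adapted:
  assumes c: "c \<in> A" and d: "d \<in> A" and \<rho>: "0 < \<rho>"
  shows "\<forall>\<^sub>F \<delta> in at_right 0. \<forall>x \<omega> x'. x \<in> inner_chart c \<rho> \<longrightarrow> f \<omega> x \<in> inner_chart d \<rho> \<longrightarrow>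
           dist (f \<omega> x) x' < \<delta> \<longrightarrow> inj (adapted c d ((x, \<omega>), x'))"
proof -
  define W where "W = {z \<in> step_dom c d \<times> UNIV. 0 < norm (adapted c d (fst z) (snd z))}"
  have "open W" unfolding W_def
    by (intro open_Collect_on open_Times open_step_dom c d continuous_intros
        continuous_on_compose2[OF continuous_on_adapted]) auto
  moreover have "compact (step_graph c d \<rho> \<times> sphere (0::'e) 1)"
    by (intro compact_Times compact_step_graph compact_sphere)
  moreover have "step_graph c d \<rho> \<times> sphere 0 1 \<subseteq> W"
  proof (intro subrelI)
    fix t and v :: 'e assume "(t, v) \<in> step_graph c d \<rho> \<times> sphere 0 1"
    then have t: "t \<in> step_graph c d \<rho>" and v: "v \<noteq> 0" by auto
    obtain x \<omega> x' where t_eq: "t = ((x, \<omega>), x')" by (metis prod.exhaust)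
    then have "x' = f \<omega> x" using t by (simp add: step_graph_def)
    moreover have dom: "t \<in> step_dom c d" using step_graph_subset_dom[OF \<rho>] t by blast
    moreover have "Df c d (x, \<omega>) v \<noteq> 0"
      using injD[OF inj_Df[OF c d, of x \<omega>], of v 0] dom v by (auto simp: t_eq step_dom_def)
    ultimately show "(t, v) \<in> W"
      using adapted_graph[OF c d, of x \<omega>] by (simp add: W_def t_eq step_dom_def)
  qed
  ultimately have "\<forall>\<^sub>F \<delta> in at_right 0. \<forall>x \<omega> x' v.
           (((x, \<omega>), f \<omega> x), v) \<in> step_graph c d \<rho> \<times> sphere 0 1 \<longrightarrow> dist (f \<omega> x) x' < \<delta> \<longrightarrow>
           (((x, \<omega>), x'), v) \<in> W"
    by (intro near_step_graph)
  then show ?thesis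
  proof eventually_elim
    case (elim \<delta>)
    show ?case
    proof (intro allI impI)
      fix x \<omega> x'
      assume x: "x \<in> inner_chart c \<rho>" "f \<omega> x \<in> inner_chart d \<rho>" "dist (f \<omega> x) x' < \<delta>"
      have "v = 0" if v: "adapted c d ((x, \<omega>), x') v = 0" for v
      proof (rule ccontr)
        assume "v \<noteq> 0"
        then have "(((x, \<omega>), x'), v /\<^sub>R norm v) \<in> W" using elim x by simp
        then show False using v by (simp add: W_def blinfun.scaleR_right)
      qed
      then show "inj (adapted c d ((x, \<omega>), x'))"
        using linear_injective_0[of "adapted c d ((x, \<omega>), x')"]
        by (simp add: blinfun.bounded_linear_right bounded_linear.linear)
    qed
  qed
qed

lemma near_step_graph_in_dom:
  assumes c: "c \<in> A" and d: "d \<in> A" and \<rho>: "0 < \<rho>"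
  shows "\<forall>\<^sub>F \<delta> in at_right 0. \<forall>x \<omega> x'. x \<in> inner_chart c \<rho> \<longrightarrow> f \<omega> x \<in> inner_chart d \<rho> \<longrightarrow>
           dist (f \<omega> x) x' < \<delta> \<longrightarrow> ((x, \<omega>), x') \<in> step_dom c d"
proof -
  have "compact (step_graph c d \<rho> \<times> {0::real})"
    by (intro compact_Times compact_step_graph) auto
  moreover have "open (step_dom c d \<times> (UNIV :: real set))" by (intro open_Times open_step_dom c d open_UNIV)
  moreover have "step_graph c d \<rho> \<times> {0::real} \<subseteq> step_dom c d \<times> UNIV"
    using step_graph_subset_dom[OF \<rho>] by blast
  ultimately have "\<forall>\<^sub>F \<delta> in at_right 0. \<forall>x \<omega> x' v.
           (((x, \<omega>), f \<omega> x), v) \<in> step_graph c d \<rho> \<times> {0::real} \<longrightarrow> dist (f \<omega> x) x' < \<delta> \<longrightarrow>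
           (((x, \<omega>), x'), v) \<in> step_dom c d \<times> UNIV"
    by (intro near_step_graph)
  then show ?thesis by eventually_elim simp
qed

text \<open>A strict inequality between norms, on the kernel of a continuously varying map, at exact steps. By
homogeneity unit vectors suffice; the inequality weakens to \<open>\<le>\<close> only to include \<open>v = 0\<close>.\<close>

lemma homogeneous_near_step_graph:
  fixes l r :: "('m \<times> 'w) \<times> 'm \<Rightarrow> 'e \<Rightarrow> real" and T :: "'m \<times> 'w \<Rightarrow> 'e \<Rightarrow>\<^sub>L 'e"
  assumes c: "c \<in> A" and d: "d \<in> A" and \<rho>: "0 < \<rho>"
    and l: "continuous_on (step_dom c d \<times> UNIV) (\<lambda>z. l (fst z) (snd z))"
    and r: "continuous_on (step_dom c d \<times> UNIV) (\<lambda>z. r (fst z) (snd z))"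
    and hom: "\<And>t a v. t \<in> step_dom c d \<Longrightarrow> l t (a *\<^sub>R v) = \<bar>a\<bar> * l t v"
      "\<And>t a v. t \<in> step_dom c d \<Longrightarrow> r t (a *\<^sub>R v) = \<bar>a\<bar> * r t v"
    and T: "continuous_on (fst c \<times> UNIV) T"
    and strict: "\<And>x \<omega> v. \<lbrakk>(x, \<omega>) \<in> chart_dom c d; v \<noteq> 0; T (x, \<omega>) v = 0\<rbrakk>
                   \<Longrightarrow> l ((x, \<omega>), f \<omega> x) v < r ((x, \<omega>), f \<omega> x) v"
  shows "\<forall>\<^sub>F \<delta> in at_right 0. \<forall>x \<omega> x'. x \<in> inner_chart c \<rho> \<longrightarrow> f \<omega> x \<in> inner_chart d \<rho> \<longrightarrow>
           dist (f \<omega> x) x' < \<delta> \<longrightarrow>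
           (\<forall>v. T (x, \<omega>) v = 0 \<longrightarrow> l ((x, \<omega>), x') v \<le> r ((x, \<omega>), x') v)"
proof -
  define W where "W = {z \<in> step_dom c d \<times> UNIV. l (fst z) (snd z) < r (fst z) (snd z)}"
  define K where "K = step_graph c d \<rho> \<times> sphere (0::'e) 1"
  define K0 where "K0 = {z \<in> K. T (fst (fst z)) (snd z) = 0}"
  have "open (step_dom c d \<times> (UNIV :: 'e set))" by (intro open_Times open_step_dom c d open_UNIV)
  then have W: "open W" unfolding W_def by (intro open_Collect_on l r)
  have K: "compact K" unfolding K_def by (intro compact_Times compact_step_graph compact_sphere)
  have "fst (fst z) \<in> fst c \<times> UNIV" if "z \<in> K" for z
    using subsetD[OF step_graph_subset_dom[OF \<rho>], of "fst z" c d] that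
    by (cases z) (simp add: K_def step_dom_def chart_dom_def mem_Times_iff)
  then have "continuous_on K (\<lambda>z. T (fst (fst z)) (snd z))"
    by (intro continuous_intros continuous_on_compose2[OF T]) blast
  then have "closed K0" unfolding K0_def
    by (rule continuous_closed_preimage_constant) (rule compact_imp_closed[OF K])
  moreover have "K \<inter> K0 = K0" by (auto simp: K0_def)
  ultimately have K0: "compact K0" using compact_Int_closed[OF K] by metis
  have "K0 \<subseteq> W"
  proof
    fix z assume z: "z \<in> K0"
    obtain x \<omega> x' v where z_eq: "z = (((x, \<omega>), x'), v)" by (metis prod.exhaust)
    have t: "((x, \<omega>), x') \<in> step_graph c d \<rho>" and v: "norm v = 1" "T (x, \<omega>) v = 0"
      using z by (simp_all add: K0_def K_def z_eq)
    have x': "x' = f \<omega> x" using t by (simp add: step_graph_def)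
    have dom: "((x, \<omega>), x') \<in> step_dom c d" using step_graph_subset_dom[OF \<rho>] t by blast
    have "l ((x, \<omega>), f \<omega> x) v < r ((x, \<omega>), f \<omega> x) v"
      using dom v by (intro strict) (auto simp: step_dom_def)
    then show "z \<in> W" using dom by (simp add: W_def z_eq x')
  qed
  from near_step_graph[OF K0 W this] near_step_graph_in_dom[OF c d \<rho>]
  show ?thesis
  proof eventually_elim
    case (elim \<delta>)
    show ?case
    proof (intro allI impI)
      fix x \<omega> x' v
      assume x: "x \<in> inner_chart c \<rho>" "f \<omega> x \<in> inner_chart d \<rho>" "dist (f \<omega> x) x' < \<delta>"
        and Tv: "T (x, \<omega>) v = 0"
      let ?t = "((x, \<omega>), x')"
      have dom: "?t \<in> step_dom c d" using elim(2) x by blast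
      show "l ?t v \<le> r ?t v"
      proof (cases "v = 0")
        case True
        then show ?thesis using hom[OF dom, of 0 0] by simp
      next
        case False
        define e where "e = v /\<^sub>R norm v"
        have v: "v = norm v *\<^sub>R e" using False by (simp add: e_def)
        have "(((x, \<omega>), f \<omega> x), e) \<in> K0"
          using x False Tv by (simp add: K0_def K_def e_def blinfun.scaleR_right)
        then have "(?t, e) \<in> W" using elim(1) x(3) by blast
        then have "norm v * l ?t e \<le> norm v * r ?t e"
          by (intro mult_left_mono) (auto simp: W_def)
        then show ?thesis using hom[OF dom, of "norm v" e] v by simp
      qed
    qed
  qed
qed

lemma continuous_on_source_norm:
  assumes c: "c \<in> A"
  shows "continuous_on (step_dom c d \<times> UNIV) (\<lambda>z. chart_norm c (fst (fst (fst z))) (snd z))"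
proof -
  have *: "continuous_on (step_dom c d \<times> UNIV) (\<lambda>z. (fst (fst (fst z)), snd z))"
    by (intro continuous_intros)
  have "(\<lambda>z. (fst (fst (fst z)), snd z)) ` (step_dom c d \<times> UNIV) \<subseteq> fst c \<times> UNIV"
    by (auto simp: step_dom_def chart_dom_def)
  from continuous_on_compose2[OF continuous_on_chart_norm[OF c] * this] show ?thesis by simp
qed

lemma continuous_on_target_norm:
  assumes c: "c \<in> A" and d: "d \<in> A"
  shows "continuous_on (step_dom c d \<times> UNIV) (\<lambda>z. chart_norm d (snd (fst z)) (adapted c d (fst z) (snd z)))"
proof -
  have "continuous_on (step_dom c d \<times> (UNIV :: 'e set)) (\<lambda>z. adapted c d (fst z))"
    by (rule continuous_on_compose2[OF continuous_on_adapted[OF c d]]) (auto intro: continuous_intros)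
  then have *: "continuous_on (step_dom c d \<times> UNIV) (\<lambda>z. (snd (fst z), adapted c d (fst z) (snd z)))"
    by (intro continuous_intros)
  have "(\<lambda>z. (snd (fst z), adapted c d (fst z) (snd z))) ` (step_dom c d \<times> UNIV) \<subseteq> fst d \<times> UNIV"
    by (auto simp: step_dom_def chart_dom_def)
  from continuous_on_compose2[OF continuous_on_chart_norm[OF d] * this] show ?thesis by simp
qed

lemma adapted_expanding:
  assumes c: "c \<in> A" and d: "d \<in> A" and \<rho>: "0 < \<rho>" and \<mu>: "exp (- \<kappa>) < \<mu>"
  shows "\<forall>\<^sub>F \<delta> in at_right 0. \<forall>x \<omega> x'. x \<in> inner_chart c \<rho> \<longrightarrow> f \<omega> x \<in> inner_chart d \<rho> \<longrightarrow>
           dist (f \<omega> x) x' < \<delta> \<longrightarrow>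
           (\<forall>v. v - proj_u c (x, \<omega>) v = 0 \<longrightarrow>
              chart_norm c x v \<le> \<mu> * chart_norm d x' (adapted c d ((x, \<omega>), x') v))"
proof -
  have \<mu>0: "0 < \<mu>" using \<mu> exp_gt_zero[of "- \<kappa>"] by linarith
  have "\<forall>\<^sub>F \<delta> in at_right 0. \<forall>x \<omega> x'. x \<in> inner_chart c \<rho> \<longrightarrow> f \<omega> x \<in> inner_chart d \<rho> \<longrightarrow>
           dist (f \<omega> x) x' < \<delta> \<longrightarrow>
           (\<forall>v. (id_blinfun - proj_u c (x, \<omega>)) v = 0 \<longrightarrow>
              chart_norm c (fst (fst ((x, \<omega>), x'))) v
              \<le> \<mu> * chart_norm d (snd ((x, \<omega>), x')) (adapted c d ((x, \<omega>), x') v))"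
  proof (rule homogeneous_near_step_graph[OF c d \<rho>])
    show "continuous_on (step_dom c d \<times> UNIV) (\<lambda>z. chart_norm c (fst (fst (fst z))) (snd z))"
      by (rule continuous_on_source_norm[OF c])
    show "continuous_on (step_dom c d \<times> UNIV)
        (\<lambda>z. \<mu> * chart_norm d (snd (fst z)) (adapted c d (fst z) (snd z)))"
      by (intro continuous_intros continuous_on_target_norm c d)
    show "continuous_on (fst c \<times> UNIV) (\<lambda>q. id_blinfun - proj_u c q)"
      by (intro continuous_intros continuous_on_proj_u c)
    fix x \<omega> v
    assume q: "(x, \<omega>) \<in> chart_dom c d" and v: "v \<noteq> 0" "(id_blinfun - proj_u c (x, \<omega>)) v = 0"
    have x: "x \<in> fst c" using q by (simp add: chart_dom_def)
    have "v = proj_u c (x, \<omega>) v" using v(2) by (simp add: blinfun.diff_left)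
    then have vE: "v \<in> chart_Eu c (x, \<omega>)" using proj_u_mem(1)[OF c, of "(x, \<omega>)" v] x by simp
    have "chart_norm c x v = exp (- \<kappa>) * (exp \<kappa> * chart_norm c x v)" by (simp add: exp_minus)
    also have "\<dots> \<le> exp (- \<kappa>) * chart_norm d (f \<omega> x) (Df c d (x, \<omega>) v)"
      by (intro mult_left_mono Df_Eu(2) c d q vE) simp
    finally have le: "chart_norm c x v \<le> exp (- \<kappa>) * chart_norm d (f \<omega> x) (Df c d (x, \<omega>) v)" .
    then have "0 < chart_norm d (f \<omega> x) (Df c d (x, \<omega>) v)"
      using chart_norm_pos[OF c x v(1)] by (smt (verit) exp_gt_zero zero_less_mult_pos)
    then show "chart_norm c (fst (fst ((x, \<omega>), f \<omega> x))) v
        < \<mu> * chart_norm d (snd ((x, \<omega>), f \<omega> x)) (adapted c d ((x, \<omega>), f \<omega> x) v)"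
      using order_le_less_trans[OF le mult_strict_right_mono[OF \<mu>]] adapted_graph[OF c d q] by simp
  qed (auto simp: step_dom_def chart_dom_def blinfun.scaleR_right chart_norm_scale c d)
  then show ?thesis by (simp add: blinfun.diff_left)
qed

lemma adapted_contracting:
  assumes c: "c \<in> A" and d: "d \<in> A" and \<rho>: "0 < \<rho>" and \<mu>: "exp (- \<kappa>) < \<mu>"
  shows "\<forall>\<^sub>F \<delta> in at_right 0. \<forall>x \<omega> x'. x \<in> inner_chart c \<rho> \<longrightarrow> f \<omega> x \<in> inner_chart d \<rho> \<longrightarrow>
           dist (f \<omega> x) x' < \<delta> \<longrightarrow>
           (\<forall>v. proj_u c (x, \<omega>) v = 0 \<longrightarrow>
              chart_norm d x' (adapted c d ((x, \<omega>), x') v) \<le> \<mu> * chart_norm c x v)"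
proof -
  have "\<forall>\<^sub>F \<delta> in at_right 0. \<forall>x \<omega> x'. x \<in> inner_chart c \<rho> \<longrightarrow> f \<omega> x \<in> inner_chart d \<rho> \<longrightarrow>
           dist (f \<omega> x) x' < \<delta> \<longrightarrow>
           (\<forall>v. proj_u c (x, \<omega>) v = 0 \<longrightarrow>
              chart_norm d (snd ((x, \<omega>), x')) (adapted c d ((x, \<omega>), x') v)
              \<le> \<mu> * chart_norm c (fst (fst ((x, \<omega>), x'))) v)"
  proof (rule homogeneous_near_step_graph[OF c d \<rho>])
    show "continuous_on (step_dom c d \<times> UNIV) (\<lambda>z. \<mu> * chart_norm c (fst (fst (fst z))) (snd z))"
      by (intro continuous_intros continuous_on_source_norm c)
    show "continuous_on (step_dom c d \<times> UNIV)
        (\<lambda>z. chart_norm d (snd (fst z)) (adapted c d (fst z) (snd z)))"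
      by (intro continuous_on_target_norm c d)
    show "continuous_on (fst c \<times> UNIV) (proj_u c)" by (intro continuous_on_proj_u c)
    fix x \<omega> v
    assume q: "(x, \<omega>) \<in> chart_dom c d" and v: "v \<noteq> 0" "proj_u c (x, \<omega>) v = 0"
    have x: "x \<in> fst c" using q by (simp add: chart_dom_def)
    then have "v \<in> chart_Es c (x, \<omega>)" using proj_u_mem(2)[OF c, of "(x, \<omega>)" v] v by simp
    then have le: "chart_norm d (f \<omega> x) (Df c d (x, \<omega>) v) \<le> exp (- \<kappa>) * chart_norm c x v"
      by (rule Df_Es(2)[OF c d q])
    show "chart_norm d (snd ((x, \<omega>), f \<omega> x)) (adapted c d ((x, \<omega>), f \<omega> x) v)
        < \<mu> * chart_norm c (fst (fst ((x, \<omega>), f \<omega> x))) v"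
      using order_le_less_trans[OF le mult_strict_right_mono[OF \<mu> chart_norm_pos[OF c x v(1)]]]
        adapted_graph[OF c d q] by simp
  qed (auto simp: step_dom_def chart_dom_def blinfun.scaleR_right chart_norm_scale c d)
  then show ?thesis by simp
qed

text \<open>The derivative varies little near the compact set of exact steps, so the difference between the local
representative and its linearisation has small derivative on a ball; the mean value inequality makes
it a map with small Lipschitz constant.\<close>

lemma local_rep_nearly_affine:
  assumes c: "c \<in> A" and d: "d \<in> A" and \<rho>: "0 < \<rho>" and \<eta>: "0 < \<eta>"
  shows "\<forall>\<^sub>F r in at_right 0. \<forall>x \<omega>. x \<in> inner_chart c \<rho> \<longrightarrow> f \<omega> x \<in> inner_chart d \<rho> \<longrightarrow>
           (\<forall>v\<in>cball 0 r. snd c x + v \<in> snd c ` fst c \<and> f \<omega> (chart_inv c (snd c x + v)) \<in> fst d \<and>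
             (\<forall>w\<in>cball 0 r. norm (local_rep c d (f \<omega>) (snd c x + v) - local_rep c d (f \<omega>) (snd c x + w)
                 - Df c d (x, \<omega>) (v - w)) \<le> \<eta> * norm (v - w)))"
proof -
  define S :: "('e \<times> 'w) set" where "S = {p \<in> snd c ` fst c \<times> UNIV. (chart_inv c (fst p), snd p) \<in> chart_dom c d}"
  define g where "g p = Df c d (chart_inv c (fst p), snd p)" for p
  define K where "K = (\<lambda>q. (snd c (fst q), snd q)) ` (fst ` step_graph c d \<rho>)"
  have cont: "continuous_on (snd c ` fst c \<times> UNIV) (\<lambda>p. (chart_inv c (fst p), snd p))"
    by (intro continuous_intros continuous_on_compose2[OF continuous_on_chart_inv[OF c]]) auto
  have S: "open S"
    using continuous_open_preimage[OF cont _ open_chart_dom[OF c d]] open_chart_image[OF c]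
    by (simp add: open_Times S_def Int_def vimage_def)
  have "continuous_on S g" unfolding g_def
    by (rule continuous_on_compose2[OF continuous_on_Df[OF c d]])
       (auto simp: S_def intro: continuous_on_subset[OF cont])
  moreover have "compact K" unfolding K_def
  proof (rule compact_continuous_image)
    show "continuous_on (fst ` step_graph c d \<rho>) (\<lambda>q. (snd c (fst q), snd q))"
      using inner_chart_subset[OF \<rho>, of c]
      by (intro continuous_intros continuous_on_compose2[OF continuous_on_chart[OF c]]) (auto simp: step_graph_def)
    show "compact (fst ` step_graph c d \<rho>)"
      by (intro compact_continuous_image compact_step_graph continuous_intros)
  qed
  moreover have KS: "K \<subseteq> S"
  proof
    fix p assume "p \<in> K"
    then obtain t where t: "t \<in> step_graph c d \<rho>" "p = (snd c (fst (fst t)), snd (fst t))"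
      by (auto simp: K_def)
    have "fst t \<in> chart_dom c d"
      using subsetD[OF step_graph_subset_dom[OF \<rho>] t(1)] by (simp add: step_dom_def mem_Times_iff)
    then show "p \<in> S" using t(2) c by (cases "fst t") (auto simp: S_def chart_dom_def)
  qed
  ultimately obtain r where r: "0 < r"
    "\<And>p p'. \<lbrakk>p \<in> K; dist p p' < r\<rbrakk> \<Longrightarrow> p' \<in> S \<and> dist (g p) (g p') < \<eta>"
    using uniformly_continuous_near_compact[of K S g \<eta>] S \<eta> by blast
  show ?thesis
  proof (rule eventually_at_right_0I[of "r / 2"])
    fix r' assume r': "0 < r'" "r' \<le> r / 2"
    show "\<forall>x \<omega>. x \<in> inner_chart c \<rho> \<longrightarrow> f \<omega> x \<in> inner_chart d \<rho> \<longrightarrow>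
           (\<forall>v\<in>cball 0 r'. snd c x + v \<in> snd c ` fst c \<and> f \<omega> (chart_inv c (snd c x + v)) \<in> fst d \<and>
             (\<forall>w\<in>cball 0 r'. norm (local_rep c d (f \<omega>) (snd c x + v) - local_rep c d (f \<omega>) (snd c x + w)
                 - Df c d (x, \<omega>) (v - w)) \<le> \<eta> * norm (v - w)))"
    proof (intro allI impI)
      fix x \<omega> assume x: "x \<in> inner_chart c \<rho>" "f \<omega> x \<in> inner_chart d \<rho>"
      have xc: "x \<in> fst c" using inner_chart_subset[OF \<rho>] x(1) by blast
      have "((x, \<omega>), f \<omega> x) \<in> step_graph c d \<rho>" using x by simp
      then have K: "(snd c x, \<omega>) \<in> K"
        unfolding K_def image_image by (rule rev_image_eqI) simp
      have near: "(snd c x + v, \<omega>) \<in> S" "norm (Df c d (x, \<omega>) - g (snd c x + v, \<omega>)) < \<eta>"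
        if v: "v \<in> cball 0 r'" for v
      proof -
        have "dist (snd c x, \<omega>) (snd c x + v, \<omega>) < r"
          using v r r' by (simp add: dist_Pair_Pair dist_norm)
        from r(2)[OF K this] show "(snd c x + v, \<omega>) \<in> S" "norm (Df c d (x, \<omega>) - g (snd c x + v, \<omega>)) < \<eta>"
          using xc c by (simp_all add: g_def dist_norm)
      qed
      define h where "h v = local_rep c d (f \<omega>) (snd c x + v) - Df c d (x, \<omega>) v" for v
      have "norm (h v - h w) \<le> \<eta> * norm (v - w)" if vw: "v \<in> cball 0 r'" "w \<in> cball 0 r'" for v w
      proof (rule differentiable_bound[OF convex_cball _ _ vw])
        fix u :: 'e assume u: "u \<in> cball 0 r'"
        have uS: "snd c x + u \<in> snd c ` fst c" "(chart_inv c (snd c x + u), \<omega>) \<in> chart_dom c d"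
          using near(1)[OF u] by (simp_all add: S_def)
        have "(local_rep c d (f \<omega>) has_derivative g (snd c x + u, \<omega>)) (at (snd c x + u))"
          using local_rep_has_derivative[OF c d uS(2)] chart_chart_inv[OF c uS(1)] by (simp add: g_def)
        moreover have "((\<lambda>v. snd c x + v) has_derivative (\<lambda>v. v)) (at u within cball 0 r')"
          by (auto intro!: derivative_eq_intros)
        ultimately have "((\<lambda>v. local_rep c d (f \<omega>) (snd c x + v)) has_derivative (\<lambda>v. g (snd c x + u, \<omega>) v))
            (at u within cball 0 r')"
          using has_derivative_compose[of "\<lambda>v. snd c x + v" "\<lambda>v. v" u "cball 0 r'"] by blast
        then have "(h has_derivative (\<lambda>v. g (snd c x + u, \<omega>) v - Df c d (x, \<omega>) v)) (at u within cball 0 r')"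
          unfolding h_def by (intro has_derivative_diff bounded_linear_imp_has_derivative blinfun.bounded_linear_right)
        then show "(h has_derivative blinfun_apply (g (snd c x + u, \<omega>) - Df c d (x, \<omega>))) (at u within cball 0 r')"
          by (simp add: blinfun.diff_left[abs_def])
        show "onorm (blinfun_apply (g (snd c x + u, \<omega>) - Df c d (x, \<omega>))) \<le> \<eta>"
          using near(2)[OF u] by (simp add: norm_blinfun.rep_eq[symmetric] norm_minus_commute)
      qed
      then show "\<forall>v\<in>cball 0 r'. snd c x + v \<in> snd c ` fst c \<and> f \<omega> (chart_inv c (snd c x + v)) \<in> fst d \<and>
             (\<forall>w\<in>cball 0 r'. norm (local_rep c d (f \<omega>) (snd c x + v) - local_rep c d (f \<omega>) (snd c x + w)
                 - Df c d (x, \<omega>) (v - w)) \<le> \<eta> * norm (v - w))"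
        using near(1) by (simp add: h_def blinfun.diff_right S_def chart_dom_def algebra_simps)
    qed
  qed (use r in simp)
qed

lemma chart_inv_uniform:
  assumes c: "c \<in> A" and \<rho>: "0 < \<rho>" and e: "0 < e"
  shows "\<forall>\<^sub>F s in at_right 0. \<forall>x\<in>inner_chart c \<rho>. \<forall>v. norm v \<le> s \<longrightarrow>
           snd c x + v \<in> snd c ` fst c \<and> dist (chart_inv c (snd c x + v)) x < e"
proof -
  have "compact (snd c ` inner_chart c \<rho>)"
    by (intro compact_continuous_image compact_inner_chart continuous_on_subset[OF continuous_on_chart[OF c]]
        inner_chart_subset \<rho>)
  moreover have "snd c ` inner_chart c \<rho> \<subseteq> snd c ` fst c" using inner_chart_subset[OF \<rho>] by blast
  ultimately obtain s where s: "0 < s"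
    "\<And>y y'. \<lbrakk>y \<in> snd c ` inner_chart c \<rho>; dist y y' < s\<rbrakk>
       \<Longrightarrow> y' \<in> snd c ` fst c \<and> dist (chart_inv c y) (chart_inv c y') < e"
    using uniformly_continuous_near_compact[OF _ _ open_chart_image[OF c] continuous_on_chart_inv[OF c] e]
    by metis
  show ?thesis
  proof (rule eventually_at_right_0I[OF half_gt_zero[OF s(1)]], intro ballI allI impI)
    fix s' x and v :: 'e
    assume "s' \<le> s / 2" and x: "x \<in> inner_chart c \<rho>" and "norm v \<le> s'"
    then have "dist (snd c x) (snd c x + v) < s" using s(1) by (simp add: dist_norm)
    moreover have "x \<in> fst c" using x inner_chart_subset[OF \<rho>] by blast
    ultimately show "snd c x + v \<in> snd c ` fst c \<and> dist (chart_inv c (snd c x + v)) x < e"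
      using s(2)[OF imageI[OF x], of "snd c x + v"] c by (simp add: dist_commute)
  qed
qed

lemma chart_uniform:
  assumes c: "c \<in> A" and \<rho>: "0 < \<rho>" and s: "0 < s"
  shows "\<forall>\<^sub>F e in at_right 0. \<forall>x\<in>inner_chart c \<rho>. \<forall>y. dist x y \<le> e \<longrightarrow>
           y \<in> fst c \<and> norm (snd c y - snd c x) < s"
proof -
  obtain e where e: "0 < e" "\<And>x y. \<lbrakk>x \<in> inner_chart c \<rho>; dist x y < e\<rbrakk> \<Longrightarrow> y \<in> fst c \<and> dist (snd c x) (snd c y) < s"
    using uniformly_continuous_near_compact[OF compact_inner_chart inner_chart_subset[OF \<rho>] open_chart[OF c]
        continuous_on_chart[OF c] s] by metis
  show ?thesis
    by (rule eventually_at_right_0I[of "e / 2"]) (use e in \<open>auto simp: dist_norm norm_minus_commute\<close>)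
qed

lemma chart_bounds:
  assumes c: "c \<in> A" and \<rho>: "0 < \<rho>"
  shows "\<forall>\<^sub>F B in at_top. \<forall>x\<in>inner_chart c \<rho>. \<forall>\<omega> v.
           norm (proj_u c (x, \<omega>) v) \<le> B * norm v \<and> chart_norm c x v \<le> B * norm v \<and> norm v \<le> B * chart_norm c x v"
proof -
  have sub: "inner_chart c \<rho> \<subseteq> fst c" by (rule inner_chart_subset[OF \<rho>])
  have "compact (inner_chart c \<rho> \<times> (UNIV :: 'w set))" by (intro compact_Times compact_inner_chart compact_base)
  moreover have "continuous_on (inner_chart c \<rho> \<times> UNIV) (\<lambda>q. norm (proj_u c q) + 1)"
    by (intro continuous_intros continuous_on_subset[OF continuous_on_proj_u[OF c]]) (use sub in auto)
  ultimately obtain B1 where B1: "1 \<le> B1" "\<And>q. q \<in> inner_chart c \<rho> \<times> UNIV \<Longrightarrow> norm (proj_u c q) + 1 \<le> B1"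
    by (rule compact_pos_bounds) (auto intro: add_nonneg_pos)
  have "compact (inner_chart c \<rho> \<times> sphere (0::'e) 1)" by (intro compact_Times compact_inner_chart compact_sphere)
  note K = this
  have cont: "continuous_on (inner_chart c \<rho> \<times> sphere (0::'e) 1) (\<lambda>q. chart_norm c (fst q) (snd q))"
    by (rule continuous_on_subset[OF continuous_on_chart_norm[OF c]]) (use sub in auto)
  have pos: "0 < chart_norm c (fst q) (snd q)" if "q \<in> inner_chart c \<rho> \<times> sphere (0::'e) 1" for q
    using that sub by (intro chart_norm_pos c) auto
  obtain B2 where B2: "1 \<le> B2"
    "\<And>q. q \<in> inner_chart c \<rho> \<times> sphere (0::'e) 1 \<Longrightarrow> chart_norm c (fst q) (snd q) \<le> B2"
    "\<And>q. q \<in> inner_chart c \<rho> \<times> sphere (0::'e) 1 \<Longrightarrow> 1 \<le> B2 * chart_norm c (fst q) (snd q)"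
    using compact_pos_bounds[OF K cont pos] by blast
  show ?thesis
    using eventually_ge_at_top[of "max B1 B2"]
  proof eventually_elim
    case (elim B)
    show ?case
    proof (intro ballI allI conjI)
      fix x \<omega> and v :: 'e assume x: "x \<in> inner_chart c \<rho>"
      then have xc: "x \<in> fst c" using sub by blast
      have "norm (proj_u c (x, \<omega>) v) \<le> norm (proj_u c (x, \<omega>)) * norm v" by (rule norm_blinfun)
      also have "\<dots> \<le> B * norm v" using B1(2)[of "(x, \<omega>)"] x elim by (intro mult_right_mono) auto
      finally show "norm (proj_u c (x, \<omega>) v) \<le> B * norm v" .
      define e where "e = v /\<^sub>R norm v"
      have hom: "chart_norm c x v = norm v * chart_norm c x e"
      proof (cases "v = 0")
        case True
        then show ?thesis using chart_norm_scale[OF c xc, of 0 0] by simp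
      next
        case False
        then show ?thesis using chart_norm_scale[OF c xc, of "norm v" e] by (simp add: e_def)
      qed
      have unit: "(x, e) \<in> inner_chart c \<rho> \<times> sphere (0::'e) 1" if "v \<noteq> 0" using x that by (simp add: e_def)
      show "chart_norm c x v \<le> B * norm v"
      proof (cases "v = 0")
        case False
        have "norm v * chart_norm c x e \<le> norm v * B"
          using B2(2)[OF unit[OF False]] elim by (intro mult_left_mono) auto
        then show ?thesis by (simp add: hom mult.commute)
      qed (use hom in simp)
      show "norm v \<le> B * chart_norm c x v"
      proof (cases "v = 0")
        case False
        have "1 \<le> B2 * chart_norm c x e" using B2(3)[OF unit[OF False]] by simp
        also have "\<dots> \<le> B * chart_norm c x e" using elim chart_norm_nonneg[OF c xc] by (intro mult_right_mono) auto
        finally have "norm v * 1 \<le> norm v * (B * chart_norm c x e)" by (intro mult_left_mono) auto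
        then show ?thesis by (simp add: hom mult_ac)
      qed (use hom in simp)
    qed
  qed
qed

end

section \<open>Shadowing\<close>

lemma eventually_at_right_0E:
  assumes "\<forall>\<^sub>F \<delta> in at_right 0. P \<delta>"
  obtains \<delta> :: real where "0 < \<delta>" "P \<delta>"
proof -
  have "\<forall>\<^sub>F \<delta>::real in at_right 0. 0 < \<delta>" by (rule eventually_at_right_less)
  with assms have "\<forall>\<^sub>F \<delta>::real in at_right 0. 0 < \<delta> \<and> P \<delta>" by eventually_elim simp
  then have "\<exists>\<delta>. 0 < \<delta> \<and> P \<delta>" by (auto dest: eventually_happens)
  then show ?thesis using that by blast
qed

lemma inj_linear_inverse:
  fixes L :: "'i \<Rightarrow> 'e::euclidean_space \<Rightarrow>\<^sub>L 'e"
  assumes "\<And>j. inj (L j)"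
  shows "\<exists>L'. \<forall>j. linear (L' j) \<and> (\<forall>v. L' j (L j v) = v) \<and> (\<forall>v. L j (L' j v) = v)"
proof -
  have "\<exists>g. linear g \<and> (\<forall>v. g (L j v) = v) \<and> (\<forall>v. L j (g v) = v)" for j
    by (rule linear_injective_isomorphism[OF _ assms])
       (simp add: blinfun.bounded_linear_right bounded_linear.linear, rule refl)
  then show ?thesis by (intro choice allI)
qed

context anosov_splitting
begin

lemma finite_inner_cover:
  obtains C \<rho> where "finite C" "C \<subseteq> A" "0 < \<rho>" "\<And>x. \<exists>c\<in>C. x \<in> inner_chart c (\<rho> + \<rho>)"
proof -
  have "UNIV \<subseteq> (\<Union>c\<in>A. fst c)" using chart_at by blast
  then obtain C where C: "C \<subseteq> A" "finite C" "UNIV \<subseteq> (\<Union>c\<in>C. fst c)"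
    using compactE_image[OF compact_M, of A fst] open_chart by metis
  have "\<And>U. U \<in> fst ` C \<Longrightarrow> open U" using C open_chart by blast
  then obtain \<epsilon> where \<epsilon>: "0 < \<epsilon>" "\<And>x. x \<in> UNIV \<Longrightarrow> \<exists>U\<in>fst ` C. ball x \<epsilon> \<subseteq> U"
    using Heine_Borel_lemma[OF compact_M C(3)] by blast
  have "\<exists>c\<in>C. x \<in> inner_chart c (\<epsilon> / 2 + \<epsilon> / 2)" for x
  proof -
    obtain c where "c \<in> C" "ball x \<epsilon> \<subseteq> fst c" using \<epsilon>(2)[of x] by auto
    then show ?thesis by (intro bexI[of _ c]) (auto simp: inner_chart_def subset_iff not_le[symmetric])
  qed
  then show ?thesis using that[of C "\<epsilon> / 2"] C \<epsilon> by simp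
qed

definition hyperbolic_step ::
    "('m, 'e) chart \<Rightarrow> ('m, 'e) chart \<Rightarrow> real \<Rightarrow> real \<Rightarrow> 'm \<Rightarrow> 'w \<Rightarrow> 'm \<Rightarrow> bool" where
  "hyperbolic_step c d \<mu> \<eta> x \<omega> x' \<longleftrightarrow> (let L = adapted c d ((x, \<omega>), x') in
     norm (L - Df c d (x, \<omega>)) < \<eta> \<and> inj L \<and>
     (\<forall>v. v - proj_u c (x, \<omega>) v = 0 \<longrightarrow> chart_norm c x v \<le> \<mu> * chart_norm d x' (L v)) \<and>
     (\<forall>v. proj_u c (x, \<omega>) v = 0 \<longrightarrow> chart_norm d x' (L v) \<le> \<mu> * chart_norm c x v))"

lemma uniform_steps:
  assumes C: "finite C" "C \<subseteq> A" and \<rho>: "0 < \<rho>" and \<mu>: "exp (- \<kappa>) < \<mu>" and \<eta>: "0 < \<eta>"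
  shows "\<forall>\<^sub>F \<delta> in at_right 0. \<forall>c\<in>C. \<forall>d\<in>C. \<forall>x \<omega> x'. x \<in> inner_chart c \<rho> \<longrightarrow> f \<omega> x \<in> inner_chart d \<rho> \<longrightarrow>
      dist (f \<omega> x) x' < \<delta> \<longrightarrow> hyperbolic_step c d \<mu> \<eta> x \<omega> x'"
proof (intro eventually_ball_finite C ballI)
  fix c d assume "c \<in> C" "d \<in> C"
  then have cd: "c \<in> A" "d \<in> A" using C by auto
  show "\<forall>\<^sub>F \<delta> in at_right 0. \<forall>x \<omega> x'. x \<in> inner_chart c \<rho> \<longrightarrow> f \<omega> x \<in> inner_chart d \<rho> \<longrightarrow>
      dist (f \<omega> x) x' < \<delta> \<longrightarrow> hyperbolic_step c d \<mu> \<eta> x \<omega> x'"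
    using adapted_near_Df[OF cd \<rho> \<eta>] inj_adapted[OF cd \<rho>] adapted_expanding[OF cd \<rho> \<mu>]
      adapted_contracting[OF cd \<rho> \<mu>]
    unfolding hyperbolic_step_def Let_def by eventually_elim blast
qed

text \<open>The Anosov shadowing lemma over an arbitrary orbit \<open>w\<close> of the base. In charts centred at the points
of the pseudo-orbit \<open>x\<close>, the orbits near \<open>x\<close> are the small bounded solutions of
\<open>v (j + 1) = F j (v j)\<close>, where \<open>F j\<close> is a perturbation of the \<open>adapted\<close> map with small Lipschitz
constant, and \<open>F j 0\<close> is the jump of the pseudo-orbit. Existence is \<open>ex_orbit\<close>. Uniqueness comes from
\<open>orbit_unique\<close> on the fixed ball of radius \<open>r\<close>, which does not depend on \<open>e\<close>.\<close>

theorem shadowing: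
  "\<exists>e0>0. \<forall>e. 0 < e \<longrightarrow> e \<le> e0 \<longrightarrow> (\<exists>\<delta>>0. \<forall>w x.
     (\<forall>j::int. w (j + 1) = \<theta> (w j) \<and> dist (f (w j) (x j)) (x (j + 1)) < \<delta>) \<longrightarrow>
     (\<exists>!y. \<forall>j. y (j + 1) = f (w j) (y j) \<and> dist (x j) (y j) \<le> e))"
proof -
  obtain C \<rho> where C: "finite C" "C \<subseteq> A" and \<rho>: "0 < \<rho>"
    and cover: "\<And>x. \<exists>c\<in>C. x \<in> inner_chart c (\<rho> + \<rho>)"
    using finite_inner_cover by blast
  then obtain ch where ch: "\<And>x. ch x \<in> C" "\<And>x. x \<in> inner_chart (ch x) (\<rho> + \<rho>)" by metis
  have chA: "ch x \<in> A" for x using ch(1) C(2) by blast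
  define \<mu> where "\<mu> = (1 + exp (- \<kappa>)) / 2"
  have \<mu>: "exp (- \<kappa>) < \<mu>" "0 \<le> \<mu>" "\<mu> < 1" using \<kappa>_pos by (auto simp: \<mu>_def add_nonneg_nonneg)
  have "\<forall>\<^sub>F B in at_top. \<forall>c\<in>C. \<forall>x\<in>inner_chart c \<rho>. \<forall>\<omega> v.
      norm (proj_u c (x, \<omega>) v) \<le> B * norm v \<and> chart_norm c x v \<le> B * norm v \<and> norm v \<le> B * chart_norm c x v"
    using C(2) by (intro eventually_ball_finite C ballI chart_bounds \<rho>) auto
  with eventually_ge_at_top[of 1] have "\<forall>\<^sub>F B in at_top. 1 \<le> B \<and> (\<forall>c\<in>C. \<forall>x\<in>inner_chart c \<rho>. \<forall>\<omega> v.
      norm (proj_u c (x, \<omega>) v) \<le> B * norm v \<and> chart_norm c x v \<le> B * norm v \<and> norm v \<le> B * chart_norm c x v)"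
    by eventually_elim simp
  then obtain B :: real where B: "1 \<le> B" and bounds: "\<And>c x \<omega> v. c \<in> C \<Longrightarrow> x \<in> inner_chart c \<rho> \<Longrightarrow>
      norm (proj_u c (x, \<omega>) v) \<le> B * norm v \<and> chart_norm c x v \<le> B * norm v \<and> norm v \<le> B * chart_norm c x v"
    by (metis (mono_tags, lifting) eventually_at_top_linorder order_refl)
  \<comment> \<open>Half of the Lipschitz constant permitted by the contraction: the distance between the
    derivative and the adapted map also costs \<open>\<eta>\<close>.\<close>
  define \<eta> where "\<eta> = (1 - \<mu>) / (16 * B ^ 3)"
  have \<eta>: "0 < \<eta>" "4 * B ^ 3 * (2 * \<eta>) \<le> (1 - \<mu>) / 2" using \<mu> B by (simp_all add: \<eta>_def)
  have "\<forall>\<^sub>F r in at_right 0. \<forall>c\<in>C. \<forall>d\<in>C. \<forall>x \<omega>. x \<in> inner_chart c \<rho> \<longrightarrow> f \<omega> x \<in> inner_chart d \<rho> \<longrightarrow>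
           (\<forall>v\<in>cball 0 r. snd c x + v \<in> snd c ` fst c \<and> f \<omega> (chart_inv c (snd c x + v)) \<in> fst d \<and>
             (\<forall>w\<in>cball 0 r. norm (local_rep c d (f \<omega>) (snd c x + v) - local_rep c d (f \<omega>) (snd c x + w)
                 - Df c d (x, \<omega>) (v - w)) \<le> \<eta> * norm (v - w)))"
    (is "\<forall>\<^sub>F r in _. ?affine r")
    using C(2) by (intro eventually_ball_finite C ballI local_rep_nearly_affine \<rho> \<eta>) auto
  then obtain r where r: "0 < r" and "?affine r"
    by (rule eventually_at_right_0E) blast
  note affine = \<open>?affine r\<close>[rule_format, unfolded mem_cball_0]
  have "\<forall>\<^sub>F e in at_right 0. \<forall>c\<in>C. \<forall>x\<in>inner_chart c \<rho>. \<forall>y. dist x y \<le> e \<longrightarrow>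
      y \<in> fst c \<and> norm (snd c y - snd c x) < r"
    using C(2) by (intro eventually_ball_finite C ballI chart_uniform \<rho> r) auto
  then obtain e0 where e0: "0 < e0" and close: "\<And>c x y. \<lbrakk>c \<in> C; x \<in> inner_chart c \<rho>; dist x y \<le> e0\<rbrakk> \<Longrightarrow>
      y \<in> fst c \<and> norm (snd c y - snd c x) < r"
    by (rule eventually_at_right_0E) blast
  show ?thesis
  proof (rule exI[of _ e0], intro conjI e0 allI impI)
    fix e assume e: "0 < e" "e \<le> e0"
    have "\<forall>\<^sub>F s in at_right 0. \<forall>c\<in>C. \<forall>x\<in>inner_chart c \<rho>. \<forall>v. norm v \<le> s \<longrightarrow>
           snd c x + v \<in> snd c ` fst c \<and> dist (chart_inv c (snd c x + v)) x < e"
      using C(2) by (intro eventually_ball_finite C ballI chart_inv_uniform \<rho> e) auto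
    with eventually_at_right_0I[OF r, of "\<lambda>s. s \<le> r"]
    have "\<forall>\<^sub>F s in at_right 0. s \<le> r \<and> (\<forall>c\<in>C. \<forall>x\<in>inner_chart c \<rho>. \<forall>v. norm v \<le> s \<longrightarrow>
           snd c x + v \<in> snd c ` fst c \<and> dist (chart_inv c (snd c x + v)) x < e)"
      by (simp add: eventually_conj_iff)
    then obtain s where s: "0 < s" "s \<le> r" and in_image: "\<And>c x v. \<lbrakk>c \<in> C; x \<in> inner_chart c \<rho>; norm v \<le> s\<rbrakk> \<Longrightarrow>
        snd c x + v \<in> snd c ` fst c \<and> dist (chart_inv c (snd c x + v)) x < e"
      by (rule eventually_at_right_0E) blast
    \<comment> \<open>The size of jumps, in charts, for which the solution stays in the ball of radius \<open>s\<close>.\<close>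
    define \<tau> where "\<tau> = (1 - \<mu>) / (8 * B ^ 3) * s"
    have \<tau>: "0 < \<tau>" using \<mu> B s by (simp add: \<tau>_def)
    have "\<forall>\<^sub>F \<delta> in at_right 0. \<forall>c\<in>C. \<forall>x\<in>inner_chart c \<rho>. \<forall>y. dist x y \<le> \<delta> \<longrightarrow>
      y \<in> fst c \<and> norm (snd c y - snd c x) < \<tau>"
      using C(2) by (intro eventually_ball_finite C ballI chart_uniform \<rho> \<tau>) auto
    with uniform_steps[OF C \<rho> \<mu>(1) \<eta>(1)] eventually_at_right_0I[OF \<rho>, of "\<lambda>\<delta>. \<delta> \<le> \<rho>"]
    have "\<forall>\<^sub>F \<delta> in at_right 0. \<delta> \<le> \<rho> \<and>
      (\<forall>c\<in>C. \<forall>x\<in>inner_chart c \<rho>. \<forall>y. dist x y \<le> \<delta> \<longrightarrow> y \<in> fst c \<and> norm (snd c y - snd c x) < \<tau>) \<and>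
      (\<forall>c\<in>C. \<forall>d\<in>C. \<forall>x \<omega> x'. x \<in> inner_chart c \<rho> \<longrightarrow> f \<omega> x \<in> inner_chart d \<rho> \<longrightarrow> dist (f \<omega> x) x' < \<delta> \<longrightarrow>
        hyperbolic_step c d \<mu> \<eta> x \<omega> x')"
      (is "\<forall>\<^sub>F \<delta> in _. _ \<and> ?jump \<delta> \<and> ?step \<delta>")
      by (simp add: eventually_conj_iff)
    then obtain \<delta> where \<delta>: "0 < \<delta>" "\<delta> \<le> \<rho>" and "?jump \<delta>" and "?step \<delta>"
      by (rule eventually_at_right_0E) blast
    note jump = \<open>?jump \<delta>\<close>[rule_format, THEN conjunct2]
    have main: "\<exists>!y. \<forall>j. y (j + 1) = f (w j) (y j) \<and> dist (x j) (y j) \<le> e"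
      if w: "\<And>j::int. w (j + 1) = \<theta> (w j)" and x: "\<And>j. dist (f (w j) (x j)) (x (j + 1)) < \<delta>" for w x
    proof -
      define c where "c j = ch (x j)" for j
      define a where "a j = snd (c j) (x j)" for j
      define P where "P j = proj_u (c j) (x j, w j)" for j
      define L where "L j = adapted (c j) (c (j + 1)) ((x j, w j), x (j + 1))" for j
      define D where "D j = Df (c j) (c (j + 1)) (x j, w j)" for j
      define nrm where "nrm j = chart_norm (c j) (x j)" for j
      define F where "F j v = local_rep (c j) (c (j + 1)) (f (w j)) (a j + v) - a (j + 1)" for j v
      have cC: "c j \<in> C" and cA: "c j \<in> A" for j using ch chA by (simp_all add: c_def)
      have xin: "x j \<in> inner_chart (c j) \<rho>" for j
        using inner_chart_near[OF ch(2)[of "x j"], of "x j"] \<rho> by (simp add: c_def)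
      \<comment> \<open>The charts are chosen with margin \<open>\<rho> + \<rho>\<close>, so that \<open>f (w j) (x j)\<close>, too, lies inside the chart
        chosen at \<open>x (j + 1)\<close>.\<close>
      have fin: "f (w j) (x j) \<in> inner_chart (c (j + 1)) \<rho>" for j
        using inner_chart_near[OF ch(2)[of "x (j + 1)"], of "f (w j) (x j)"] x[of j] \<delta>(2)
        by (simp add: c_def dist_commute)
      have xc: "x j \<in> fst (c j)" for j using xin inner_chart_subset[OF \<rho>] by blast
      have near: "norm (L j - D j) < \<eta>" and inj: "inj (L j)"
        and exp: "v - P j v = 0 \<Longrightarrow> nrm j v \<le> \<mu> * nrm (j + 1) (L j v)"
        and con: "P j v = 0 \<Longrightarrow> nrm (j + 1) (L j v) \<le> \<mu> * nrm j v" for j v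
        using \<open>?step \<delta>\<close>[THEN bspec, OF cC[of j], THEN bspec, OF cC[of "j + 1"], THEN spec, THEN spec, THEN spec,
            THEN mp, OF xin, THEN mp, OF fin, THEN mp, OF x]
        by (simp_all add: hyperbolic_step_def Let_def L_def D_def P_def nrm_def)
      obtain L' where "\<forall>j. linear (L' j) \<and> (\<forall>v. L' j (L j v) = v) \<and> (\<forall>v. L j (L' j v) = v)"
        using inj_linear_inverse[of L, OF inj] by (rule exE)
      then have L': "\<And>j. linear (L' j)" "\<And>j v. L' j (L j v) = v" "\<And>j v. L j (L' j v) = v" by simp_all
      interpret hyperbolic_sequence "\<lambda>j. blinfun_apply (P j)" "\<lambda>j. blinfun_apply (L j)" L' nrm \<mu> B
      proof (rule hyperbolic_sequence.intro)
        show "linear (P j)" "linear (L j)" for j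
          by (simp_all add: blinfun.bounded_linear_right bounded_linear.linear)
        show PP: "P j (P j v) = P j v" for j v
          unfolding P_def by (rule proj_u_idem) (use cA xc in auto)
        show "L j (P j v) = P (j + 1) (L j v)" for j v
          unfolding L_def P_def w by (rule adapted_proj_u) (use cA xc in auto)
        show "nrm j (u + v) \<le> nrm j u + nrm j v" for j u v
          unfolding nrm_def by (rule chart_norm_triangle[OF cA xc])
        show "nrm j v \<le> B * norm v" "norm v \<le> B * nrm j v" "norm (P j v) \<le> B * norm v" for j v
          using bounds[OF cC xin] unfolding nrm_def P_def by blast+
        show "nrm j (P j v) \<le> \<mu> * nrm (j + 1) (L j (P j v))" for j v
          by (rule exp) (simp add: PP)
        show "nrm (j + 1) (L j (v - P j v)) \<le> \<mu> * nrm j (v - P j v)" for j v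
          by (rule con) (simp add: blinfun.diff_right PP)
      qed (use L' B \<mu> in auto)
      have lip: "norm ((F j u - L j u) - (F j v - L j v)) \<le> 2 * \<eta> * norm (u - v)"
        if uv: "norm u \<le> r" "norm v \<le> r" for j u v
      proof -
        have "(F j u - L j u) - (F j v - L j v)
            = (local_rep (c j) (c (j + 1)) (f (w j)) (a j + u) - local_rep (c j) (c (j + 1)) (f (w j)) (a j + v)
                - D j (u - v)) - (L j - D j) (u - v)"
          by (simp add: F_def blinfun.diff_left blinfun.diff_right)
        also have "norm \<dots> \<le> \<eta> * norm (u - v) + \<eta> * norm (u - v)"
        proof (rule order_trans[OF norm_triangle_ineq4 add_mono])
          show "norm (local_rep (c j) (c (j + 1)) (f (w j)) (a j + u)
              - local_rep (c j) (c (j + 1)) (f (w j)) (a j + v) - D j (u - v)) \<le> \<eta> * norm (u - v)"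
            using affine[OF cC cC xin fin[of j] uv(1)] uv(2) unfolding a_def D_def by simp
          have "norm ((L j - D j) (u - v)) \<le> norm (L j - D j) * norm (u - v)" by (rule norm_blinfun)
          also have "\<dots> \<le> \<eta> * norm (u - v)" using near[of j] by (intro mult_right_mono) auto
          finally show "norm ((L j - D j) (u - v)) \<le> \<eta> * norm (u - v)" .
        qed
        finally show ?thesis by simp
      qed
      have \<eta>0: "0 \<le> 2 * \<eta>" using \<eta> by simp
      have F_point: "F j (snd (c j) z - a j) = snd (c (j + 1)) (f (w j) z) - a (j + 1)" if "z \<in> fst (c j)" for j z
        using that cA by (simp add: F_def)
      have F0: "norm (F j 0) \<le> (1 - \<mu>) / (8 * B ^ 3) * s" for j
      proof -
        have "norm (snd (c (j + 1)) (x (j + 1)) - snd (c (j + 1)) (f (w j) (x j))) < \<tau>"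
          by (rule jump[OF cC fin less_imp_le[OF x]])
        then show ?thesis using F_point[OF xc, of j] by (simp add: a_def \<tau>_def norm_minus_commute)
      qed
      obtain v where v: "\<And>j. norm (v j) \<le> s" "\<And>j. v (j + 1) = F j (v j)"
        using ex_orbit[OF lip \<eta>0 \<eta>(2) less_imp_le[OF s(1)] s(2) F0] by blast
      define y where "y j = chart_inv (c j) (a j + v j)" for j
      have y_dist: "dist (x j) (y j) \<le> e" for j
        using in_image[OF cC[of j] xin[of j] v(1)[of j]] unfolding y_def a_def by (simp add: dist_commute)
      have y_orbit: "y (j + 1) = f (w j) (y j)" for j
      proof -
        have "norm (v j) \<le> r" using v(1)[of j] s(2) by linarith
        from affine[OF cC cC xin fin[of j] this] have "f (w j) (y j) \<in> fst (c (j + 1))"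
          unfolding y_def a_def by blast
        moreover have "a (j + 1) + v (j + 1) = snd (c (j + 1)) (f (w j) (y j))"
          by (simp add: v(2) F_def y_def)
        ultimately show ?thesis unfolding y_def[of "j + 1"] using cA by simp
      qed
      show ?thesis
      proof (rule ex1I[of _ y])
        show "\<forall>j. y (j + 1) = f (w j) (y j) \<and> dist (x j) (y j) \<le> e" using y_dist y_orbit by blast
        fix z assume z: "\<forall>j. z (j + 1) = f (w j) (z j) \<and> dist (x j) (z j) \<le> e"
        have coord: "y' j \<in> fst (c j)" "norm (snd (c j) (y' j) - a j) \<le> r"
          if "\<forall>j. y' (j + 1) = f (w j) (y' j) \<and> dist (x j) (y' j) \<le> e" for y' j
          using close[OF cC[of j] xin[of j], of "y' j"] that e(2) unfolding a_def by (meson less_imp_le order_trans)+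
        have orb: "snd (c (j + 1)) (y' (j + 1)) - a (j + 1) = F j (snd (c j) (y' j) - a j)"
          if y': "\<forall>j. y' (j + 1) = f (w j) (y' j) \<and> dist (x j) (y' j) \<le> e" for y' j
          unfolding F_point[OF coord(1)[OF y']] using y' by simp
        have Y: "\<forall>j. y (j + 1) = f (w j) (y j) \<and> dist (x j) (y j) \<le> e" using y_dist y_orbit by blast
        have "(\<lambda>j. snd (c j) (z j) - a j) = (\<lambda>j. snd (c j) (y j) - a j)"
          by (rule orbit_unique[OF lip \<eta>0 \<eta>(2)]) (use coord[OF z] coord[OF Y] orb[OF z] orb[OF Y] in auto)
        then have eq: "snd (c j) (z j) = snd (c j) (y j)" for j by (auto dest: fun_cong[of _ _ j])
        show "z = y"
        proof
          fix j
          have "z j = chart_inv (c j) (snd (c j) (z j))" by (rule chart_inv_chart[OF cA coord(1)[OF z], symmetric])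
          also have "\<dots> = y j" unfolding eq by (rule chart_inv_chart[OF cA coord(1)[OF Y]])
          finally show "z j = y j" .
        qed
      qed
    qed
    show "\<exists>\<delta>>0. \<forall>w x.
     (\<forall>j::int. w (j + 1) = \<theta> (w j) \<and> dist (f (w j) (x j)) (x (j + 1)) < \<delta>) \<longrightarrow>
     (\<exists>!y. \<forall>j. y (j + 1) = f (w j) (y j) \<and> dist (x j) (y j) \<le> e)"
      by (rule exI[of _ \<delta>], intro conjI \<delta>(1) allI impI, rule main) simp_all
  qed
qed

end

section \<open>Measurable maps into a compact space\<close>

lemma compact_dense_sequence:
  fixes K :: "'a::metric_space set"
  assumes K: "compact K" "K \<noteq> {}"
  obtains s :: "nat \<Rightarrow> 'a" where "range s \<subseteq> K" "\<And>x e. \<lbrakk>x \<in> K; 0 < e\<rbrakk> \<Longrightarrow> \<exists>k. dist (s k) x < e"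
proof -
  have "\<exists>k. finite k \<and> k \<subseteq> K \<and> K \<subseteq> (\<Union>x\<in>k. ball x (inverse (real (Suc n))))" for n
    using seq_compact_imp_totally_bounded[of K] K by (simp add: compact_imp_seq_compact)
  then obtain F where F: "\<And>n. finite (F n)" "\<And>n. F n \<subseteq> K"
    "\<And>n. K \<subseteq> (\<Union>x\<in>F n. ball x (inverse (real (Suc n))))" by metis
  define D where "D = (\<Union>n. F n)"
  have "countable D" unfolding D_def by (rule countable_UN[OF countableI_type countable_finite[OF F(1)]])
  moreover have "D \<noteq> {}" using F(3)[of 0] K(2) unfolding D_def by blast
  ultimately have range: "range (from_nat_into D) = D" by (rule range_from_nat_into[rotated])
  show ?thesis
  proof
    show "range (from_nat_into D) \<subseteq> K" unfolding range using F(2) by (auto simp: D_def)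
    fix x and e :: real assume "x \<in> K" "0 < e"
    from reals_Archimedean[OF this(2)] obtain n where n: "inverse (real (Suc n)) < e" by blast
    obtain p where p: "p \<in> F n" "dist p x < inverse (real (Suc n))" using F(3)[of n] \<open>x \<in> K\<close> by auto
    then have "p \<in> range (from_nat_into D)" unfolding range by (auto simp: D_def)
    then obtain k where "p = from_nat_into D k" by blast
    then show "\<exists>k. dist (from_nat_into D k) x < e" using p(2) n by (intro exI[of _ k]) simp
  qed
qed

text \<open>Replacing \<open>g \<omega>\<close> by the first member of a dense sequence within \<open>1 / (n + 1)\<close> of it gives maps with
countably many values that converge to \<open>g\<close>. For them the composition is measurable, and continuity of
\<open>H \<omega>\<close> passes to the limit.\<close>

lemma measurable_Caratheodory_comp:
  fixes H :: "'w \<Rightarrow> 'm::metric_space \<Rightarrow> 'c::metric_space"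
  assumes M: "compact (UNIV :: 'm set)"
    and meas: "\<And>x. (\<lambda>\<omega>. H \<omega> x) \<in> borel_measurable N"
    and cont: "\<And>\<omega>. continuous_on UNIV (H \<omega>)"
    and g: "g \<in> borel_measurable N"
  shows "(\<lambda>\<omega>. H \<omega> (g \<omega>)) \<in> borel_measurable N"
proof -
  obtain s :: "nat \<Rightarrow> 'm" where s: "\<And>x e. 0 < e \<Longrightarrow> \<exists>k. dist (s k) x < e"
    using compact_dense_sequence[OF M] by auto
  define ix where "ix n \<omega> = (LEAST k. dist (s k) (g \<omega>) < inverse (real (Suc n)))" for n \<omega>
  have ix: "dist (s (ix n \<omega>)) (g \<omega>) < inverse (real (Suc n))" for n \<omega>
    unfolding ix_def by (rule LeastI_ex) (simp add: s)
  have "Measurable.pred N (\<lambda>\<omega>. dist (s k) (g \<omega>) < r)" for k r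
  proof -
    have "g -` ball (s k) r \<inter> space N \<in> sets N" by (rule measurable_sets[OF g]) simp
    moreover have "g -` ball (s k) r \<inter> space N = {\<omega> \<in> space N. dist (s k) (g \<omega>) < r}" by auto
    ultimately show ?thesis by (simp add: pred_def)
  qed
  then have "ix n \<in> measurable N (count_space UNIV)" for n
    unfolding ix_def[abs_def] by (rule measurable_Least)
  then have "(\<lambda>\<omega>. H \<omega> (s (ix n \<omega>))) \<in> borel_measurable N" for n
    by (intro measurable_compose_countable[of "\<lambda>k \<omega>. H \<omega> (s k)" N borel "ix n"] meas)
  moreover have "(\<lambda>n. H \<omega> (s (ix n \<omega>))) \<longlonglongrightarrow> H \<omega> (g \<omega>)" for \<omega>
  proof (rule continuous_on_tendsto_compose[OF cont])
    show "(\<lambda>n. s (ix n \<omega>)) \<longlonglongrightarrow> g \<omega>"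
    proof (rule metric_LIMSEQ_I)
      fix r :: real assume "0 < r"
      then obtain n0 where n0: "inverse (real (Suc n0)) < r" using reals_Archimedean by blast
      have "dist (s (ix n \<omega>)) (g \<omega>) < r" if "n0 \<le> n" for n
      proof -
        have "inverse (real (Suc n)) \<le> inverse (real (Suc n0))" using that by (intro le_imp_inverse_le) auto
        then show ?thesis using ix[of n \<omega>] n0 by linarith
      qed
      then show "\<exists>n0. \<forall>n\<ge>n0. dist (s (ix n \<omega>)) (g \<omega>) < r" by blast
    qed
  qed auto
  ultimately show ?thesis by (rule borel_measurable_LIMSEQ_metric)
qed

text \<open>For closed \<open>C\<close>, the solution lies in \<open>C\<close> iff there are approximate solutions in \<open>C\<close> of finitely many
constraints at a time, with arbitrary precision: a limit point of them is a solution, hence the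
solution. Approximate solutions can be sought in a sequence dense in \<open>C\<close>, and what remains is a
countable combination of measurable conditions.\<close>

lemma measurable_unique_solution:
  fixes d :: "int \<Rightarrow> 'w \<Rightarrow> 'm::metric_space \<Rightarrow> real"
  assumes M: "compact (UNIV :: 'm set)"
    and meas: "\<And>j x. (\<lambda>\<omega>. d j \<omega> x) \<in> borel_measurable N"
    and cont: "\<And>j \<omega>. continuous_on UNIV (d j \<omega>)"
    and unique: "\<And>\<omega> x. (\<forall>j. d j \<omega> x \<le> e) \<longleftrightarrow> x = h \<omega>"
  shows "h \<in> borel_measurable N"
proof (rule measurable_sigma_sets[of _ UNIV "Collect closed"])
  show "sets borel = sigma_sets (UNIV :: 'm set) (Collect closed)"
    by (subst borel_eq_closed) (rule sets_measure_of, simp)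
  show "Collect closed \<subseteq> Pow (UNIV :: 'm set)" "h \<in> space N \<rightarrow> UNIV" by auto
  fix C :: "'m set" assume "C \<in> Collect closed"
  then have C: "compact C" using compact_Int_closed[OF M] by simp
  show "h -` C \<inter> space N \<in> sets N"
  proof (cases "C = {}")
    case False
    obtain s where s: "range s \<subseteq> C" "\<And>x e. \<lbrakk>x \<in> C; 0 < e\<rbrakk> \<Longrightarrow> \<exists>k::nat. dist (s k) x < e"
      using compact_dense_sequence[OF C False] by blast
    have "h \<omega> \<in> C \<longleftrightarrow> (\<forall>n::nat. \<exists>k. \<forall>j\<in>{- int n..int n}. d j \<omega> (s k) < e + inverse (real (Suc n)))" for \<omega>
    proof
      assume hC: "h \<omega> \<in> C"
      show "\<forall>n::nat. \<exists>k. \<forall>j\<in>{- int n..int n}. d j \<omega> (s k) < e + inverse (real (Suc n))"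
      proof
        fix n :: nat
        have "open {x. d j \<omega> x < e + inverse (real (Suc n))}" for j
          by (intro open_Collect_less cont continuous_on_const)
        then have "open (\<Inter>j\<in>{- int n..int n}. {x. d j \<omega> x < e + inverse (real (Suc n))})"
          by (intro open_INT) auto
        moreover have "h \<omega> \<in> (\<Inter>j\<in>{- int n..int n}. {x. d j \<omega> x < e + inverse (real (Suc n))})"
        proof -
          have "d j \<omega> (h \<omega>) \<le> e" for j using unique[of \<omega> "h \<omega>"] by simp
          moreover have "0 < inverse (real (Suc n))" by simp
          ultimately have "d j \<omega> (h \<omega>) < e + inverse (real (Suc n))" for j by (smt (verit))
          then show ?thesis by blast
        qed
        ultimately obtain r where r: "0 < r"
          "ball (h \<omega>) r \<subseteq> (\<Inter>j\<in>{- int n..int n}. {x. d j \<omega> x < e + inverse (real (Suc n))})"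
          using open_contains_ball by blast
        obtain k where "dist (s k) (h \<omega>) < r" using s(2)[OF hC r(1)] by blast
        then have "s k \<in> ball (h \<omega>) r" by (simp add: dist_commute)
        then show "\<exists>k. \<forall>j\<in>{- int n..int n}. d j \<omega> (s k) < e + inverse (real (Suc n))"
          using r(2) by blast
      qed
    next
      assume "\<forall>n::nat. \<exists>k. \<forall>j\<in>{- int n..int n}. d j \<omega> (s k) < e + inverse (real (Suc n))"
      then obtain k where k: "\<And>n j. j \<in> {- int n..int n} \<Longrightarrow> d j \<omega> (s (k n)) < e + inverse (real (Suc n))"
        by metis
      obtain x r where x: "x \<in> C" and r: "strict_mono r" "((\<lambda>n. s (k n)) \<circ> r) \<longlonglongrightarrow> x"
        using C[unfolded compact_def, rule_format, of "\<lambda>n. s (k n)"] s(1) by blast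
      have "d j \<omega> x \<le> e" for j
      proof (rule LIMSEQ_le)
        show "(\<lambda>n. d j \<omega> (s (k (r n)))) \<longlonglongrightarrow> d j \<omega> x"
          using continuous_on_tendsto_compose[OF cont r(2)] by simp
        show "(\<lambda>n. e + inverse (real (Suc n))) \<longlonglongrightarrow> e"
          using tendsto_add[OF tendsto_const LIMSEQ_inverse_real_of_nat] by simp
        show "\<exists>n0. \<forall>n\<ge>n0. d j \<omega> (s (k (r n))) \<le> e + inverse (real (Suc n))"
        proof (intro exI[of _ "nat \<bar>j\<bar>"] allI impI)
          fix n assume n: "nat \<bar>j\<bar> \<le> n"
          have rn: "n \<le> r n" by (rule seq_suble[OF r(1)])
          have "d j \<omega> (s (k (r n))) < e + inverse (real (Suc (r n)))" using n rn by (intro k) auto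
          also have "\<dots> \<le> e + inverse (real (Suc n))" using rn by (intro add_left_mono le_imp_inverse_le) auto
          finally show "d j \<omega> (s (k (r n))) \<le> e + inverse (real (Suc n))" by simp
        qed
      qed
      then have "x = h \<omega>" using unique by blast
      then show "h \<omega> \<in> C" using x by simp
    qed
    then have "h -` C \<inter> space N = {\<omega> \<in> space N.
        \<forall>n::nat. \<exists>k. \<forall>j\<in>{- int n..int n}. d j \<omega> (s k) < e + inverse (real (Suc n))}" by auto
    moreover have "Measurable.pred N (\<lambda>\<omega>. \<forall>n::nat. \<exists>k. \<forall>j\<in>{- int n..int n}. d j \<omega> (s k) < e + inverse (real (Suc n)))"
      by (intro pred_intros_countable pred_intros_finite borel_measurable_less[THEN pred_def[THEN iffD2]] meas) auto
    ultimately show ?thesis by (simp add: pred_def)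
  qed simp
qed

section \<open>Two-sided orbits\<close>

definition zpow :: "('a \<Rightarrow> 'a) \<Rightarrow> int \<Rightarrow> 'a \<Rightarrow> 'a" where
  "zpow T j p = (if 0 \<le> j then (T ^^ nat j) p else (inv T ^^ nat (- j)) p)"

lemma zpow_0 [simp]: "zpow T 0 p = p"
  by (simp add: zpow_def)

lemma zpow_int [simp]: "zpow T (int n) p = (T ^^ n) p"
  by (simp add: zpow_def)

lemma zpow_succ:
  assumes "bij T"
  shows "zpow T (j + 1) p = T (zpow T j p)"
proof (cases "0 \<le> j")
  case True
  then show ?thesis by (simp add: zpow_def nat_add_distrib)
next
  case False
  then obtain n where n: "nat (- j) = Suc n" by (cases "nat (- j)") auto
  then have "T (zpow T j p) = (inv T ^^ n) p" using False assms by (simp add: zpow_def bij_is_surj surj_f_inv_f)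
  moreover have "zpow T (j + 1) p = (inv T ^^ n) p"
  proof (cases "j = -1")
    case True
    then show ?thesis using n by (simp add: zpow_def)
  next
    case False2: False
    then have "nat (- (j + 1)) = n" "\<not> 0 \<le> j + 1" using n False by auto
    then show ?thesis by (simp only: zpow_def if_False)
  qed
  ultimately show ?thesis by simp
qed

lemma zpow_unique:
  assumes T: "bij T" and u: "\<And>j. u (j + 1) = T (u j)"
  shows "u j = zpow T j (u 0)"
proof (induction j rule: int_induct[of _ 0])
  case base
  then show ?case by simp
next
  case (step1 i)
  then show ?case by (simp add: u zpow_succ[OF T])
next
  case (step2 i)
  have "T (u (i - 1)) = T (zpow T (i - 1) (u 0))"
    using step2 u[of "i - 1"] zpow_succ[OF T, of "i - 1" "u 0"] by simp
  then show ?case using T by (simp add: bij_def inj_eq)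
qed

lemma zpow_add:
  assumes "bij T"
  shows "zpow T (i + j) p = zpow T j (zpow T i p)"
proof -
  have "zpow T (i + (j + 1)) p = T (zpow T (i + j) p)" for j
    using zpow_succ[OF assms, of "i + j" p] by (simp add: add.assoc)
  from zpow_unique[OF assms, of "\<lambda>j. zpow T (i + j) p", OF this] show ?thesis by simp
qed

lemma continuous_on_zpow:
  assumes "continuous_on UNIV T" "continuous_on UNIV (inv T)"
  shows "continuous_on UNIV (zpow T j)"
proof -
  have pow: "continuous_on UNIV (S ^^ n)" if "continuous_on UNIV S" for S :: "'a::topological_space \<Rightarrow> 'a" and n
    by (induction n) (auto simp: o_def id_def intro: continuous_on_compose2[OF that])
  show ?thesis
    by (cases "0 \<le> j") (simp_all add: zpow_def[abs_def] pow assms)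
qed

section \<open>Random periodic points\<close>

context random_diffeo
begin

abbreviation \<phi> :: "'m \<times> 'w \<Rightarrow> 'm \<times> 'w" where
  "\<phi> \<equiv> skew_product f \<theta>"

definition cocycle :: "int \<Rightarrow> 'w \<Rightarrow> 'm \<Rightarrow> 'm" where
  "cocycle j \<omega> x = fst (zpow \<phi> j (x, \<omega>))"

lemma bij_\<theta>: "bij \<theta>"
  using \<theta>_homeo by (metis bijI' homeomorphism_apply1 homeomorphism_image1 UNIV_I imageE)

lemma bij_\<phi>: "bij \<phi>"
proof -
  have f: "bij (f \<omega>)" for \<omega> using f_Diff by (simp add: Diff_def)
  have "inj \<phi>"
  proof (rule injI)
    fix p q assume eq: "\<phi> p = \<phi> q"
    then have "snd p = snd q" using bij_is_inj[OF bij_\<theta>] by (simp add: skew_product_def case_prod_unfold inj_eq)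
    moreover from this have "fst p = fst q"
      using eq bij_is_inj[OF f] by (simp add: skew_product_def case_prod_unfold inj_eq)
    ultimately show "p = q" by (simp add: prod_eq_iff)
  qed
  moreover have "\<exists>p. q = \<phi> p" for q
  proof (cases q)
    case (Pair y \<eta>)
    obtain \<omega> where \<omega>: "\<eta> = \<theta> \<omega>" using bij_is_surj[OF bij_\<theta>] by (metis surjD)
    obtain x where "y = f \<omega> x" using bij_is_surj[OF f] by (metis surjD)
    then show ?thesis using \<omega> Pair by (intro exI[of _ "(x, \<omega>)"]) (simp add: skew_product_def)
  qed
  ultimately show ?thesis by (simp add: bij_def surj_def)
qed

lemma continuous_on_\<phi>: "continuous_on UNIV \<phi>"
proof -
  have "continuous_on UNIV \<theta>" using \<theta>_homeo by (simp add: homeomorphism_def)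
  then have "continuous_on UNIV (\<lambda>q::'m \<times> 'w. (f (snd q) (fst q), \<theta> (snd q)))"
    by (intro continuous_on_Pair continuous_on_f_joint continuous_on_compose2[of UNIV \<theta> UNIV snd] continuous_intros) auto
  then show ?thesis by (simp add: skew_product_def case_prod_unfold)
qed

lemma continuous_on_inv_\<phi>: "continuous_on UNIV (inv \<phi>)"
proof -
  have "compact (UNIV :: ('m \<times> 'w) set)" using compact_Times[OF compact_M compact_base] by simp
  from continuous_on_inv[OF continuous_on_\<phi> this, of "inv \<phi>"] show ?thesis
    using bij_is_inj[OF bij_\<phi>] bij_is_surj[OF bij_\<phi>] by simp
qed

lemma snd_zpow: "snd (zpow \<phi> j (x, \<omega>)) = zpow \<theta> j \<omega>"
proof -
  have "snd (zpow \<phi> j (x, \<omega>)) = zpow \<theta> j (snd (zpow \<phi> 0 (x, \<omega>)))"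
    by (rule zpow_unique[OF bij_\<theta>]) (simp add: zpow_succ[OF bij_\<phi>], simp add: skew_product_def split: prod.split)
  then show ?thesis by simp
qed

lemma zpow_skew: "zpow \<phi> j (x, \<omega>) = (cocycle j \<omega> x, zpow \<theta> j \<omega>)"
  by (rule prod_eqI) (simp_all add: cocycle_def snd_zpow)

lemma cocycle_0 [simp]: "cocycle 0 \<omega> x = x"
  by (simp add: cocycle_def)

lemma cocycle_succ: "cocycle (j + 1) \<omega> x = f (zpow \<theta> j \<omega>) (cocycle j \<omega> x)"
proof -
  have "cocycle (j + 1) \<omega> x = fst (\<phi> (zpow \<phi> j (x, \<omega>)))"
    by (simp only: cocycle_def zpow_succ[OF bij_\<phi>])
  also have "zpow \<phi> j (x, \<omega>) = (cocycle j \<omega> x, zpow \<theta> j \<omega>)" by (rule zpow_skew)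
  finally show ?thesis by (simp add: skew_product_def)
qed

lemma cocycle_unique:
  assumes y: "\<And>j. y (j + 1) = f (zpow \<theta> j \<omega>) (y j)"
  shows "y j = cocycle j \<omega> (y 0)"
proof -
  have "(y j, zpow \<theta> j \<omega>) = zpow \<phi> j (y 0, zpow \<theta> 0 \<omega>)"
    by (rule zpow_unique[OF bij_\<phi>]) (simp add: y zpow_succ[OF bij_\<theta>] skew_product_def)
  from arg_cong[OF this, of fst] show ?thesis by (simp add: cocycle_def)
qed

lemma continuous_on_cocycle:
  assumes "continuous_on S p" "continuous_on S q"
  shows "continuous_on S (\<lambda>t. cocycle j (p t) (q t))"
proof -
  have "continuous_on S (\<lambda>t. zpow \<phi> j (q t, p t))"
    by (rule continuous_on_compose2[OF continuous_on_zpow[OF continuous_on_\<phi> continuous_on_inv_\<phi>]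
          continuous_on_Pair[OF assms(2,1)] subset_UNIV])
  then show ?thesis unfolding cocycle_def by (rule continuous_on_fst)
qed

lemma continuous_on_zpow_\<theta>: "continuous_on UNIV (zpow \<theta> j)"
  using \<theta>_homeo by (intro continuous_on_zpow) (auto simp: homeomorphism_def)

lemma Linfty_shift:
  fixes g :: "'w \<Rightarrow> 'm"
  assumes "g \<in> Linfty"
  shows "(\<lambda>\<omega>. g (zpow \<theta> j \<omega>)) \<in> Linfty"
proof -
  have "zpow \<theta> j \<in> borel_measurable borel"
    by (rule borel_measurable_continuous_onI[OF continuous_on_zpow_\<theta>])
  from measurable_compose[OF this] assms show ?thesis unfolding Linfty_def by blast
qed

lemma Linfty_cocycle:
  assumes g: "g \<in> Linfty"
  shows "(\<lambda>\<omega>. cocycle i (zpow \<theta> j \<omega>) (g \<omega>)) \<in> Linfty"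
  unfolding Linfty_def
proof (rule measurable_Caratheodory_comp[OF compact_M, where H = "\<lambda>\<omega>. cocycle i (zpow \<theta> j \<omega>)" and g = g])
  show "g \<in> borel_measurable borel" using g by (simp add: Linfty_def)
  show "(\<lambda>\<omega>. cocycle i (zpow \<theta> j \<omega>) x) \<in> borel_measurable borel" for x
    by (intro borel_measurable_continuous_onI continuous_on_cocycle continuous_on_zpow_\<theta> continuous_on_const)
  show "continuous_on UNIV (cocycle i (zpow \<theta> j \<omega>))" for \<omega>
    using continuous_on_cocycle[of UNIV "\<lambda>_. zpow \<theta> j \<omega>" "\<lambda>x. x" i] by simp
qed

lemma measurable_dist_Linfty:
  fixes p :: "'w \<Rightarrow> 'm"
  assumes p: "p \<in> Linfty" and g: "g \<in> Linfty"
  shows "(\<lambda>\<omega>. dist (p \<omega>) (g \<omega>)) \<in> borel_measurable borel"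
proof (rule measurable_Caratheodory_comp[OF compact_M, where H = "\<lambda>\<omega>. dist (p \<omega>)" and g = g])
  show "g \<in> borel_measurable borel" using g by (simp add: Linfty_def)
  show "(\<lambda>\<omega>. dist (p \<omega>) x) \<in> borel_measurable borel" for x
  proof (rule measurable_compose[where f = p and g = "\<lambda>y. dist y x" and N = borel])
    show "p \<in> borel_measurable borel" using p by (simp add: Linfty_def)
    show "(\<lambda>y. dist y x) \<in> borel_measurable borel"
      by (intro borel_measurable_continuous_onI continuous_intros)
  qed
  show "continuous_on UNIV (dist (p \<omega>))" for \<omega> by (intro continuous_intros)
qed

text \<open>Mixing is uniform in the fibre. A finite cover by balls of radius \<open>\<delta> / 2\<close> makes it uniform in the two
points as well.\<close>

lemma uniform_mixing:
  assumes mix: "mixing_on_fibers f \<theta>" and \<delta>: "0 < \<delta>"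
  obtains N :: nat where "0 < N" "\<And>n \<omega> a b. N \<le> n \<Longrightarrow> \<exists>x. dist x a < \<delta> \<and> dist (cocycle (int n) \<omega> x) b < \<delta>"
proof -
  obtain K :: "'m set" where K: "finite K" "UNIV \<subseteq> (\<Union>p\<in>K. ball p (\<delta> / 2))"
    using seq_compact_imp_totally_bounded[OF compact_imp_seq_compact[OF compact_M]] \<delta> by (meson half_gt_zero)
  have "\<forall>\<^sub>F n in sequentially. \<forall>p\<in>K. \<forall>q\<in>K. \<forall>\<omega>. \<exists>x. dist p x < \<delta> / 2 \<and> dist q (cocycle (int n) \<omega> x) < \<delta> / 2"
  proof (intro eventually_ball_finite K ballI)
    fix p q :: 'm
    have "open (ball p (\<delta> / 2)) \<and> ball p (\<delta> / 2) \<noteq> {} \<and> open (ball q (\<delta> / 2)) \<and> ball q (\<delta> / 2) \<noteq> {}"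
      using \<delta> by simp
    then obtain N where N: "\<And>n \<omega>. N \<le> n \<Longrightarrow>
        (\<phi> ^^ n) ` (ball p (\<delta> / 2) \<times> {\<omega>}) \<inter> ball q (\<delta> / 2) \<times> {(\<theta> ^^ n) \<omega>} \<noteq> {}"
      using mix unfolding mixing_on_fibers_def by meson
    have "\<exists>x. dist p x < \<delta> / 2 \<and> dist q (cocycle (int n) \<omega> x) < \<delta> / 2" if n: "N \<le> n" for n \<omega>
    proof -
      obtain t where t: "t \<in> (\<phi> ^^ n) ` (ball p (\<delta> / 2) \<times> {\<omega>})" "fst t \<in> ball q (\<delta> / 2)"
        using N[OF n, of \<omega>] by (metis Int_iff ex_in_conv mem_Times_iff)
      then obtain x where "x \<in> ball p (\<delta> / 2)" "t = (\<phi> ^^ n) (x, \<omega>)" by (elim imageE SigmaE) simp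
      with t(2) show ?thesis by (intro exI[of _ x]) (simp add: cocycle_def mem_Times_iff)
    qed
    then show "\<forall>\<^sub>F n in sequentially. \<forall>\<omega>. \<exists>x. dist p x < \<delta> / 2 \<and> dist q (cocycle (int n) \<omega> x) < \<delta> / 2"
      unfolding eventually_sequentially by blast
  qed
  then obtain N where N: "\<And>n p q \<omega>. \<lbrakk>N \<le> n; p \<in> K; q \<in> K\<rbrakk> \<Longrightarrow>
      \<exists>x. dist p x < \<delta> / 2 \<and> dist q (cocycle (int n) \<omega> x) < \<delta> / 2"
    unfolding eventually_sequentially by blast
  show ?thesis
  proof (rule that[of "Suc N"])
    fix n \<omega> a b assume n: "Suc N \<le> n"
    have "\<exists>p\<in>K. dist p y < \<delta> / 2" for y using subsetD[OF K(2) UNIV_I, of y] by simp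
    then obtain p q where p: "p \<in> K" "dist p a < \<delta> / 2" and q: "q \<in> K" "dist q b < \<delta> / 2" by meson
    obtain x where x: "dist p x < \<delta> / 2" "dist q (cocycle (int n) \<omega> x) < \<delta> / 2"
      using N[OF Suc_leD[OF n] p(1) q(1)] by blast
    show "\<exists>x. dist x a < \<delta> \<and> dist (cocycle (int n) \<omega> x) b < \<delta>"
      using dist_triangle_half_r[OF x(1) p(2)] dist_triangle_half_r[OF x(2) q(2)] by (intro exI[of _ x]) simp
  qed simp
qed

text \<open>The condition on the connecting point is open, so it can be chosen as the first suitable member of a
dense sequence.\<close>

lemma measurable_connection:
  assumes g: "g \<in> Linfty" and \<delta>: "0 < \<delta>"
    and mix: "\<And>\<omega> a b. \<exists>x. dist x a < \<delta> \<and> dist (cocycle (int n) \<omega> x) b < \<delta>"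
  obtains z where "z \<in> Linfty" "\<And>\<omega>. dist (z \<omega>) (g \<omega>) < \<delta>"
    "\<And>\<omega>. dist (cocycle (int n) \<omega> (z \<omega>)) (g (zpow \<theta> (int n) \<omega>)) < \<delta>"
proof -
  obtain s :: "nat \<Rightarrow> 'm" where s: "\<And>x e. 0 < e \<Longrightarrow> \<exists>k. dist (s k) x < e"
    using compact_dense_sequence[OF compact_M] by auto
  define Q where "Q k \<omega> \<longleftrightarrow> dist (s k) (g \<omega>) < \<delta> \<and> dist (cocycle (int n) \<omega> (s k)) (g (zpow \<theta> (int n) \<omega>)) < \<delta>" for k \<omega>
  have ex: "\<exists>k. Q k \<omega>" for \<omega>
  proof -
    obtain x where x: "dist x (g \<omega>) < \<delta>" "dist (cocycle (int n) \<omega> x) (g (zpow \<theta> (int n) \<omega>)) < \<delta>"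
      using mix by blast
    have "continuous_on UNIV (\<lambda>y. cocycle (int n) \<omega> y)" by (intro continuous_on_cocycle continuous_intros)
    then have "open {y. dist y (g \<omega>) < \<delta> \<and> dist (cocycle (int n) \<omega> y) (g (zpow \<theta> (int n) \<omega>)) < \<delta>}"
      by (intro open_Collect_conj open_Collect_less continuous_intros)
    then obtain r where r: "0 < r"
      "ball x r \<subseteq> {y. dist y (g \<omega>) < \<delta> \<and> dist (cocycle (int n) \<omega> y) (g (zpow \<theta> (int n) \<omega>)) < \<delta>}"
      using x open_contains_ball by blast
    obtain k where "dist (s k) x < r" using s[OF r(1)] by blast
    then have "s k \<in> ball x r" by (simp add: dist_commute)
    then show ?thesis using r(2) unfolding Q_def by blast
  qed
  define z where "z \<omega> = s (LEAST k. Q k \<omega>)" for \<omega>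
  have Q: "Q (LEAST k. Q k \<omega>) \<omega>" for \<omega> by (rule LeastI_ex[OF ex])
  have "(\<lambda>\<omega>. dist (s k) (g \<omega>)) \<in> borel_measurable borel" for k
    by (rule measurable_dist_Linfty[OF _ g]) (simp add: Linfty_def)
  moreover have "(\<lambda>\<omega>. dist (cocycle (int n) \<omega> (s k)) (g (zpow \<theta> (int n) \<omega>))) \<in> borel_measurable borel" for k
    by (rule measurable_dist_Linfty[OF _ Linfty_shift[OF g]])
       (unfold Linfty_def, intro borel_measurable_continuous_onI continuous_on_cocycle continuous_on_id continuous_on_const)
  ultimately have "Measurable.pred borel (Q k)" for k
    unfolding Q_def[abs_def]
    by (intro pred_intros_logic borel_measurable_less[THEN pred_def[THEN iffD2]] borel_measurable_const)
  then have "(\<lambda>\<omega>. LEAST k. Q k \<omega>) \<in> measurable borel (count_space UNIV)"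
    by (rule measurable_Least)
  then have "z \<in> Linfty"
    unfolding Linfty_def z_def[abs_def]
    by (rule measurable_compose_countable[of "\<lambda>k \<omega>. s k", rotated]) simp
  moreover have "dist (z \<omega>) (g \<omega>) < \<delta>"
    and "dist (cocycle (int n) \<omega> (z \<omega>)) (g (zpow \<theta> (int n) \<omega>)) < \<delta>" for \<omega>
    using Q[of \<omega>] unfolding Q_def[of "LEAST k. Q k \<omega>"] z_def by blast+
  ultimately show ?thesis by (rule that)
qed

end

context anosov_splitting
begin

text \<open>Near \<open>g \<omega>\<close> there is a point \<open>z \<omega>\<close> whose \<open>n\<close>-th iterate is near \<open>g (\<theta>\<^sup>n \<omega>)\<close>. The pseudo-orbit \<open>X \<omega>\<close>
follows the orbit of \<open>z\<close> for \<open>n\<close> steps at a time, and jumps to \<open>z\<close> again at each multiple of \<open>n\<close>. It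
is equivariant under the shift by \<open>n\<close>, hence so is the unique orbit \<open>Y \<omega>\<close> that shadows it, which makes
its starting point \<open>h \<omega>\<close> periodic.\<close>

lemma random_periodic_point_near:
  assumes mix: "mixing_on_fibers f \<theta>" and \<epsilon>: "0 < \<epsilon>"
  shows "\<exists>N::nat. \<forall>g\<in>Linfty. \<forall>n\<ge>N. \<exists>h\<in>Linfty. random_periodic_point f \<theta> n h \<and> Linfty_dist g h \<le> \<epsilon>"
proof -
  obtain e0 where e0: "0 < e0 \<and> (\<forall>e. 0 < e \<longrightarrow> e \<le> e0 \<longrightarrow> (\<exists>\<delta>>0. \<forall>w x.
     (\<forall>j::int. w (j + 1) = \<theta> (w j) \<and> dist (f (w j) (x j)) (x (j + 1)) < \<delta>) \<longrightarrow>
     (\<exists>!y. \<forall>j. y (j + 1) = f (w j) (y j) \<and> dist (x j) (y j) \<le> e)))"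
    using shadowing by (rule exE)
  define e where "e = min e0 (\<epsilon> / 2)"
  have e: "0 < e" "e \<le> e0" "e \<le> \<epsilon> / 2" using e0 \<epsilon> by (simp_all add: e_def)
  obtain \<delta> where \<delta>': "0 < \<delta> \<and> (\<forall>w x.
     (\<forall>j::int. w (j + 1) = \<theta> (w j) \<and> dist (f (w j) (x j)) (x (j + 1)) < \<delta>) \<longrightarrow>
     (\<exists>!y. \<forall>j. y (j + 1) = f (w j) (y j) \<and> dist (x j) (y j) \<le> e))"
    using e0[THEN conjunct2, THEN spec, THEN mp, OF e(1), THEN mp, OF e(2)] by (rule exE)
  note \<delta> = \<delta>'[THEN conjunct1]
    and unique = \<delta>'[THEN conjunct2, THEN spec, THEN spec, THEN mp]
  define \<beta> where "\<beta> = min (\<delta> / 2) (\<epsilon> / 2)"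
  have \<beta>: "0 < \<beta>" "\<beta> + \<beta> \<le> \<delta>" "\<beta> \<le> \<epsilon> / 2" using \<delta> \<epsilon> by (auto simp: \<beta>_def)
  obtain N :: nat where N: "0 < N"
    "\<And>n \<omega> a b. N \<le> n \<Longrightarrow> \<exists>x. dist x a < \<beta> \<and> dist (cocycle (int n) \<omega> x) b < \<beta>"
    using uniform_mixing[OF mix \<beta>(1)] by blast
  have "\<exists>h\<in>Linfty. random_periodic_point f \<theta> n h \<and> Linfty_dist g h \<le> \<epsilon>"
    if g: "g \<in> Linfty" and n: "N \<le> n" for g n
  proof -
    have n0: "0 < n" using n N(1) by simp
    obtain z where z: "z \<in> Linfty" "\<And>\<omega>. dist (z \<omega>) (g \<omega>) < \<beta>"
      "\<And>\<omega>. dist (cocycle (int n) \<omega> (z \<omega>)) (g (zpow \<theta> (int n) \<omega>)) < \<beta>"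
      using measurable_connection[OF g \<beta>(1) N(2)[OF n]] by blast
    define X where "X \<omega> j = cocycle (j mod int n) (zpow \<theta> (j - j mod int n) \<omega>) (z (zpow \<theta> (j - j mod int n) \<omega>))"
      for \<omega> j
    have X_shift: "X (zpow \<theta> (int n) \<omega>) j = X \<omega> (j + int n)" for \<omega> j
    proof -
      have "zpow \<theta> (j - j mod int n) (zpow \<theta> (int n) \<omega>) = zpow \<theta> (j + int n - (j + int n) mod int n) \<omega>"
        using zpow_add[OF bij_\<theta>, of "int n" "j - j mod int n" \<omega>] by (simp add: algebra_simps)
      then show ?thesis by (simp add: X_def)
    qed
    have jump: "dist (f (zpow \<theta> j \<omega>) (X \<omega> j)) (X \<omega> (j + 1)) < \<delta>" for \<omega> j
    proof -
      define i where "i = j mod int n"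
      define \<eta> where "\<eta> = zpow \<theta> (j - i) \<omega>"
      have i: "0 \<le> i" "i < int n" using n0 by (simp_all add: i_def)
      have \<eta>i: "zpow \<theta> i \<eta> = zpow \<theta> j \<omega>"
        using zpow_add[OF bij_\<theta>, of "j - i" i \<omega>] by (simp add: \<eta>_def)
      have step: "f (zpow \<theta> j \<omega>) (X \<omega> j) = cocycle (i + 1) \<eta> (z \<eta>)"
        by (simp add: cocycle_succ \<eta>i X_def i_def[symmetric] \<eta>_def[symmetric])
      have mod: "(j + 1) mod int n = (i + 1) mod int n" by (simp add: i_def mod_simps)
      show ?thesis
      proof (cases "i + 1 = int n")
        case False
        then have "(j + 1) mod int n = i + 1" using i mod by simp
        then have "X \<omega> (j + 1) = cocycle (i + 1) \<eta> (z \<eta>)" by (simp add: X_def \<eta>_def)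
        then show ?thesis using step \<delta> by simp
      next
        case True
        then have "(j + 1) mod int n = 0" using mod by simp
        moreover have "j - i + int n = j + 1" using True by simp
        then have "zpow \<theta> (j + 1) \<omega> = zpow \<theta> (int n) \<eta>"
          by (simp only: \<eta>_def zpow_add[OF bij_\<theta>, symmetric])
        ultimately have "X \<omega> (j + 1) = z (zpow \<theta> (int n) \<eta>)" by (simp add: X_def)
        moreover have "f (zpow \<theta> j \<omega>) (X \<omega> j) = cocycle (int n) \<eta> (z \<eta>)" using step True by simp
        ultimately show ?thesis
          using z(3)[of \<eta>] z(2)[of "zpow \<theta> (int n) \<eta>"] \<beta>(2)
            dist_triangle2[of "cocycle (int n) \<eta> (z \<eta>)" "z (zpow \<theta> (int n) \<eta>)" "g (zpow \<theta> (int n) \<eta>)"] by simp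
      qed
    qed
    have ex1: "\<exists>!y. \<forall>j. y (j + 1) = f (zpow \<theta> j \<omega>) (y j) \<and> dist (X \<omega> j) (y j) \<le> e" for \<omega>
      by (rule unique) (simp add: jump zpow_succ[OF bij_\<theta>])
    have "\<exists>Y. \<forall>\<omega> j. Y \<omega> (j + 1) = f (zpow \<theta> j \<omega>) (Y \<omega> j) \<and> dist (X \<omega> j) (Y \<omega> j) \<le> e"
      by (intro choice allI ex1_implies_ex ex1)
    then obtain Y where Y: "\<And>\<omega> j. Y \<omega> (j + 1) = f (zpow \<theta> j \<omega>) (Y \<omega> j)" "\<And>\<omega> j. dist (X \<omega> j) (Y \<omega> j) \<le> e"
      by blast
    define h where "h \<omega> = Y \<omega> 0" for \<omega>
    have Y_cocycle: "Y \<omega> j = cocycle j \<omega> (h \<omega>)" for \<omega> j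
      unfolding h_def by (rule cocycle_unique) (rule Y(1))
    have h_unique: "(\<forall>j. dist (X \<omega> j) (cocycle j \<omega> x) \<le> e) \<longleftrightarrow> x = h \<omega>" for \<omega> x
    proof
      assume x: "\<forall>j. dist (X \<omega> j) (cocycle j \<omega> x) \<le> e"
      from ex1[of \<omega>] have "(\<lambda>j. cocycle j \<omega> x) = Y \<omega>"
      proof (rule ex1E)
        fix y
        assume "\<forall>y'. (\<forall>j. y' (j + 1) = f (zpow \<theta> j \<omega>) (y' j) \<and> dist (X \<omega> j) (y' j) \<le> e) \<longrightarrow> y' = y"
        note * = this[THEN spec, THEN mp]
        have "(\<lambda>j. cocycle j \<omega> x) = y" by (rule *) (use x in \<open>simp add: cocycle_succ\<close>)
        moreover have "Y \<omega> = y" by (rule *) (use Y in simp)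
        ultimately show ?thesis by simp
      qed
      then show "x = h \<omega>" unfolding h_def by (metis cocycle_0)
    next
      assume "x = h \<omega>"
      then show "\<forall>j. dist (X \<omega> j) (cocycle j \<omega> x) \<le> e" using Y(2)[of \<omega>] by (simp add: Y_cocycle)
    qed
    have X_meas: "(\<lambda>\<omega>. X \<omega> j) \<in> Linfty" for j
      unfolding X_def by (rule Linfty_cocycle[OF Linfty_shift[OF z(1)]])
    have h: "h \<in> Linfty"
      unfolding Linfty_def
    proof (rule measurable_unique_solution[OF compact_M _ _ h_unique])
      show "(\<lambda>\<omega>. dist (X \<omega> j) (cocycle j \<omega> x)) \<in> borel_measurable borel" for j x
        by (rule measurable_dist_Linfty[OF X_meas])
           (unfold Linfty_def, intro borel_measurable_continuous_onI continuous_on_cocycle continuous_on_id continuous_on_const)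
      show "continuous_on UNIV (\<lambda>x. dist (X \<omega> j) (cocycle j \<omega> x))" for j \<omega>
        by (intro continuous_intros continuous_on_cocycle)
    qed
    have h_periodic: "h (zpow \<theta> (int n) \<omega>) = cocycle (int n) \<omega> (h \<omega>)" for \<omega>
    proof -
      have "dist (X (zpow \<theta> (int n) \<omega>) j) (cocycle j (zpow \<theta> (int n) \<omega>) (cocycle (int n) \<omega> (h \<omega>))) \<le> e" for j
      proof -
        have "zpow \<phi> (int n + j) (h \<omega>, \<omega>) = zpow \<phi> j (zpow \<phi> (int n) (h \<omega>, \<omega>))" by (rule zpow_add[OF bij_\<phi>])
        then have "cocycle (int n + j) \<omega> (h \<omega>) = cocycle j (zpow \<theta> (int n) \<omega>) (cocycle (int n) \<omega> (h \<omega>))"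
          unfolding zpow_skew by simp
        then show ?thesis using Y(2)[of \<omega> "int n + j"] by (simp only: X_shift Y_cocycle add.commute)
      qed
      then show ?thesis using h_unique[of "zpow \<theta> (int n) \<omega>" "cocycle (int n) \<omega> (h \<omega>)"] by simp
    qed
    have inv\<theta>: "inv \<theta> = zpow \<theta> (- 1)" by (simp add: zpow_def fun_eq_iff)
    \<comment> \<open>The members of the periodic orbit of \<open>h\<close>.\<close>
    define G' where "G' k = (graph_transform f \<theta> ^^ k) h" for k
    have G'_eq: "G' k \<omega> = cocycle (int k) (zpow \<theta> (- int k) \<omega>) (h (zpow \<theta> (- int k) \<omega>))" for k \<omega>
    proof (induction k arbitrary: \<omega>)
      case 0
      then show ?case by (simp add: G'_def)
    next
      case (Suc k)
      let ?\<eta> = "zpow \<theta> (- int (Suc k)) \<omega>"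
      have 1: "zpow \<theta> (- int k) (zpow \<theta> (- 1) \<omega>) = ?\<eta>"
        using zpow_add[OF bij_\<theta>, of "- 1" "- int k" \<omega>] by simp
      have 2: "zpow \<theta> (int k) ?\<eta> = zpow \<theta> (- 1) \<omega>"
        using zpow_add[OF bij_\<theta>, of "- int (Suc k)" "int k" \<omega>] by simp
      have "G' (Suc k) \<omega> = f (zpow \<theta> (- 1) \<omega>) (G' k (zpow \<theta> (- 1) \<omega>))"
        by (simp add: G'_def graph_transform_def inv\<theta>)
      also have "\<dots> = f (zpow \<theta> (int k) ?\<eta>) (cocycle (int k) ?\<eta> (h ?\<eta>))" by (simp only: Suc 1 2)
      also have "\<dots> = cocycle (int k + 1) ?\<eta> (h ?\<eta>)" by (simp only: cocycle_succ)
      finally show ?case by (simp add: add.commute)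
    qed
    have G'_Linfty: "G' k \<in> Linfty" for k
    proof -
      have "G' k = (\<lambda>\<omega>. cocycle (int k) (zpow \<theta> (- int k) \<omega>) (h (zpow \<theta> (- int k) \<omega>)))" using G'_eq by blast
      then show ?thesis using Linfty_cocycle[OF Linfty_shift[OF h]] by metis
    qed
    have G'_n: "G' n = h"
    proof
      fix \<omega>
      have "zpow \<theta> (int n) (zpow \<theta> (- int n) \<omega>) = \<omega>"
        using zpow_add[OF bij_\<theta>, of "- int n" "int n" \<omega>] by simp
      then show "G' n \<omega> = h \<omega>" using h_periodic[of "zpow \<theta> (- int n) \<omega>"] by (simp only: G'_eq)
    qed
    have "random_periodic_orbit f \<theta> n (\<lambda>i. G' (i - 1))"
      unfolding random_periodic_orbit_def
    proof (intro ballI conjI G'_Linfty)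
      fix i assume i: "i \<in> {1..n}"
      have "graph_transform f \<theta> (G' (i - 1)) = G' i"
        using i by (cases i) (auto simp: G'_def)
      moreover have "G' i = G' (i mod n + 1 - 1)"
        using i G'_n by (cases "i = n") (simp_all add: G'_def)
      ultimately show "graph_transform f \<theta> (G' (i - 1)) = G' (i mod n + 1 - 1)" by simp
    qed
    moreover have "h = G' (1 - 1)" "1 \<in> {1..n}" using n0 by (simp_all add: G'_def)
    ultimately have "random_periodic_point f \<theta> n h" unfolding random_periodic_point_def by metis
    moreover have "Linfty_dist g h \<le> \<epsilon>"
      unfolding Linfty_dist_def
    proof (rule cSUP_least)
      fix \<omega>
      have "dist (z \<omega>) (h \<omega>) \<le> e" using Y(2)[of \<omega> 0] by (simp add: X_def h_def)
      then show "dist (g \<omega>) (h \<omega>) \<le> \<epsilon>"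
        using z(2)[of \<omega>] dist_triangle3[of "g \<omega>" "h \<omega>" "z \<omega>"] e(3) \<beta>(3) by (simp add: dist_commute)
    qed simp
    ultimately show ?thesis using h by blast
  qed
  then show ?thesis by blast
qed

end

theorem theoremA:
  fixes A :: "('m::metric_space, 'e::euclidean_space) chart set"
    and G :: "'m \<Rightarrow> 'e \<Rightarrow> 'e \<Rightarrow> real"
    and \<theta> :: "'w::metric_space \<Rightarrow> 'w"
    and f :: "'w \<Rightarrow> 'm \<Rightarrow> 'm"
  assumes "compact (UNIV :: 'm set)" and "connected (UNIV :: 'm set)"
    and "smooth_atlas A" and "riemannian_metric A G"
    and "\<And>x y. dist x y = riemannian_distance A G x y"
    and "compact (UNIV :: 'w set)"
    and "homeomorphism UNIV UNIV \<theta> (inv \<theta>)"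
    and "continuous_map euclidean (Diff_topology 2 A) f"
    and "anosov_on_fibers A G f \<theta>"
    and "mixing_on_fibers f \<theta>"
  shows "\<forall>\<epsilon>>0. \<exists>N::nat. \<forall>g\<in>Linfty. \<forall>n\<ge>N.
           \<exists>h\<in>Linfty. random_periodic_point f \<theta> n h \<and> Linfty_dist g h \<le> \<epsilon>"
proof -
  obtain Eu Es :: "'m \<times> 'w \<Rightarrow> 'e set" and \<kappa> where
    splitting: "\<forall>p. subspace (Eu p) \<and> subspace (Es p) \<and>
           Eu p \<inter> Es p = {0} \<and> {u + s | u s. u \<in> Eu p \<and> s \<in> Es p} = UNIV \<and>
           0 < dim (Eu p) \<and> 0 < dim (Es p)"
    and cont: "continuous_subbundle A Eu" "continuous_subbundle A Es"
    and inv: "\<forall>x \<omega>. tangent_map A (f \<omega>) x ` Eu (x, \<omega>) = Eu (skew_product f \<theta> (x, \<omega>)) \<and>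
               tangent_map A (f \<omega>) x ` Es (x, \<omega>) = Es (skew_product f \<theta> (x, \<omega>))"
    and \<kappa>: "\<kappa> > 0" and hyp: "\<forall>x \<omega>.
           (\<forall>\<xi>\<in>Eu (x, \<omega>). tangent_norm G (f \<omega> x) (tangent_map A (f \<omega>) x \<xi>)
                              \<ge> exp \<kappa> * tangent_norm G x \<xi>) \<and>
           (\<forall>\<eta>\<in>Es (x, \<omega>). tangent_norm G (f \<omega> x) (tangent_map A (f \<omega>) x \<eta>)
                              \<le> exp (- \<kappa>) * tangent_norm G x \<eta>)"
    using assms(9) unfolding anosov_on_fibers_def by (elim exE conjE) (rule that)
  interpret anosov_splitting A G \<theta> f Eu Es \<kappa>
  proof (intro anosov_splitting.intro random_diffeo.intro manifold.intro random_diffeo_axioms.intro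
      anosov_splitting_axioms.intro)
    show "complementary (Eu p) (Es p)" for p using splitting[THEN spec, of p] by (simp only: complementary_def)
    show "tangent_map A (f \<omega>) x ` Eu (x, \<omega>) = Eu (f \<omega> x, \<theta> \<omega>)" for \<omega> x
      using inv[THEN spec, THEN spec, THEN conjunct1, of \<omega> x] by (simp only: skew_product_def prod.case)
    show "tangent_map A (f \<omega>) x ` Es (x, \<omega>) = Es (f \<omega> x, \<theta> \<omega>)" for \<omega> x
      using inv[THEN spec, THEN spec, THEN conjunct2, of \<omega> x] by (simp only: skew_product_def prod.case)
    show "exp \<kappa> * tangent_norm G x \<xi> \<le> tangent_norm G (f \<omega> x) (tangent_map A (f \<omega>) x \<xi>)"
      if "\<xi> \<in> Eu (x, \<omega>)" for \<xi> x \<omega>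
      by (rule bspec[OF hyp[THEN spec, THEN spec, THEN conjunct1] that])
    show "tangent_norm G (f \<omega> x) (tangent_map A (f \<omega>) x \<eta>) \<le> exp (- \<kappa>) * tangent_norm G x \<eta>"
      if "\<eta> \<in> Es (x, \<omega>)" for \<eta> x \<omega>
      by (rule bspec[OF hyp[THEN spec, THEN spec, THEN conjunct2] that])
  qed (rule assms(1) assms(3) assms(4) assms(6) assms(7) assms(8) cont \<kappa>)+
  show ?thesis by (intro allI impI) (rule random_periodic_point_near[OF assms(10)])
qed

end
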